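(* Assume that for each $j\in\{1,\dots,k\}$ the running cost is $f_j(x)=a_j|x|^2+b_j$ with $a_j>0$ and $b_j\ge 0$, that $p_j=2$ (so $q_j=2$), and that the matrix $M=(M_{j\ell})_{j,\ell=1}^k$, $M_{j\ell}:=\delta_j\mathbf{1}_{\{j=\ell\}}-\alpha_{j\ell}$, is an M-matrix (i.e. $M^{-1}$ exists and has non-negative entries). Then the unique solution $u=(u_1,\dots,u_k)\in\mathcal{A}^k$ of the system $$-\frac{\sigma_j^2}{2}\Delta u_j+\frac12|\nabla u_j|^2+\delta_j u_j-\sum_{\ell=1}^k\alpha_{j\ell}u_\ell=f_j(x)\quad\text{in }\mathbb{R}^N,\qquad j=1,\dots,k,$$ has the form $$u_j(x)=\beta_j|x|^2+\eta_j,\qquad j=1,\dots,k,$$ where the coefficients $\beta_j>0$ and $\eta_j\ge 0$ are uniquely determined by the two algebraic systems $$2\beta_j^2+\delta_j\beta_j-\sum_{\ell=1}^k\alpha_{j\ell}\beta_\ell=a_j,\qquad j=1,\dots,k,$$ $$\delta_j\eta_j-\sum_{\ell=1}^k\alpha_{j\ell}\eta_\ell=b_j+N\sigma_j^2\beta_j,\qquad j=1,\dots,k.$$ That is, the first system has exactly one solution $(\beta_1,\dots,\beta_k)\in(0,\infty)^k$, and for this $\beta$ the second (linear) system has exactly one solution $(\eta_1,\dots,\eta_k)$, which satisfies $\eta_j\ge 0$ for all $j$.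
   Context: Let $N,k\ge 1$ be integers. The matrix $(\alpha_{j\ell})_{j,\ell=1}^k$ is real with $\alpha_{j\ell}\ge 0$ for $j\ne\ell$, $\alpha_{jj}=-\sum_{\ell\ne j}\alpha_{j\ell}$ for all $j$, and is irreducible (it is the generator of an irreducible continuous-time Markov chain on $\{1,\dots,k\}$). For each $j$: $\sigma_j>0$ and $\delta_j>0$. Admissible class (here with all exponents $q_j=2$): $u=(u_1,\dots,u_k)\in\mathcal{A}^k$ if for each $j$, $u_j\in W^{2,m}_{\mathrm{loc}}(\mathbb{R}^N)$ for all $m>N$ and $\liminf_{|x|\to\infty}u_j(x)|x|^{-2}\ge 0$. A solution in $\mathcal{A}^k$ satisfies the equations almost everywhere. *)

theory Defs
  imports "HOL-Analysis.Analysis"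
begin

section \<open>Test functions\<close>

fun iterated_partial :: "'a::euclidean_space list \<Rightarrow> ('a \<Rightarrow> real) \<Rightarrow> 'a \<Rightarrow> real" where
  "iterated_partial [] \<phi> = \<phi>"
| "iterated_partial (i # is) \<phi> = (\<lambda>x. frechet_derivative (iterated_partial is \<phi>) (at x) i)"

text \<open>Differentiability of all iterated partial derivatives also makes all of them continuous, so
  this is membership in \<open>C\<^sup>\<infinity>\<close>.\<close>

definition smooth :: "('a::euclidean_space \<Rightarrow> real) \<Rightarrow> bool" where
  "smooth \<phi> \<longleftrightarrow> (\<forall>is. set is \<subseteq> Basis \<longrightarrow> (\<forall>x. iterated_partial is \<phi> differentiable (at x)))"

definition test_function :: "('a::euclidean_space \<Rightarrow> real) \<Rightarrow> bool" where
  "test_function \<phi> \<longleftrightarrow> smooth \<phi> \<and> compact (closure {x. \<phi> x \<noteq> 0})"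


section \<open>Local Lebesgue and Sobolev spaces\<close>

definition loc_Lp :: "real \<Rightarrow> ('a::euclidean_space \<Rightarrow> 'b::euclidean_space) \<Rightarrow> bool" where
  "loc_Lp m f \<longleftrightarrow> f \<in> borel_measurable lebesgue \<and>
     (\<forall>K. compact K \<longrightarrow> set_integrable lebesgue K (\<lambda>x. norm (f x) powr m))"

definition weak_gradient :: "('a::euclidean_space \<Rightarrow> real) \<Rightarrow> ('a \<Rightarrow> 'a) \<Rightarrow> bool" where
  "weak_gradient u G \<longleftrightarrow> loc_Lp 1 u \<and> loc_Lp 1 G \<and>
     (\<forall>\<phi>. test_function \<phi> \<longrightarrow> (\<forall>i\<in>Basis.
        (LINT x|lebesgue. u x * frechet_derivative \<phi> (at x) i) =
        - (LINT x|lebesgue. (G x \<bullet> i) * \<phi> x)))"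

text \<open>\<open>H i\<close> is the weak gradient of the partial derivative \<open>\<partial>\<^sub>i u\<close>, so that \<open>H i x \<bullet> j\<close> is
  \<open>\<partial>\<^sub>j \<partial>\<^sub>i u\<close>. Weak derivatives are determined only almost everywhere and are therefore treated
  as relations.\<close>

definition weak_derivatives2 ::
    "('a::euclidean_space \<Rightarrow> real) \<Rightarrow> ('a \<Rightarrow> 'a) \<Rightarrow> ('a \<Rightarrow> 'a \<Rightarrow> 'a) \<Rightarrow> bool" where
  "weak_derivatives2 u G H \<longleftrightarrow>
     weak_gradient u G \<and> (\<forall>i\<in>Basis. weak_gradient (\<lambda>x. G x \<bullet> i) (H i))"

definition laplacian_of :: "('a::euclidean_space \<Rightarrow> 'a \<Rightarrow> 'a) \<Rightarrow> 'a \<Rightarrow> real" where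
  "laplacian_of H x = (\<Sum>i\<in>Basis. H i x \<bullet> i)"

definition W2_loc :: "real \<Rightarrow> ('a::euclidean_space \<Rightarrow> real) \<Rightarrow> bool" where
  "W2_loc m u \<longleftrightarrow> loc_Lp m u \<and>
     (\<exists>G H. weak_derivatives2 u G H \<and> loc_Lp m G \<and> (\<forall>i\<in>Basis. loc_Lp m (H i)))"


section \<open>The admissible class and the system\<close>

text \<open>For \<open>m > N\<close> every element of \<open>W\<^sup>2\<^sup>,\<^sup>m\<^sub>l\<^sub>o\<^sub>c\<close> has exactly one continuous representative (Sobolev
  embedding). As usual the element is identified with it; this gives the pointwise limit inferior a
  meaning and turns equality in the space into equality at every point.\<close>

definition admissible :: "('a::euclidean_space \<Rightarrow> real) \<Rightarrow> bool" where
  "admissible u \<longleftrightarrow>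
     continuous_on UNIV u \<and>
     (\<forall>m > real DIM('a). W2_loc m u) \<and>
     Liminf at_infinity (\<lambda>x. ereal (u x / (norm x)\<^sup>2)) \<ge> 0"

definition solves_HJB_system ::
    "('k::finite \<Rightarrow> real) \<Rightarrow> ('k \<Rightarrow> real) \<Rightarrow> real^'k^'k \<Rightarrow>
     ('k \<Rightarrow> 'a::euclidean_space \<Rightarrow> real) \<Rightarrow> ('k \<Rightarrow> 'a \<Rightarrow> real) \<Rightarrow> bool" where
  "solves_HJB_system \<sigma> \<delta> \<alpha> f u \<longleftrightarrow>
     (\<exists>G H. (\<forall>j. weak_derivatives2 (u j) (G j) (H j)) \<and>
       (\<forall>j. AE x in lebesgue.
          - ((\<sigma> j)\<^sup>2 / 2) * laplacian_of (H j) x + 1/2 * (norm (G j x))\<^sup>2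
            + \<delta> j * u j x - (\<Sum>l\<in>UNIV. \<alpha>$j$l * u l x) = f j x))"


section \<open>Matrices\<close>

definition markov_generator :: "real^'k^'k \<Rightarrow> bool" where
  "markov_generator \<alpha> \<longleftrightarrow>
     (\<forall>j l. j \<noteq> l \<longrightarrow> \<alpha>$j$l \<ge> 0) \<and> (\<forall>j. \<alpha>$j$j = - (\<Sum>l\<in>UNIV - {j}. \<alpha>$j$l))"

definition irreducible_matrix :: "real^'k^'k \<Rightarrow> bool" where
  "irreducible_matrix \<alpha> \<longleftrightarrow> (\<forall>j l. (j, l) \<in> {(j, l). \<alpha>$j$l \<noteq> 0}\<^sup>*)"

definition M_matrix :: "real^'k^'k \<Rightarrow> bool" where
  "M_matrix M \<longleftrightarrow> invertible M \<and> (\<forall>j l. matrix_inv M $ j $ l \<ge> 0)"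

definition beta_system ::
    "('k::finite \<Rightarrow> real) \<Rightarrow> real^'k^'k \<Rightarrow> ('k \<Rightarrow> real) \<Rightarrow> ('k \<Rightarrow> real) \<Rightarrow> bool" where
  "beta_system \<delta> \<alpha> a \<beta> \<longleftrightarrow>
     (\<forall>j. 2 * (\<beta> j)\<^sup>2 + \<delta> j * \<beta> j - (\<Sum>l\<in>UNIV. \<alpha>$j$l * \<beta> l) = a j)"

definition eta_system ::
    "nat \<Rightarrow> ('k::finite \<Rightarrow> real) \<Rightarrow> ('k \<Rightarrow> real) \<Rightarrow> real^'k^'k \<Rightarrow> ('k \<Rightarrow> real) \<Rightarrow>
     ('k \<Rightarrow> real) \<Rightarrow> ('k \<Rightarrow> real) \<Rightarrow> bool" where
  "eta_system N \<sigma> \<delta> \<alpha> b \<beta> \<eta> \<longleftrightarrow>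
     (\<forall>j. \<delta> j * \<eta> j - (\<Sum>l\<in>UNIV. \<alpha>$j$l * \<eta> l) = b j + real N * (\<sigma> j)\<^sup>2 * \<beta> j)"

end

(* Hopf-Cole: if u_j solves its equation then v_j = exp(-u_j / sigma_j^2) has a continuous
   distributional Laplacian. Mollifying v_j therefore yields a classical maximum principle: u_j obeys
   the viscosity inequalities at every point where it is touched by a smooth function. Since the rows
   of alpha sum to zero and its off-diagonal entries are nonnegative, touching points of the family u
   can be compared simultaneously in j. Explicit radial barriers on balls of radius R, above and below
   the quadratic solution, then squeeze u onto it as R tends to infinity.

   The system for beta is solved by Brouwer's theorem. Every positive solution pair (beta, eta) of the
   algebraic systems gives a solution of the PDE, so the uniqueness of beta and eta follows from the
   uniqueness of u. *)

theory Submission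
  imports Defs
begin

section \<open>Bump functions\<close>

text \<open>The second derivatives of a W^{2,m}_loc function need not exist at a point where it is
  touched, so the second derivative test cannot be applied to u itself. In \<Delta>p = s
  |\<nabla>p|^2 + c the gradient term is the obstacle: it is only known almost everywhere, and
  squaring does not commute with mollification. For v = exp (- s p) it disappears, \<Delta>v = - s c
  v, and the right-hand side involves only the continuous functions p and c. The Laplacians of the
  mollified v then converge locally uniformly, so the inequality at a touching point survives the
  limit.

  Growth is prescribed only from below, hence the two bounds on u use different barriers. From
  above, the quadratic gradient term admits a logarithmic barrier that is infinite on a finite
  sphere; from below, the barrier grows slightly faster than |x|^2 and the liminf condition settles
  the boundary comparison. The barriers are either the same for all indices or proportional to
  \<beta>, so that their coupling sums are known: 0 by the row sums, or the value given by the
  equation for \<beta>.\<close>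

definition flat :: "nat \<Rightarrow> real \<Rightarrow> real" where
  "flat k t = (if t > 0 then inverse t ^ k / exp (inverse t) else 0)"

lemma flat_nonneg: "flat k t \<ge> 0"
  by (simp add: flat_def)

lemma flat_tendsto_0: "(flat k \<longlongrightarrow> 0) (at 0)"
proof (rule filterlim_split_at)
  show "(flat k \<longlongrightarrow> 0) (at_left 0)"
  proof (rule tendsto_eventually)
    show "\<forall>\<^sub>F t in at_left 0. flat k t = 0"
      by (auto simp: eventually_at_filter flat_def)
  qed
  have "((\<lambda>t::real. inverse t ^ k / exp (inverse t)) \<longlongrightarrow> 0) (at_right 0)"
    by (rule filterlim_compose[OF tendsto_power_div_exp_0 filterlim_inverse_at_top_right])
  then show "(flat k \<longlongrightarrow> 0) (at_right 0)"
    by (rule Lim_transform_eventually) (auto simp: eventually_at_filter flat_def)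
qed

text \<open>For t > 0 this is t^(-k) e^(-1/t), whose derivative is a combination of the same
  functions with larger k; the index is carried for this closure. At t = 0 the difference quotient
  of \<open>flat k\<close> is \<open>flat (k + 1)\<close>, which tends to 0.\<close>

lemma flat_has_real_derivative:
  "(flat k has_real_derivative (flat (k + 2) t - real k * flat (k + 1) t)) (at t)"
proof -
  consider "t > 0" | "t < 0" | "t = 0" by linarith
  then show ?thesis
  proof cases
    case 1
    have "((\<lambda>s::real. s ^ k / exp s) has_real_derivative
        ((real k * inverse t ^ (k - 1) - inverse t ^ k) / exp (inverse t))) (at (inverse t))"
      by (rule derivative_eq_intros refl | simp)+
         (simp add: diff_divide_distrib right_diff_distrib left_diff_distrib)
    moreover have "(inverse has_real_derivative - (inverse t ^ 2)) (at t)"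
      using 1 DERIV_inverse[of t UNIV] by (simp add: numeral_2_eq_2 power_inverse)
    ultimately have "((\<lambda>t. inverse t ^ k / exp (inverse t)) has_real_derivative
        ((real k * inverse t ^ (k - 1) - inverse t ^ k) / exp (inverse t)) * - (inverse t ^ 2)) (at t)"
      by (rule DERIV_chain2)
    moreover have "((real k * inverse t ^ (k - 1) - inverse t ^ k) / exp (inverse t)) * - (inverse t ^ 2)
        = flat (k + 2) t - real k * flat (k + 1) t"
      using 1 by (cases k) (simp_all add: flat_def add_divide_distrib diff_divide_distrib algebra_simps power2_eq_square)
    ultimately have *: "((\<lambda>t. inverse t ^ k / exp (inverse t)) has_real_derivative
        (flat (k + 2) t - real k * flat (k + 1) t)) (at t)"
      by simp
    show ?thesis
      by (rule has_field_derivative_transform_within_open[OF *, of "{0<..}"])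
         (use 1 in \<open>auto simp: flat_def\<close>)
  next
    case 2
    have *: "((\<lambda>t. 0) has_real_derivative (flat (k + 2) t - real k * flat (k + 1) t)) (at t)"
      using 2 by (auto simp: flat_def)
    show ?thesis
      by (rule has_field_derivative_transform_within_open[OF *, of "{..<0}"])
         (use 2 in \<open>auto simp: flat_def\<close>)
  next
    case 3
    have "((\<lambda>h. (flat k (0 + h) - flat k 0) / h) \<longlongrightarrow> 0) (at 0)"
      by (rule Lim_transform_eventually[OF flat_tendsto_0[of "Suc k"]])
         (auto simp: eventually_at_filter flat_def field_simps)
    then show ?thesis
      using 3 by (simp add: DERIV_def flat_def)
  qed
qed

text \<open>A syntactic stock of functions that contains the radial bumps and is closed under
  partial derivatives. One induction over the list of directions then makes every member
  smooth.\<close>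

inductive_set bump_algebra :: "('a::euclidean_space \<Rightarrow> real) set" where
  const: "(\<lambda>x. c) \<in> bump_algebra"
| coord: "(\<lambda>x. x \<bullet> b) \<in> bump_algebra"
| flat: "(\<lambda>x. flat k (r - (x - c) \<bullet> (x - c))) \<in> bump_algebra"
| add: "f \<in> bump_algebra \<Longrightarrow> g \<in> bump_algebra \<Longrightarrow> (\<lambda>x. f x + g x) \<in> bump_algebra"
| mult: "f \<in> bump_algebra \<Longrightarrow> g \<in> bump_algebra \<Longrightarrow> (\<lambda>x. f x * g x) \<in> bump_algebra"

lemma bump_algebra_has_derivative:
  assumes "f \<in> bump_algebra"
  shows "\<exists>f'. (\<forall>x. (f has_derivative f' x) (at x)) \<and> (\<forall>b. (\<lambda>x. f' x b) \<in> bump_algebra)"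
  using assms
proof induction
  case (const c)
  show ?case
    by (rule exI[of _ "\<lambda>x h. 0"]) (auto intro: bump_algebra.const)
next
  case (coord b)
  show ?case
    by (rule exI[of _ "\<lambda>x h. h \<bullet> b"]) (auto intro!: bump_algebra.const derivative_eq_intros)
next
  case (flat k r c)
  \<comment> \<open>Only sums, products and constant factors occur, with the subtraction written as
    the factor \<open>- real k\<close>, so that for each fixed direction the introduction rules of
    \<open>bump_algebra\<close> apply.\<close>
  define f' where "f' = (\<lambda>x h. (flat (k + 2) (r - (x - c) \<bullet> (x - c))
      + (- real k) * flat (k + 1) (r - (x - c) \<bullet> (x - c))) * ((-2) * (x \<bullet> h) + 2 * (c \<bullet> h)))"
  show ?case
  proof (intro exI conjI allI)
    fix x
    have "((\<lambda>x. r - (x - c) \<bullet> (x - c)) has_derivative (\<lambda>h. -2 * (x \<bullet> h) + 2 * (c \<bullet> h))) (at x)"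
      by (auto intro!: derivative_eq_intros simp: algebra_simps inner_commute)
    from has_derivative_compose[OF this
        flat_has_real_derivative[unfolded has_field_derivative_def]]
    show "((\<lambda>x. flat k (r - (x - c) \<bullet> (x - c))) has_derivative f' x) (at x)"
      unfolding f'_def by (simp add: algebra_simps)
  next
    fix b
    show "(\<lambda>x. f' x b) \<in> bump_algebra"
      unfolding f'_def
      by (intro bump_algebra.intros)
  qed
next
  case (add f g)
  then obtain f' g' where
    "\<And>x. (f has_derivative f' x) (at x)" "\<And>b. (\<lambda>x. f' x b) \<in> bump_algebra"
    "\<And>x. (g has_derivative g' x) (at x)" "\<And>b. (\<lambda>x. g' x b) \<in> bump_algebra"
    by blast
  then show ?case
    by (intro exI[of _ "\<lambda>x h. f' x h + g' x h"])
       (auto intro!: bump_algebra.add has_derivative_add)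
next
  case (mult f g)
  then obtain f' g' where
    "\<And>x. (f has_derivative f' x) (at x)" "\<And>b. (\<lambda>x. f' x b) \<in> bump_algebra"
    "\<And>x. (g has_derivative g' x) (at x)" "\<And>b. (\<lambda>x. g' x b) \<in> bump_algebra"
    by blast
  with mult.hyps show ?case
    by (intro exI[of _ "\<lambda>x h. f x * g' x h + f' x h * g x"])
       (auto intro!: bump_algebra.add bump_algebra.mult has_derivative_mult)
qed

lemma bump_algebra_smooth:
  assumes "f \<in> bump_algebra"
  shows "smooth f"
proof -
  have "iterated_partial is f \<in> bump_algebra" for "is"
  proof (induction "is")
    case Nil
    then show ?case using assms by simp
  next
    case (Cons i "is")
    then obtain f' where "\<And>x. (iterated_partial is f has_derivative f' x) (at x)"
      and "\<And>b. (\<lambda>x. f' x b) \<in> bump_algebra"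
      using bump_algebra_has_derivative by blast
    moreover from this(1) have "frechet_derivative (iterated_partial is f) (at x) = f' x" for x
      using frechet_derivative_at by metis
    ultimately show ?case by simp
  qed
  then show ?thesis
    unfolding smooth_def using bump_algebra_has_derivative
    by (meson differentiable_def)
qed

section \<open>Partial derivatives and compactly supported functions\<close>

text \<open>Differentiability along the lines parallel to b, without a Frechet derivative:
  convolutions, products and integration by parts treat one direction at a time, which leaves
  one-variable calculus.\<close>

definition has_partial :: "'a::euclidean_space \<Rightarrow> ('a \<Rightarrow> real) \<Rightarrow> ('a \<Rightarrow> real) \<Rightarrow> bool" where
  "has_partial b F F' \<longleftrightarrow>
    (\<forall>x. ((\<lambda>t. F (x + t *\<^sub>R b)) has_real_derivative F' x) (at 0))"

lemma has_partialD:
  assumes "has_partial b F F'"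
  shows "((\<lambda>t. F (x + t *\<^sub>R b)) has_real_derivative F' (x + t *\<^sub>R b)) (at t)"
proof -
  have "((\<lambda>s. F ((x + t *\<^sub>R b) + s *\<^sub>R b)) has_real_derivative F' (x + t *\<^sub>R b)) (at (0 + t - t))"
    using assms by (simp add: has_partial_def)
  then have "((\<lambda>s. F ((x + t *\<^sub>R b) + (s - t) *\<^sub>R b)) has_real_derivative F' (x + t *\<^sub>R b)) (at t)"
    using DERIV_at_within_shift[of "\<lambda>s. F ((x + t *\<^sub>R b) + (s - t) *\<^sub>R b)" "F' (x + t *\<^sub>R b)" t 0 UNIV]
    by (simp add: add.commute)
  then show ?thesis by (simp add: algebra_simps)
qed

lemma has_partial_mult:
  assumes "has_partial b F F'" "has_partial b G G'"
  shows "has_partial b (\<lambda>x. F x * G x) (\<lambda>x. F' x * G x + F x * G' x)"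
  using assms unfolding has_partial_def
  by (auto intro!: derivative_eq_intros)

lemma has_partial_compose:
  assumes "has_partial b F F'" "\<And>y. (g has_real_derivative g' y) (at y)"
  shows "has_partial b (\<lambda>x. g (F x)) (\<lambda>x. g' (F x) * F' x)"
  unfolding has_partial_def
proof
  fix x
  show "((\<lambda>t. g (F (x + t *\<^sub>R b))) has_real_derivative g' (F x) * F' x) (at 0)"
    by (rule DERIV_chain'[where f = "\<lambda>t. F (x + t *\<^sub>R b)", OF _ assms(2)[of "F (x + 0 *\<^sub>R b)"], simplified])
       (use assms(1) in \<open>simp add: has_partial_def\<close>)
qed

lemma has_partial_unique:
  assumes "has_partial b F F'" "has_partial b F G'"
  shows "F' = G'"
  using assms DERIV_unique unfolding has_partial_def by blast

section \<open>Continuous functions of compact support, and test functions among them\<close>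

definition cont_cpt :: "('a::euclidean_space \<Rightarrow> real) \<Rightarrow> bool" where
  "cont_cpt f \<longleftrightarrow> continuous_on UNIV f \<and> (\<exists>R. \<forall>x. norm x > R \<longrightarrow> f x = 0)"

definition pd :: "'a::euclidean_space \<Rightarrow> ('a \<Rightarrow> real) \<Rightarrow> 'a \<Rightarrow> real" where
  "pd b f = (\<lambda>x. frechet_derivative f (at x) b)"

text \<open>The classical Laplacian, applied to test functions; \<open>laplacian_of\<close> is the
  counterpart for weak second derivatives.\<close>

definition lap :: "('a::euclidean_space \<Rightarrow> real) \<Rightarrow> 'a \<Rightarrow> real" where
  "lap f x = (\<Sum>b\<in>Basis. pd b (pd b f) x)"

lemma cont_cpt_mult:
  assumes "cont_cpt f" "continuous_on UNIV g"
  shows "cont_cpt (\<lambda>x. f x * g x)"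
proof -
  from assms obtain R where "\<And>x. norm x > R \<Longrightarrow> f x = 0" by (auto simp: cont_cpt_def)
  then show ?thesis
    unfolding cont_cpt_def using assms
    by (auto intro!: continuous_on_mult continuous_on_add exI[of _ R] simp: cont_cpt_def)
qed

lemma cont_cpt_add:
  assumes "cont_cpt f" "cont_cpt g"
  shows "cont_cpt (\<lambda>x. f x + g x)"
proof -
  from assms obtain R S where "\<And>x. norm x > R \<Longrightarrow> f x = 0" "\<And>x. norm x > S \<Longrightarrow> g x = 0"
    by (auto simp: cont_cpt_def)
  then show ?thesis
    unfolding cont_cpt_def using assms
    by (auto intro!: continuous_on_mult continuous_on_add exI[of _ "max R S"] simp: cont_cpt_def)
qed

lemma cont_cpt_0 [simp]: "cont_cpt (\<lambda>x. 0)"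
  by (auto simp: cont_cpt_def)

lemma cont_cpt_sum:
  assumes "\<And>i. i \<in> A \<Longrightarrow> cont_cpt (f i)"
  shows "cont_cpt (\<lambda>x. \<Sum>i\<in>A. f i x)"
  using assms
proof (induction A rule: infinite_finite_induct)
  case (insert i A)
  have "cont_cpt (\<lambda>x. f i x + (\<Sum>i\<in>A. f i x))"
    by (rule cont_cpt_add) (use insert in auto)
  then show ?case using insert.hyps by simp
qed auto

lemma cont_cpt_bounded:
  assumes "cont_cpt f"
  obtains M where "M > 0" "\<And>x. \<bar>f x\<bar> \<le> M"
proof -
  from assms obtain R where R: "\<And>x. norm x > R \<Longrightarrow> f x = 0" and c: "continuous_on UNIV f"
    by (auto simp: cont_cpt_def)
  have "bounded (f ` cball 0 R)"
    by (intro compact_imp_bounded compact_continuous_image continuous_on_subset[OF c]) auto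
  then obtain M where M: "M > 0" "\<And>x. x \<in> cball 0 R \<Longrightarrow> \<bar>f x\<bar> \<le> M"
    by (auto simp: bounded_pos)
  have "\<bar>f x\<bar> \<le> M" for x
    using M(2)[of x] M(1) R[of x] by (cases "norm x \<le> R") auto
  with M(1) show ?thesis using that by blast
qed

lemma cont_cpt_reflect:
  assumes "cont_cpt f"
  shows "cont_cpt (\<lambda>x. f (y - x))"
proof -
  from assms obtain R where R: "\<And>x. norm x > R \<Longrightarrow> f x = 0" and c: "continuous_on UNIV f"
    by (auto simp: cont_cpt_def)
  have "norm (y - x) > R" if "norm x > R + norm y" for x
    using that norm_triangle_ineq4[of y "y - x"] by simp
  with R have "\<forall>x. norm x > R + norm y \<longrightarrow> f (y - x) = 0" by blast
  moreover have "continuous_on UNIV (\<lambda>x. f (y - x))"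
    by (rule continuous_on_compose2[OF c]) (auto intro: continuous_intros)
  ultimately show ?thesis unfolding cont_cpt_def by blast
qed

lemma smooth_has_partial:
  assumes "smooth f"
  shows "has_partial b f (pd b f)"
proof -
  have "iterated_partial [] f differentiable at x" for x
    using assms unfolding smooth_def by (metis empty_set empty_subsetI)
  then have d: "(f has_derivative frechet_derivative f (at x)) (at x)" for x
    by (simp add: frechet_derivative_works)
  show ?thesis
    unfolding has_partial_def
  proof
    fix x
    have 1: "((\<lambda>t::real. x + t *\<^sub>R b) has_derivative (\<lambda>t. t *\<^sub>R b)) (at 0)"
      by (auto intro!: derivative_eq_intros)
    have "((\<lambda>t. f (x + t *\<^sub>R b)) has_derivative (\<lambda>t. frechet_derivative f (at x) (t *\<^sub>R b))) (at 0)"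
      using has_derivative_compose[OF 1, of f "frechet_derivative f (at x)"] d[of x] by simp
    moreover have "frechet_derivative f (at x) (t *\<^sub>R b) = pd b f x * t" for t
      using linear_scale[OF has_derivative_linear[OF d[of x]]] by (simp add: pd_def)
    ultimately show "((\<lambda>t. f (x + t *\<^sub>R b)) has_real_derivative pd b f x) (at 0)"
      by (simp add: has_field_derivative_def)
  qed
qed

lemma smooth_continuous:
  assumes "smooth f"
  shows "continuous_on UNIV f"
proof -
  have "iterated_partial [] f differentiable at x" for x
    using assms unfolding smooth_def by (metis empty_set empty_subsetI)
  then show ?thesis
    by (auto intro!: continuous_at_imp_continuous_on differentiable_imp_continuous_within)
qed

lemma smooth_pd:
  assumes "smooth f" "b \<in> Basis"
  shows "smooth (pd b f)"
proof -
  have "iterated_partial is (pd b f) = iterated_partial (is @ [b]) f" for "is"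
    by (induction "is") (auto simp: pd_def)
  then show ?thesis
    using assms unfolding smooth_def by auto
qed

lemma test_function_cont_cpt:
  assumes "test_function f"
  shows "cont_cpt f"
proof -
  have "bounded (closure {x. f x \<noteq> 0})"
    using assms compact_imp_bounded by (auto simp: test_function_def)
  then have "bounded {x. f x \<noteq> 0}"
    using bounded_subset closure_subset by blast
  then obtain R where R: "\<And>x. f x \<noteq> 0 \<Longrightarrow> norm x \<le> R"
    by (auto simp: bounded_iff)
  have "f x = 0" if "norm x > R" for x
    using R[of x] that by force
  then show ?thesis
    using assms smooth_continuous by (auto simp: cont_cpt_def test_function_def)
qed

lemma has_partial_cont_cpt:
  assumes "has_partial b f f'" "cont_cpt f" "continuous_on UNIV f'"
  shows "cont_cpt f'"
proof -
  from assms obtain R where R: "\<And>x. norm x > R \<Longrightarrow> f x = 0"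
    by (auto simp: cont_cpt_def)
  have "f' x = 0" if x: "norm x > R" for x
  proof -
    have o: "open {t. norm (x + t *\<^sub>R b) > R}"
      by (intro open_Collect_less continuous_intros)
    have "((\<lambda>t. f (x + t *\<^sub>R b)) has_real_derivative 0) (at 0)"
      by (rule has_field_derivative_transform_within_open[of "\<lambda>_. 0" 0 0, OF _ o])
         (use x R in auto)
    moreover have "((\<lambda>t. f (x + t *\<^sub>R b)) has_real_derivative f' x) (at 0)"
      using assms(1) by (simp add: has_partial_def)
    ultimately show ?thesis using DERIV_unique by blast
  qed
  then show ?thesis using assms by (auto simp: cont_cpt_def)
qed

lemma test_function_iff:
  "test_function f \<longleftrightarrow> smooth f \<and> cont_cpt f"
proof
  assume "smooth f \<and> cont_cpt f"
  then obtain R where R: "\<And>x. norm x > R \<Longrightarrow> f x = 0" and "smooth f"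
    by (auto simp: cont_cpt_def)
  then have "{x. f x \<noteq> 0} \<subseteq> cball 0 R"
    by (auto simp: not_less[symmetric])
  then have "bounded (closure {x. f x \<noteq> 0})"
    using bounded_cball bounded_subset by blast
  then show "test_function f"
    using \<open>smooth f\<close> by (simp add: test_function_def compact_eq_bounded_closed)
qed (auto simp: test_function_cont_cpt test_function_def)

lemma test_function_pd:
  assumes "test_function f" "b \<in> Basis"
  shows "test_function (pd b f)"
  using assms smooth_pd smooth_continuous smooth_has_partial has_partial_cont_cpt
  unfolding test_function_iff by blast

lemma test_function_has_partial:
  "test_function f \<Longrightarrow> has_partial b f (pd b f)"
  by (simp add: test_function_iff smooth_has_partial)

section \<open>Convolution with locally integrable functions\<close>

definition loc_int :: "('a::euclidean_space \<Rightarrow> real) \<Rightarrow> bool" where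
  "loc_int w \<longleftrightarrow> w \<in> borel_measurable lebesgue \<and>
     (\<forall>R. integrable lebesgue (\<lambda>x. indicator (cball 0 R) x * w x))"

lemma continuous_borel_measurable_lebesgue:
  fixes f :: "'a::euclidean_space \<Rightarrow> real"
  assumes "continuous_on UNIV f"
  shows "f \<in> borel_measurable lebesgue"
  using borel_measurable_continuous_onI[OF assms] by (simp add: measurable_completion)

lemma indicator_cball_measurable:
  "(\<lambda>x::'a::euclidean_space. indicator (cball c R) x :: real) \<in> borel_measurable lebesgue"
  by (intro borel_measurable_indicator) simp

lemma loc_int_measurable: "loc_int w \<Longrightarrow> w \<in> borel_measurable lebesgue"
  by (simp add: loc_int_def)

lemma loc_int_bound:
  assumes "loc_int w" "v \<in> borel_measurable lebesgue" "AE x in lebesgue. \<bar>v x\<bar> \<le> \<bar>w x\<bar>"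
  shows "loc_int v"
  unfolding loc_int_def
proof (intro conjI allI)
  fix R
  show "integrable lebesgue (\<lambda>x. indicator (cball 0 R) x * v x)"
  proof (rule Bochner_Integration.integrable_bound)
    show "integrable lebesgue (\<lambda>x. indicator (cball 0 R) x * w x)"
      using assms(1) by (simp add: loc_int_def)
    show "(\<lambda>x. indicator (cball 0 R) x * v x) \<in> borel_measurable lebesgue"
      by (intro borel_measurable_times indicator_cball_measurable assms(2))
    show "AE x in lebesgue. norm (indicator (cball 0 R) x * v x) \<le> norm (indicator (cball 0 R) x * w x)"
      using assms(3) by eventually_elim (simp add: abs_mult mult_left_mono)
  qed
qed fact

lemma loc_int_add: "loc_int v \<Longrightarrow> loc_int w \<Longrightarrow> loc_int (\<lambda>x. v x + w x)"
  unfolding loc_int_def by (auto simp: distrib_left)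

lemma loc_int_sum:
  assumes "\<And>i. i \<in> A \<Longrightarrow> loc_int (w i)"
  shows "loc_int (\<lambda>x. \<Sum>i\<in>A. w i x)"
  using assms unfolding loc_int_def sum_distrib_left
  by (auto intro!: borel_measurable_sum)

lemma loc_int_cmult: "loc_int w \<Longrightarrow> loc_int (\<lambda>x. c * w x)"
  unfolding loc_int_def by (auto simp: mult.left_commute[of _ c])

lemma loc_Lp_imp_loc_int:
  assumes "loc_Lp 1 w"
  shows "loc_int w"
  unfolding loc_int_def
proof (intro conjI allI)
  show m: "w \<in> borel_measurable lebesgue"
    using assms by (simp add: loc_Lp_def)
  fix R
  have "integrable lebesgue (\<lambda>x. indicator (cball 0 R) x * \<bar>w x\<bar>)"
    using assms by (auto simp: loc_Lp_def set_integrable_def)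
  then show "integrable lebesgue (\<lambda>x. indicator (cball 0 R) x * w x)"
    by (rule Bochner_Integration.integrable_bound) (use m in \<open>auto simp: abs_mult intro!: borel_measurable_times indicator_cball_measurable\<close>)
qed

lemma continuous_loc_int:
  assumes "continuous_on UNIV w"
  shows "loc_int w"
  unfolding loc_int_def
proof (intro conjI allI)
  show "w \<in> borel_measurable lebesgue"
    by (rule continuous_borel_measurable_lebesgue) fact
  fix R
  have "integrable lborel (\<lambda>x. indicator (cball 0 R) x *\<^sub>R w x)"
    by (rule borel_integrable_compact) (use assms continuous_on_subset in auto)
  moreover have "(\<lambda>x. indicator (cball 0 R) x * w x) \<in> borel_measurable lborel"
    using borel_measurable_continuous_onI[OF assms]
    by (auto intro!: borel_measurable_times borel_measurable_indicator)
  ultimately show "integrable lebesgue (\<lambda>x. indicator (cball 0 R) x * w x)"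
    by (simp add: integrable_completion)
qed

lemma integrable_cont_cpt_mult:
  assumes "loc_int w" "cont_cpt f"
  shows "integrable lebesgue (\<lambda>x. f x * w x)"
proof -
  obtain M where M: "M > 0" "\<And>x. \<bar>f x\<bar> \<le> M" using cont_cpt_bounded assms by blast
  obtain R where R: "\<And>x. norm x > R \<Longrightarrow> f x = 0" using assms by (auto simp: cont_cpt_def)
  have "integrable lebesgue (\<lambda>x. M * (indicator (cball 0 R) x * w x))"
    using assms by (simp add: loc_int_def)
  then show ?thesis
  proof (rule Bochner_Integration.integrable_bound)
    have "f \<in> borel_measurable lebesgue"
      using assms continuous_borel_measurable_lebesgue by (auto simp: cont_cpt_def)
    then show "(\<lambda>x. f x * w x) \<in> borel_measurable lebesgue"
      using loc_int_measurable[OF assms(1)] by (rule borel_measurable_times)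
    show "AE x in lebesgue. norm (f x * w x) \<le> norm (M * (indicator (cball 0 R) x * w x))"
    proof (rule AE_I2)
      fix x
      show "norm (f x * w x) \<le> norm (M * (indicator (cball 0 R) x * w x))"
        using M(2)[of x] M(1) R[of x]
        by (cases "norm x \<le> R") (auto simp: abs_mult intro: mult_right_mono)
    qed
  qed
qed

lemma integrable_cont_cpt:
  "cont_cpt f \<Longrightarrow> integrable lebesgue f"
  using integrable_cont_cpt_mult[OF continuous_loc_int[of "\<lambda>_. 1"], of f] by simp

section \<open>Convolution: algebra, continuity, differentiation of the kernel\<close>

definition conv :: "('a::euclidean_space \<Rightarrow> real) \<Rightarrow> ('a \<Rightarrow> real) \<Rightarrow> 'a \<Rightarrow> real" where
  "conv \<kappa> w y = (LINT x|lebesgue. \<kappa> (y - x) * w x)"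

lemma integrable_conv:
  assumes "loc_int w" "cont_cpt \<kappa>"
  shows "integrable lebesgue (\<lambda>x. \<kappa> (y - x) * w x)"
  by (rule integrable_cont_cpt_mult[OF assms(1) cont_cpt_reflect[OF assms(2)]])

lemma conv_add:
  assumes "loc_int v" "loc_int w" "cont_cpt \<kappa>"
  shows "conv \<kappa> (\<lambda>x. v x + w x) y = conv \<kappa> v y + conv \<kappa> w y"
  using assms by (simp add: conv_def distrib_left integrable_conv)

lemma conv_sum:
  assumes "\<And>i. i \<in> A \<Longrightarrow> loc_int (w i)" "cont_cpt \<kappa>"
  shows "conv \<kappa> (\<lambda>x. \<Sum>i\<in>A. w i x) y = (\<Sum>i\<in>A. conv \<kappa> (w i) y)"
  using assms by (simp add: conv_def sum_distrib_left integrable_conv Bochner_Integration.integral_sum)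

lemma conv_cmult: "conv \<kappa> (\<lambda>x. c * w x) y = c * conv \<kappa> w y"
  by (simp add: conv_def mult.left_commute[of _ c])

lemma conv_cong_AE:
  assumes "AE x in lebesgue. v x = w x" "v \<in> borel_measurable lebesgue"
    "w \<in> borel_measurable lebesgue" "cont_cpt \<kappa>"
  shows "conv \<kappa> v y = conv \<kappa> w y"
  unfolding conv_def
proof (rule integral_cong_AE)
  have [simp]: "(\<lambda>x. \<kappa> (y - x)) \<in> borel_measurable lebesgue"
    using cont_cpt_reflect[OF assms(4)] continuous_borel_measurable_lebesgue
    by (auto simp: cont_cpt_def)
  show "(\<lambda>x. \<kappa> (y - x) * v x) \<in> borel_measurable lebesgue"
    "(\<lambda>x. \<kappa> (y - x) * w x) \<in> borel_measurable lebesgue"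
    using assms(2,3) by (auto intro!: borel_measurable_times)
  show "AE x in lebesgue. \<kappa> (y - x) * v x = \<kappa> (y - x) * w x"
    using assms(1) by eventually_elim simp
qed

text \<open>The limit theorem behind continuity, differentiation under the integral and weak limits:
  uniformly bounded kernels supported in one ball are dominated, after multiplication by w, by M |w|
  on that ball.\<close>

lemma conv_dominated:
  assumes w: "loc_int w"
    and meas: "\<And>n. k n \<in> borel_measurable lebesgue" "k' \<in> borel_measurable lebesgue"
    and bound: "\<And>n x. \<bar>k n x\<bar> \<le> M" and supp: "\<And>n x. norm x > R \<Longrightarrow> k n x = 0"
    and lim: "\<And>x. (\<lambda>n. k n x) \<longlonglongrightarrow> k' x"
  shows "(\<lambda>n. LINT x|lebesgue. k n x * w x) \<longlonglongrightarrow> (LINT x|lebesgue. k' x * w x)"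
proof (rule integral_dominated_convergence)
  have w_meas [simp]: "w \<in> borel_measurable lebesgue" by (rule loc_int_measurable) fact
  show "(\<lambda>x. k' x * w x) \<in> borel_measurable lebesgue" using meas by (auto intro!: borel_measurable_times)
  show "(\<lambda>x. k n x * w x) \<in> borel_measurable lebesgue" for n
    by (intro borel_measurable_times meas w_meas)
  show "integrable lebesgue (\<lambda>x. M * \<bar>indicator (cball 0 R) x * w x\<bar>)"
    using w by (auto simp: loc_int_def intro!: integrable_mult_right integrable_abs)
  show "AE x in lebesgue. (\<lambda>n. k n x * w x) \<longlonglongrightarrow> k' x * w x"
    by (intro AE_I2 tendsto_intros lim)
  show "AE x in lebesgue. norm (k n x * w x) \<le> M * \<bar>indicator (cball 0 R) x * w x\<bar>" for n
  proof (rule AE_I2)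
    fix x
    show "norm (k n x * w x) \<le> M * \<bar>indicator (cball 0 R) x * w x\<bar>"
      using bound[of n x] supp[of x n]
      by (cases "norm x \<le> R") (auto simp: abs_mult intro: mult_right_mono)
  qed
qed

lemma conv_continuous:
  assumes "loc_int w" "cont_cpt \<kappa>"
  shows "continuous_on UNIV (conv \<kappa> w)"
  unfolding continuous_on_sequentially
proof (intro ballI allI impI, elim conjE)
  fix X :: "nat \<Rightarrow> 'a" and a assume X: "X \<longlonglongrightarrow> a"
  obtain M where M: "M > 0" "\<And>x. \<bar>\<kappa> x\<bar> \<le> M" using cont_cpt_bounded assms(2) by blast
  obtain R where R: "\<And>x. norm x > R \<Longrightarrow> \<kappa> x = 0" and c: "continuous_on UNIV \<kappa>"
    using assms(2) by (auto simp: cont_cpt_def)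
  obtain B where B: "\<And>n. norm (X n) \<le> B"
    using X convergent_imp_Bseq[of X] by (auto simp: convergent_def Bseq_def)
  have "(\<lambda>n. LINT x|lebesgue. \<kappa> (X n - x) * w x) \<longlonglongrightarrow> (LINT x|lebesgue. \<kappa> (a - x) * w x)"
  proof (rule conv_dominated[OF assms(1)])
    show "(\<lambda>x. \<kappa> (y - x)) \<in> borel_measurable lebesgue" for y
      using cont_cpt_reflect[OF assms(2)] continuous_borel_measurable_lebesgue
      by (auto simp: cont_cpt_def)
    then show "(\<lambda>x. \<kappa> (a - x)) \<in> borel_measurable lebesgue" .
    show "\<bar>\<kappa> (X n - x)\<bar> \<le> M" for n x by (rule M(2))
    show "\<kappa> (X n - x) = 0" if "norm x > R + B" for n x
      using that B[of n] norm_triangle_ineq4[of "X n" "X n - x"] by (intro R) simp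
    show "(\<lambda>n. \<kappa> (X n - x)) \<longlonglongrightarrow> \<kappa> (a - x)" for x
      by (rule continuous_on_tendsto_compose[OF c]) (auto intro!: tendsto_intros X)
  qed
  then show "(conv \<kappa> w \<circ> X) \<longlonglongrightarrow> conv \<kappa> w a"
    by (simp add: conv_def comp_def)
qed

lemma has_partial_lipschitz:
  assumes "has_partial b f f'" "\<And>x. \<bar>f' x\<bar> \<le> M"
  shows "\<bar>f (x + h *\<^sub>R b) - f x\<bar> \<le> M * \<bar>h\<bar>"
  using field_differentiable_bound[of UNIV "\<lambda>t. f (x + t *\<^sub>R b)" "\<lambda>t. f' (x + t *\<^sub>R b)" M h 0]
    has_partialD[OF assms(1)] assms(2) by auto

text \<open>Along any null sequence the difference quotients of the kernel are bounded by sup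
  |\<kappa>'|, by the mean value theorem, and supported in one ball because the sequence is bounded;
  so the limit passes under the integral.\<close>

lemma conv_has_partial:
  assumes w: "loc_int w" and \<kappa>: "cont_cpt \<kappa>" "cont_cpt \<kappa>'" "has_partial b \<kappa> \<kappa>'"
  shows "has_partial b (conv \<kappa> w) (conv \<kappa>' w)"
  unfolding has_partial_def DERIV_def tendsto_at_iff_sequentially
proof (intro allI impI)
  fix y and X :: "nat \<Rightarrow> real"
  assume X0: "\<forall>i. X i \<in> UNIV - {0}" and X: "X \<longlonglongrightarrow> 0"
  obtain M where M: "M > 0" "\<And>x. \<bar>\<kappa>' x\<bar> \<le> M" using cont_cpt_bounded \<kappa>(2) by blast
  obtain R where R: "\<And>x. norm x > R \<Longrightarrow> \<kappa> x = 0" using \<kappa>(1) by (auto simp: cont_cpt_def)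
  obtain B where B: "\<And>n. \<bar>X n\<bar> \<le> B" "B \<ge> 0"
    using X convergent_imp_Bseq[of X] by (auto simp: convergent_def Bseq_def) (metis less_imp_le)
  define k where "k n x = (\<kappa> (y + X n *\<^sub>R b - x) - \<kappa> (y - x)) / X n" for n x
  have meas: "(\<lambda>x. \<kappa> (z - x)) \<in> borel_measurable lebesgue" for z
    using cont_cpt_reflect[OF \<kappa>(1)] continuous_borel_measurable_lebesgue
    by (auto simp: cont_cpt_def)
  have "(\<lambda>n. LINT x|lebesgue. k n x * w x) \<longlonglongrightarrow> (LINT x|lebesgue. \<kappa>' (y - x) * w x)"
  proof (rule conv_dominated[OF w])
    show "k n \<in> borel_measurable lebesgue" for n
      unfolding k_def using meas by (intro borel_measurable_divide borel_measurable_diff) auto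
    show "(\<lambda>x. \<kappa>' (y - x)) \<in> borel_measurable lebesgue"
      using cont_cpt_reflect[OF \<kappa>(2)] continuous_borel_measurable_lebesgue
      by (auto simp: cont_cpt_def)
    show "\<bar>k n x\<bar> \<le> M" for n x
      using has_partial_lipschitz[OF \<kappa>(3) M(2), of "y - x" "X n"] X0
      by (simp add: k_def divide_simps algebra_simps)
    show "k n x = 0" if x: "norm x > R + norm y + B * norm b" for n x
    proof -
      have "norm (X n *\<^sub>R b) \<le> B * norm b"
        using B(1)[of n] by (simp add: mult_right_mono)
      moreover have "0 \<le> B * norm b" using B(2) by simp
      ultimately have "norm (y - x) > R" "norm (y + X n *\<^sub>R b - x) > R"
        using x norm_triangle_ineq4[of y "y - x"]
          norm_triangle_ineq4[of "y + X n *\<^sub>R b" "y + X n *\<^sub>R b - x"]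
          norm_triangle_ineq[of y "X n *\<^sub>R b"] by simp_all
      then show ?thesis using R by (simp add: k_def)
    qed
    show "(\<lambda>n. k n x) \<longlonglongrightarrow> \<kappa>' (y - x)" for x
    proof -
      have "((\<lambda>h. (\<kappa> (y - x + h *\<^sub>R b) - \<kappa> (y - x)) / h) \<longlongrightarrow> \<kappa>' (y - x)) (at 0)"
        using \<kappa>(3) by (simp add: has_partial_def DERIV_def)
      then show ?thesis
        unfolding tendsto_at_iff_sequentially using X0 X
        by (simp add: k_def comp_def algebra_simps)
    qed
  qed
  moreover have "(LINT x|lebesgue. k n x * w x) = (conv \<kappa> w (y + X n *\<^sub>R b) - conv \<kappa> w y) / X n" for n
  proof -
    have "(LINT x|lebesgue. k n x * w x)
        = (LINT x|lebesgue. (\<kappa> (y + X n *\<^sub>R b - x) * w x - \<kappa> (y - x) * w x) / X n)"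
      by (simp add: k_def algebra_simps)
    also have "\<dots> = (conv \<kappa> w (y + X n *\<^sub>R b) - conv \<kappa> w y) / X n"
      using integrable_conv[OF w \<kappa>(1)] by (simp add: conv_def)
    finally show ?thesis .
  qed
  ultimately show "((\<lambda>h. (conv \<kappa> w (y + (0 + h) *\<^sub>R b) - conv \<kappa> w (y + 0 *\<^sub>R b)) / h) \<circ> X)
      \<longlonglongrightarrow> conv \<kappa>' w y"
    by (simp add: comp_def conv_def)
qed

section \<open>Reflection, integration by parts, Fubini\<close>

lemma integral_reflect:
  fixes f :: "'a::euclidean_space \<Rightarrow> real"
  assumes "continuous_on UNIV f"
  shows "(LINT x|lebesgue. f (y - x)) = (LINT x|lebesgue. f x)"
proof -
  have f [measurable]: "f \<in> borel_measurable borel"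
    by (rule borel_measurable_continuous_onI) fact
  have "(LINT x|lebesgue. f x) = (LINT x|lborel. f x)"
    by (simp add: integral_completion)
  also have "\<dots> = (LINT x|distr lborel borel (\<lambda>x. y + (-1) *\<^sub>R x). f x)"
    using lborel_affine[of "-1" y]
    by (intro arg_cong[where f = "\<lambda>M. integral\<^sup>L M f"]) (simp add: density_1)
  also have "\<dots> = (LINT x|lborel. f (y + (-1) *\<^sub>R x))"
    by (rule integral_distr) measurable
  also have "\<dots> = (LINT x|lebesgue. f (y - x))"
    by (simp add: integral_completion)
  finally show ?thesis by simp
qed

text \<open>The convolution of \<open>F\<close> with \<open>1\<close> is constant, so its derivative vanishes.\<close>

lemma integral_partial_eq_0:
  assumes "has_partial b F F'" "cont_cpt F" "cont_cpt F'"
  shows "(LINT x|lebesgue. F' x) = 0"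
proof -
  have conv1: "conv f (\<lambda>_. 1) y = (LINT x|lebesgue. f x)" if "cont_cpt f" for f :: "'a \<Rightarrow> real" and y
    using that integral_reflect[of f y] by (simp add: conv_def cont_cpt_def)
  have "has_partial b (conv F (\<lambda>_. 1)) (conv F' (\<lambda>_. 1))"
    by (intro conv_has_partial continuous_loc_int assms) simp
  moreover have "has_partial b (conv F (\<lambda>_. 1)) (\<lambda>_. 0)"
    using conv1[OF assms(2)] by (simp add: has_partial_def)
  ultimately have "conv F' (\<lambda>_. 1) = (\<lambda>_. 0)"
    by (rule has_partial_unique)
  then show ?thesis
    using conv1[OF assms(3)] by metis
qed

text \<open>The product F \<psi> has compact support through \<psi> alone, so the integral of its
  derivative vanishes.\<close>

lemma integral_by_parts:
  assumes "has_partial b F F'" "continuous_on UNIV F" "continuous_on UNIV F'"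
    and "has_partial b \<psi> \<psi>'" "cont_cpt \<psi>" "cont_cpt \<psi>'"
  shows "(LINT x|lebesgue. F x * \<psi>' x) = - (LINT x|lebesgue. F' x * \<psi> x)"
proof -
  have c: "cont_cpt (\<lambda>x. F x * \<psi>' x)" "cont_cpt (\<lambda>x. F' x * \<psi> x)" "cont_cpt (\<lambda>x. F x * \<psi> x)"
    using cont_cpt_mult[of \<psi>' F] cont_cpt_mult[of \<psi> F'] cont_cpt_mult[of \<psi> F] assms
    by (simp_all add: mult.commute)
  have "(LINT x|lebesgue. F' x * \<psi> x + F x * \<psi>' x) = 0"
    by (rule integral_partial_eq_0[OF has_partial_mult[OF assms(1,4)] c(3) cont_cpt_add[OF c(2,1)]])
  then show ?thesis
    using c by (simp add: integrable_cont_cpt)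
qed

lemma conv_fubini:
  assumes w: "loc_int w" and \<kappa>: "cont_cpt \<kappa>" and \<phi>: "cont_cpt \<phi>"
  shows "(LINT y|lebesgue. conv \<kappa> w y * \<phi> y)
       = (LINT x|lebesgue. (LINT y|lebesgue. \<kappa> (y - x) * \<phi> y) * w x)"
proof -
  have bm: "f \<in> borel_measurable borel" if "cont_cpt f" for f :: "'a \<Rightarrow> real"
    using that by (intro borel_measurable_continuous_onI) (simp add: cont_cpt_def)
  have [measurable]: "\<kappa> \<in> borel_measurable borel" "\<phi> \<in> borel_measurable borel"
    using bm \<kappa> \<phi> by auto
  \<comment> \<open>Fubini is applied on the product of Borel measures, whereas w is only Lebesgue
    measurable; a Borel version of w replaces it for the exchange.\<close>
  obtain w' where w' [measurable]: "w' \<in> borel_measurable lborel" and AE: "AE x in lborel. w x = w' x"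
    using completion_ex_borel_measurable_real[OF loc_int_measurable[OF w]] by blast
  have AE': "AE x in lebesgue. w x = w' x"
    using AE by (rule AE_completion)
  have ml: "w' \<in> borel_measurable lebesgue"
    using w' by (rule measurable_completion)
  have w'i: "loc_int w'"
    by (rule loc_int_bound[OF w ml]) (use AE' in \<open>auto elim: eventually_mono\<close>)
  obtain M where M: "M > 0" "\<And>x. \<bar>\<kappa> x\<bar> \<le> M" using cont_cpt_bounded \<kappa> by blast
  obtain R where R: "\<And>x. norm x > R \<Longrightarrow> \<kappa> x = 0" using \<kappa> by (auto simp: cont_cpt_def)
  obtain S where S: "\<And>x. norm x > S \<Longrightarrow> \<phi> x = 0" using \<phi> by (auto simp: cont_cpt_def)
  \<comment> \<open>Where \<kappa>(y - x) \<phi>(y) is nonzero, |y| \<le> S and |y - x| \<le> R,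
    hence |x| \<le> R + S: truncating at this radius loses nothing and gives the integrable product
    bound g(x) \<phi>(y).\<close>
  define g where "g x = M * \<bar>indicator (cball 0 (R + S)) x * w' x\<bar>" for x
  have gm [measurable]: "g \<in> borel_measurable borel"
    unfolding g_def using w'
    by (auto intro!: borel_measurable_times borel_measurable_abs borel_measurable_indicator)
  have "integrable lebesgue g"
    unfolding g_def using w'i by (auto simp: loc_int_def intro!: integrable_mult_right integrable_abs)
  then have gi: "integrable lborel g"
    by (simp add: integrable_completion)
  have \<phi>i: "integrable lborel \<phi>"
    using integrable_cont_cpt[OF \<phi>] by (simp add: integrable_completion)
  have "integrable (lborel \<Otimes>\<^sub>M lborel) (\<lambda>(x, y). g x * \<phi> y)"
    by (rule lborel_pair.Fubini_integrable)
       (use gi \<phi>i in \<open>auto simp: abs_mult intro!: integrable_mult_left integrable_abs\<close>)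
  then have int: "integrable (lborel \<Otimes>\<^sub>M lborel) (\<lambda>(x, y). \<kappa> (y - x) * w' x * \<phi> y)"
  proof (rule Bochner_Integration.integrable_bound)
    show "(\<lambda>(x, y). \<kappa> (y - x) * w' x * \<phi> y) \<in> borel_measurable (lborel \<Otimes>\<^sub>M lborel)"
      by measurable
    have "\<bar>\<kappa> (y - x) * w' x * \<phi> y\<bar> \<le> \<bar>g x * \<phi> y\<bar>" for x y
    proof (cases "norm x \<le> R + S")
      case True
      then show ?thesis using M(2)[of "y - x"] M(1)
        by (auto simp: g_def abs_mult intro!: mult_right_mono)
    next
      case False
      then have "norm y > S \<or> norm (y - x) > R"
        using norm_triangle_ineq4[of y "y - x"] by auto
      then show ?thesis using R S by auto
    qed
    then show "AE p in lborel \<Otimes>\<^sub>M lborel. norm (case p of (x, y) \<Rightarrow> \<kappa> (y - x) * w' x * \<phi> y)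
        \<le> norm (case p of (x, y) \<Rightarrow> g x * \<phi> y)"
      by (intro AE_I2) auto
  qed
  have "(LINT y|lebesgue. conv \<kappa> w y * \<phi> y) = (LINT y|lebesgue. conv \<kappa> w' y * \<phi> y)"
    using conv_cong_AE[OF AE' loc_int_measurable[OF w] ml \<kappa>] by simp
  also have "\<dots> = (LINT y|lborel. conv \<kappa> w' y * \<phi> y)"
    using borel_measurable_continuous_onI[OF conv_continuous[OF w'i \<kappa>]]
    by (subst integral_completion) auto
  also have "\<dots> = (LINT y|lborel. (LINT x|lborel. \<kappa> (y - x) * w' x * \<phi> y))"
    unfolding conv_def by (subst integral_completion) auto
  also have "\<dots> = (LINT x|lborel. (LINT y|lborel. \<kappa> (y - x) * w' x * \<phi> y))"
    by (rule lborel_pair.Fubini_integral[OF int])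
  also have "\<dots> = (LINT x|lborel. (LINT y|lborel. \<kappa> (y - x) * \<phi> y) * w' x)"
    by (subst integral_mult_left_zero[symmetric]) (simp add: mult.assoc mult.commute[of "w' _"])
  also have "\<dots> = (LINT x|lebesgue. (LINT y|lborel. \<kappa> (y - x) * \<phi> y) * w' x)"
    by (subst integral_completion) auto
  also have "\<dots> = (LINT x|lebesgue. (LINT y|lebesgue. \<kappa> (y - x) * \<phi> y) * w' x)"
    by (subst integral_completion) auto
  also have "\<dots> = (LINT x|lebesgue. (LINT y|lebesgue. \<kappa> (y - x) * \<phi> y) * w x)"
  proof (rule integral_cong_AE)
    have "(\<lambda>x. LINT y|lborel. \<kappa> (y - x) * \<phi> y) \<in> borel_measurable lborel"
      by measurable
    then have [simp]: "(\<lambda>x. LINT y|lebesgue. \<kappa> (y - x) * \<phi> y) \<in> borel_measurable lebesgue"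
      by (subst integral_completion) (auto intro: measurable_completion)
    show "(\<lambda>x. (LINT y|lebesgue. \<kappa> (y - x) * \<phi> y) * w' x) \<in> borel_measurable lebesgue"
      "(\<lambda>x. (LINT y|lebesgue. \<kappa> (y - x) * \<phi> y) * w x) \<in> borel_measurable lebesgue"
      using ml loc_int_measurable[OF w] by (auto intro!: borel_measurable_times)
    show "AE x in lebesgue. (LINT y|lebesgue. \<kappa> (y - x) * \<phi> y) * w' x
        = (LINT y|lebesgue. \<kappa> (y - x) * \<phi> y) * w x"
      using AE' by eventually_elim simp
  qed
  finally show ?thesis .
qed

section \<open>Mollification\<close>

text \<open>The standard mollifier: a radial bump, hence even, supported in the ball of radius 1 /
  (n + 1) and normalised to integral 1.\<close>

definition moll :: "nat \<Rightarrow> 'a::euclidean_space \<Rightarrow> real" where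
  "moll n x = flat 0 ((inverse (real (Suc n)))\<^sup>2 - x \<bullet> x) /
     (LINT z|(lebesgue :: 'a measure). flat 0 ((inverse (real (Suc n)))\<^sup>2 - z \<bullet> z))"

lemma flat_pos_iff: "flat k t \<noteq> 0 \<longleftrightarrow> t > 0"
  by (simp add: flat_def)

lemma test_function_flat:
  "test_function (\<lambda>x::'a::euclidean_space. flat k (r - (x - c) \<bullet> (x - c)))"
  unfolding test_function_iff
proof
  show s: "smooth (\<lambda>x. flat k (r - (x - c) \<bullet> (x - c)))"
    by (intro bump_algebra_smooth bump_algebra.flat)
  \<comment> \<open>Beyond this radius |x - c| exceeds |r| + 1, whose square is at least |r|, so the
    argument of \<open>flat\<close> is nonpositive. The extra 1 covers small r.\<close>
  have "flat k (r - (x - c) \<bullet> (x - c)) = 0" if x: "norm x > norm c + (\<bar>r\<bar> + 1)" for x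
  proof -
    have "norm (x - c) > \<bar>r\<bar> + 1" using x norm_triangle_sub[of x c] by simp
    then have "(\<bar>r\<bar> + 1) * (\<bar>r\<bar> + 1) \<le> norm (x - c) * norm (x - c)"
      by (intro mult_mono) auto
    moreover have "(\<bar>r\<bar> + 1) * (\<bar>r\<bar> + 1) \<ge> \<bar>r\<bar>" by (simp add: algebra_simps)
    ultimately have "(x - c) \<bullet> (x - c) \<ge> r"
      by (simp add: dot_square_norm power2_eq_square)
    then show ?thesis by (simp add: flat_def)
  qed
  then show "cont_cpt (\<lambda>x. flat k (r - (x - c) \<bullet> (x - c)))"
    using smooth_continuous[OF s] unfolding cont_cpt_def by blast
qed

lemma test_function_bump_cmult:
  assumes "f \<in> bump_algebra" "cont_cpt f"
  shows "test_function (\<lambda>x. f x * c)"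
proof -
  have "smooth (\<lambda>x. f x * c)"
    by (intro bump_algebra_smooth bump_algebra.mult bump_algebra.const assms)
  then show ?thesis
    by (simp add: test_function_iff cont_cpt_mult[OF assms(2)])
qed

text \<open>A nonnegative integrand with vanishing integral is 0 almost everywhere; here it is
  nonzero on a ball, which is not negligible.\<close>

lemma moll_integral_pos:
  "(LINT z|(lebesgue :: 'a::euclidean_space measure). flat 0 ((inverse (real (Suc n)))\<^sup>2 - z \<bullet> z)) > 0"
proof -
  let ?r = "inverse (real (Suc n))"
  let ?f = "\<lambda>z::'a. flat 0 (?r\<^sup>2 - z \<bullet> z)"
  have "cont_cpt ?f"
    using test_function_cont_cpt[OF test_function_flat[of 0 "?r\<^sup>2" 0]] by simp
  then have i: "integrable lebesgue ?f" by (rule integrable_cont_cpt)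
  have supp: "?f x \<noteq> 0 \<longleftrightarrow> x \<in> ball 0 ?r" for x
  proof -
    have "x \<bullet> x < ?r\<^sup>2 \<longleftrightarrow> norm x < ?r"
      unfolding power2_norm_eq_inner[symmetric]
      using abs_le_square_iff[of ?r "norm x"] by (simp add: not_le[symmetric])
    then show ?thesis by (simp only: flat_pos_iff) simp
  qed
  have "\<not> (AE x in lebesgue. ?f x = 0)"
  proof
    assume "AE x in lebesgue. ?f x = 0"
    then have "AE x in lebesgue. x \<notin> ball (0::'a) ?r"
      by (rule eventually_mono) (use supp in blast)
    then have "ball (0::'a) ?r \<in> null_sets lebesgue"
      by (subst AE_iff_null_sets) simp_all
    then have "negligible (ball (0::'a) ?r)"
      by (simp add: negligible_iff_null_sets)
    then show False
      using open_not_negligible[of "ball (0::'a) ?r"] by simp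
  qed
  then have "(LINT z|lebesgue. ?f z) \<noteq> 0"
    using integral_nonneg_eq_0_iff_AE[OF i] by (simp add: flat_nonneg)
  moreover have "(LINT z|lebesgue. ?f z) \<ge> 0"
    by (simp add: flat_nonneg)
  ultimately show ?thesis by linarith
qed

lemma moll_nonneg: "moll n x \<ge> 0"
  unfolding moll_def using moll_integral_pos[where 'a = 'a, of n] by (simp add: flat_nonneg)

lemma moll_minus: "moll n (x - y) = moll n (y - x)"
  by (simp add: moll_def inner_diff_left inner_diff_right inner_commute algebra_simps)

lemma moll_eq_0: "norm x \<ge> inverse (real (Suc n)) \<Longrightarrow> moll n x = 0"
proof -
  assume "norm x \<ge> inverse (real (Suc n))"
  then have "(inverse (real (Suc n)))\<^sup>2 \<le> (norm x)\<^sup>2"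
    by (intro power_mono) auto
  then show ?thesis by (simp add: moll_def flat_def power2_norm_eq_inner)
qed

lemma test_function_moll_diff: "test_function (\<lambda>x. moll n (x - y))"
  unfolding moll_def divide_inverse
  by (intro test_function_bump_cmult bump_algebra.flat test_function_cont_cpt test_function_flat)

lemma test_function_moll: "test_function (moll n)"
  using test_function_moll_diff[of n 0] by simp

lemma cont_cpt_moll: "cont_cpt (moll n)"
  by (rule test_function_cont_cpt[OF test_function_moll])

lemma integral_moll:
  fixes y :: "'a::euclidean_space"
  shows "(LINT x|lebesgue. moll n (y - x)) = 1"
proof -
  have "(LINT x|lebesgue. moll n (y - x)) = (LINT x|(lebesgue :: 'a measure). moll n x)"
    by (rule integral_reflect) (use cont_cpt_moll in \<open>auto simp: cont_cpt_def\<close>)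
  then show ?thesis
    using moll_integral_pos[where 'a = 'a, of n] by (simp add: moll_def)
qed

lemma conv_moll_const: "conv (moll n) (\<lambda>_. c) y = c"
  by (simp add: conv_def integral_moll)

lemma conv_moll_mono:
  assumes "loc_int v" "loc_int w" "\<And>x. norm (x - y) < inverse (real (Suc n)) \<Longrightarrow> v x \<le> w x"
  shows "conv (moll n) v y \<le> conv (moll n) w y"
  unfolding conv_def
proof (rule integral_mono)
  fix x
  show "moll n (y - x) * v x \<le> moll n (y - x) * w x"
    using assms(3)[of x] moll_nonneg[of n "y - x"] moll_eq_0[of n "y - x"]
    by (cases "norm (x - y) < inverse (real (Suc n))")
       (auto intro: mult_left_mono simp: norm_minus_commute)
qed (intro integrable_conv assms cont_cpt_moll)+

text \<open>The convolution is an average of p over the ball of radius 1 / (n + 1) around y, so it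
  stays in every interval that contains the values of p there.\<close>

lemma conv_moll_close:
  assumes "continuous_on UNIV p" "\<And>x. norm (x - y) < inverse (real (Suc n)) \<Longrightarrow> \<bar>p x - c\<bar> \<le> e"
  shows "\<bar>conv (moll n) p y - c\<bar> \<le> e"
proof -
  have "p x \<le> c + e \<and> c - e \<le> p x" if "norm (x - y) < inverse (real (Suc n))" for x
    using assms(2)[OF that] by linarith
  then have "conv (moll n) p y \<le> conv (moll n) (\<lambda>_. c + e) y"
    "conv (moll n) (\<lambda>_. c - e) y \<le> conv (moll n) p y"
    by (auto intro!: conv_moll_mono continuous_loc_int assms(1))
  then show ?thesis by (simp add: conv_moll_const)
qed

lemma conv_moll_uniform_limit:
  assumes p: "continuous_on UNIV p" and e: "e > 0"
  shows "\<forall>\<^sub>F n in sequentially. \<forall>y\<in>cball 0 R. \<bar>conv (moll n) p y - p y\<bar> \<le> e"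
proof -
  \<comment> \<open>Mollification radii are at most 1, so values over the ball of radius R involve p
    only on the ball of radius R + 1.\<close>
  have "uniformly_continuous_on (cball 0 (R + 1)) p"
    by (intro compact_uniformly_continuous continuous_on_subset[OF p]) auto
  then obtain d where d: "d > 0" "\<And>x y. x \<in> cball 0 (R + 1) \<Longrightarrow> y \<in> cball 0 (R + 1) \<Longrightarrow>
      dist y x < d \<Longrightarrow> dist (p y) (p x) < e"
    unfolding uniformly_continuous_on_def using e by metis
  have "\<forall>\<^sub>F n in sequentially. inverse (real (Suc n)) < d"
    using d(1) LIMSEQ_inverse_real_of_nat order_tendstoD(2) by blast
  then show ?thesis
  proof eventually_elim
    case (elim n)
    show ?case
    proof
      fix y :: 'a assume y: "y \<in> cball 0 R"
      show "\<bar>conv (moll n) p y - p y\<bar> \<le> e"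
      proof (rule conv_moll_close[OF p])
        fix x assume x: "norm (x - y) < inverse (real (Suc n))"
        have "inverse (real (Suc n)) \<le> 1" by (simp add: inverse_le_1_iff)
        with x y norm_triangle_sub[of x y] have "x \<in> cball 0 (R + 1)" "y \<in> cball 0 (R + 1)"
          by auto
        with d(2)[of y x] x elim show "\<bar>p x - p y\<bar> \<le> e"
          by (simp add: dist_norm)
      qed
    qed
  qed
qed

lemma conv_moll_tendsto:
  assumes "continuous_on UNIV p"
  shows "(\<lambda>n. conv (moll n) p y) \<longlonglongrightarrow> p y"
proof (rule tendstoI)
  fix e :: real assume "e > 0"
  then have "\<forall>\<^sub>F n in sequentially. \<forall>z\<in>cball 0 (norm y). \<bar>conv (moll n) p z - p z\<bar> \<le> e / 2"
    by (intro conv_moll_uniform_limit assms) simp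
  then show "\<forall>\<^sub>F n in sequentially. dist (conv (moll n) p y) (p y) < e"
    by eventually_elim (use \<open>e > 0\<close> in \<open>force simp: dist_norm\<close>)
qed

lemma conv_moll_bounded:
  assumes "continuous_on UNIV p"
  obtains B where "B > 0" "\<And>n y. norm y \<le> R \<Longrightarrow> \<bar>conv (moll n) p y\<bar> \<le> B"
proof -
  have "bounded (p ` cball 0 (R + 1))"
    by (intro compact_imp_bounded compact_continuous_image continuous_on_subset[OF assms]) auto
  then obtain B where B: "B > 0" "\<And>x. x \<in> cball 0 (R + 1) \<Longrightarrow> \<bar>p x\<bar> \<le> B"
    by (auto simp: bounded_pos)
  have "\<bar>conv (moll n) p y - 0\<bar> \<le> B" if y: "norm y \<le> R" for n y
  proof (rule conv_moll_close[OF assms])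
    fix x assume x: "norm (x - y) < inverse (real (Suc n))"
    have "inverse (real (Suc n)) \<le> 1" by (simp add: inverse_le_1_iff)
    with x y norm_triangle_sub[of x y] show "\<bar>p x - 0\<bar> \<le> B" by (simp add: B(2))
  qed
  with B(1) show ?thesis using that by simp
qed

text \<open>Fubini and the evenness of the mollifier move the convolution from w to \<phi>. As
  \<phi> is continuous with compact support, its mollifications converge pointwise, with a common
  bound and a common support.\<close>

lemma conv_moll_weak_limit:
  assumes w: "loc_int w" and \<phi>: "cont_cpt \<phi>"
  shows "(\<lambda>n. LINT y|lebesgue. conv (moll n) w y * \<phi> y) \<longlonglongrightarrow> (LINT x|lebesgue. \<phi> x * w x)"
proof -
  have c: "continuous_on UNIV \<phi>" using \<phi> by (simp add: cont_cpt_def)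
  obtain R where R: "\<And>x. norm x > R \<Longrightarrow> \<phi> x = 0" using \<phi> by (auto simp: cont_cpt_def)
  obtain M where M: "M > 0" "\<And>x. \<bar>\<phi> x\<bar> \<le> M" using cont_cpt_bounded \<phi> by blast
  have "(\<lambda>n. LINT x|lebesgue. conv (moll n) \<phi> x * w x) \<longlonglongrightarrow> (LINT x|lebesgue. \<phi> x * w x)"
  proof (rule conv_dominated[OF w])
    show "conv (moll n) \<phi> \<in> borel_measurable lebesgue" for n
      by (intro continuous_borel_measurable_lebesgue conv_continuous continuous_loc_int c cont_cpt_moll)
    show "\<phi> \<in> borel_measurable lebesgue"
      by (intro continuous_borel_measurable_lebesgue c)
    show "\<bar>conv (moll n) \<phi> x\<bar> \<le> M" for n x
      using conv_moll_close[OF c, where c = 0 and e = M] M(2) by simp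
    show "conv (moll n) \<phi> x = 0" if x: "norm x > R + 1" for n x
    proof -
      have "\<bar>conv (moll n) \<phi> x - 0\<bar> \<le> 0"
      proof (rule conv_moll_close[OF c])
        fix z assume z: "norm (z - x) < inverse (real (Suc n))"
        have "inverse (real (Suc n)) \<le> 1" by (simp add: inverse_le_1_iff)
        with z x norm_triangle_sub[of x z] have "norm z > R" by (simp add: norm_minus_commute)
        then show "\<bar>\<phi> z - 0\<bar> \<le> 0" by (simp add: R)
      qed
      then show ?thesis by simp
    qed
    show "(\<lambda>n. conv (moll n) \<phi> x) \<longlonglongrightarrow> \<phi> x" for x
      by (rule conv_moll_tendsto[OF c])
  qed
  moreover have "(LINT y|lebesgue. conv (moll n) w y * \<phi> y) = (LINT x|lebesgue. conv (moll n) \<phi> x * w x)" for n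
    unfolding conv_fubini[OF w cont_cpt_moll \<phi>] by (subst moll_minus) (simp add: conv_def)
  ultimately show ?thesis by simp
qed

section \<open>Derivatives of mollified functions\<close>

lemma has_partial_reflect:
  assumes "has_partial b f f'"
  shows "has_partial b (\<lambda>x. f (y - x)) (\<lambda>x. - f' (y - x))"
  unfolding has_partial_def
proof
  fix x
  have "((\<lambda>t. f (y - x + (- t) *\<^sub>R b)) has_real_derivative f' (y - x + (- 0) *\<^sub>R b) * - 1) (at 0)"
    by (rule DERIV_chain2[OF has_partialD[OF assms]]) (auto intro!: derivative_eq_intros)
  then show "((\<lambda>t. f (y - (x + t *\<^sub>R b))) has_real_derivative - f' (y - x)) (at 0)"
    by (simp add: algebra_simps)
qed

lemma pd_moll_reflect:
  "pd b (\<lambda>x. moll n (y - x)) = (\<lambda>x. - pd b (moll n) (y - x))"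
  by (rule has_partial_unique[OF test_function_has_partial
        has_partial_reflect[OF test_function_has_partial[OF test_function_moll]]])
     (use test_function_moll_diff[of n y] in \<open>simp add: moll_minus[of _ _ y]\<close>)

lemma test_function_moll_reflect: "test_function (\<lambda>x. moll n (y - x))"
  using test_function_moll_diff[of n y] by (simp add: moll_minus[of _ _ y])

lemma pd_pd_moll_reflect:
  assumes "b \<in> Basis"
  shows "pd b (pd b (\<lambda>x. moll n (y - x))) = (\<lambda>x. pd b (pd b (moll n)) (y - x))"
proof (rule has_partial_unique)
  show "has_partial b (pd b (\<lambda>x. moll n (y - x))) (pd b (pd b (\<lambda>x. moll n (y - x))))"
    by (intro test_function_has_partial test_function_pd test_function_moll_reflect assms)
  have "has_partial b (pd b (moll n)) (pd b (pd b (moll n)))"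
    by (intro test_function_has_partial test_function_pd test_function_moll assms)
  from has_partial_reflect[OF this, of y]
  show "has_partial b (pd b (\<lambda>x. moll n (y - x))) (\<lambda>x. pd b (pd b (moll n)) (y - x))"
    by (auto simp: pd_moll_reflect has_partial_def intro: DERIV_minus[where D = "- _", simplified])
qed

lemma conv_moll_has_partial:
  assumes "loc_int w"
  shows "b \<in> Basis \<Longrightarrow> has_partial b (conv (moll n) w) (conv (pd b (moll n)) w)"
    and "b \<in> Basis \<Longrightarrow> has_partial b (conv (pd b (moll n)) w) (conv (pd b (pd b (moll n))) w)"
  by (intro conv_has_partial assms test_function_cont_cpt test_function_pd test_function_moll
        test_function_has_partial; assumption)+

text \<open>Testing with x |-> \<open>moll n (y - x)\<close>, the sign from the reflection cancels
  the sign in \<open>weak_gradient\<close>. Thus the classical derivative of the mollification is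
  the mollified weak derivative.\<close>

lemma weak_gradient_conv:
  assumes "weak_gradient u G" "b \<in> Basis"
  shows "has_partial b (conv (moll n) u) (conv (moll n) (\<lambda>x. G x \<bullet> b))"
proof -
  have u: "loc_int u" using assms(1) by (auto simp: weak_gradient_def intro: loc_Lp_imp_loc_int)
  have "conv (pd b (moll n)) u y = conv (moll n) (\<lambda>x. G x \<bullet> b) y" for y
  proof -
    have "(LINT x|lebesgue. u x * pd b (\<lambda>x. moll n (y - x)) x)
        = - (LINT x|lebesgue. (G x \<bullet> b) * moll n (y - x))"
      using assms test_function_moll_reflect[of n y] unfolding weak_gradient_def pd_def by blast
    then show ?thesis
      unfolding pd_moll_reflect conv_def by (simp add: mult.commute)
  qed
  then have "conv (pd b (moll n)) u = conv (moll n) (\<lambda>x. G x \<bullet> b)" by blast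
  then show ?thesis
    using conv_moll_has_partial(1)[OF u assms(2), of n] by simp
qed

text \<open>Density of continuous functions in weighted L^2, in two dominated-convergence steps: w
  is truncated at a level m, and the truncation is then approximated almost everywhere by continuous
  functions.\<close>

lemma continuous_L2_approx:
  fixes w :: "'a::euclidean_space \<Rightarrow> real"
  assumes w: "w \<in> borel_measurable lebesgue" "loc_int (\<lambda>x. (w x)\<^sup>2)"
    and \<phi>: "cont_cpt \<phi>" "\<And>x. \<phi> x \<ge> 0" and e: "e > 0"
  obtains g where "continuous_on UNIV g" "(LINT x|lebesgue. \<phi> x * (w x - g x)\<^sup>2) < e"
proof -
  have \<phi>m: "\<phi> \<in> borel_measurable lebesgue"
    using \<phi> by (auto simp: cont_cpt_def intro: continuous_borel_measurable_lebesgue)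
  define clamp where "clamp m t = max (- real m) (min (real m) t)" for m and t :: real
  have clamp_cont: "continuous_on UNIV (clamp m)" for m
    unfolding clamp_def by (intro continuous_intros)
  have clamp_bound: "\<bar>clamp m t\<bar> \<le> real m" for m t
    by (auto simp: clamp_def)
  have clamp_meas: "(\<lambda>x. clamp m (f x)) \<in> borel_measurable lebesgue"
    if "f \<in> borel_measurable lebesgue" for f m
    unfolding clamp_def using that by (intro borel_measurable_max borel_measurable_min) auto
  have iw: "integrable lebesgue (\<lambda>x. \<phi> x * (w x)\<^sup>2)"
    by (intro integrable_cont_cpt_mult w \<phi>)
  have clamp_w_meas: "(\<lambda>x. \<phi> x * (w x - clamp m (w x))\<^sup>2) \<in> borel_measurable lebesgue" for m
    using \<phi>m clamp_meas[OF w(1)] w(1)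
    by (intro borel_measurable_times borel_measurable_power borel_measurable_diff) auto
  have clamp_w_le: "\<phi> x * (w x - clamp m (w x))\<^sup>2 \<le> \<phi> x * (w x)\<^sup>2" for x m
  proof -
    have "\<bar>w x - clamp m (w x)\<bar> \<le> \<bar>w x\<bar>" by (auto simp: clamp_def)
    then have "(w x - clamp m (w x))\<^sup>2 \<le> (w x)\<^sup>2" by (simp add: abs_le_square_iff)
    then show ?thesis by (intro mult_left_mono \<phi>(2))
  qed
  have "(\<lambda>m. LINT x|lebesgue. \<phi> x * (w x - clamp m (w x))\<^sup>2) \<longlonglongrightarrow> (LINT x|(lebesgue :: 'a measure). 0)"
  proof (rule integral_dominated_convergence[where w = "\<lambda>x. \<phi> x * (w x)\<^sup>2"])
    show "integrable lebesgue (\<lambda>x. \<phi> x * (w x)\<^sup>2)" by (rule iw)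
    show "(\<lambda>x. \<phi> x * (w x - clamp m (w x))\<^sup>2) \<in> borel_measurable lebesgue" for m
      by (rule clamp_w_meas)
    show "AE x in lebesgue. (\<lambda>m. \<phi> x * (w x - clamp m (w x))\<^sup>2) \<longlonglongrightarrow> 0"
    proof (rule AE_I2)
      fix x
      obtain N where N: "real N \<ge> \<bar>w x\<bar>" using real_arch_simple by blast
      have "\<forall>\<^sub>F m in sequentially. \<phi> x * (w x - clamp m (w x))\<^sup>2 = 0"
        using eventually_ge_at_top[of N]
      proof eventually_elim
        case (elim m)
        then have "real N \<le> real m" by simp
        with N have "clamp m (w x) = w x" by (auto simp: clamp_def)
        then show ?case by simp
      qed
      then show "(\<lambda>m. \<phi> x * (w x - clamp m (w x))\<^sup>2) \<longlonglongrightarrow> 0" by (rule tendsto_eventually)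
    qed
    show "AE x in lebesgue. norm (\<phi> x * (w x - clamp m (w x))\<^sup>2) \<le> \<phi> x * (w x)\<^sup>2" for m
      using clamp_w_le \<phi>(2) by (simp add: abs_mult)
  qed simp
  \<comment> \<open>Both approximation errors are kept below e / 4, since (s + t)^2 \<le> 2 s^2 + 2
    t^2 doubles each of them when they are combined.\<close>
  then have "\<forall>\<^sub>F m in sequentially. (LINT x|lebesgue. \<phi> x * (w x - clamp m (w x))\<^sup>2) < e / 4"
    using e by (intro order_tendstoD(2)) auto
  then obtain m where m: "(LINT x|lebesgue. \<phi> x * (w x - clamp m (w x))\<^sup>2) < e / 4"
    by (auto simp: eventually_sequentially)
  have "w measurable_on UNIV"
    by (rule lebesgue_measurable_imp_measurable_on[OF w(1)]) simp
  then obtain N g where N: "negligible N" and g: "\<And>n::nat. continuous_on UNIV (g n)"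
    and lim: "\<And>x. x \<notin> N \<Longrightarrow> (\<lambda>n. g n x) \<longlonglongrightarrow> w x"
    by (auto simp: measurable_on_def)
  \<comment> \<open>The continuous approximants of w may be unbounded; clamping them at the same
    level m keeps them continuous and bounds the squared error by (2 m)^2.\<close>
  define h where "h n x = clamp m (g n x)" for n x
  have h: "continuous_on UNIV (h n)" for n
    unfolding h_def by (rule continuous_on_compose2[OF clamp_cont g]) simp
  have i4: "integrable lebesgue (\<lambda>x. \<phi> x * (2 * real m)\<^sup>2)"
    by (intro integrable_cont_cpt cont_cpt_mult \<phi>) simp
  have cm: "\<bar>clamp m s - clamp m t\<bar> \<le> \<bar>2 * real m\<bar>" for s t
    using clamp_bound[of m s] clamp_bound[of m t] by linarith
  have cm2: "\<phi> x * (clamp m s - clamp m t)\<^sup>2 \<le> \<phi> x * (2 * real m)\<^sup>2" for s t x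
    using cm[of s t] by (intro mult_left_mono \<phi>(2)) (simp only: abs_le_square_iff)
  have hm: "(\<lambda>x. \<phi> x * (clamp m (w x) - h n x)\<^sup>2) \<in> borel_measurable lebesgue" for n
    using \<phi>m clamp_meas[OF w(1)] continuous_borel_measurable_lebesgue[OF h]
    by (intro borel_measurable_times borel_measurable_power borel_measurable_diff) auto
  have "(\<lambda>n. LINT x|lebesgue. \<phi> x * (clamp m (w x) - h n x)\<^sup>2) \<longlonglongrightarrow> (LINT x|(lebesgue :: 'a measure). 0)"
  proof (rule integral_dominated_convergence[where w = "\<lambda>x. \<phi> x * (2 * real m)\<^sup>2"])
    show "integrable lebesgue (\<lambda>x. \<phi> x * (2 * real m)\<^sup>2)" by (rule i4)
    show "(\<lambda>x. \<phi> x * (clamp m (w x) - h n x)\<^sup>2) \<in> borel_measurable lebesgue" for n by (rule hm)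
    have "AE x in lebesgue. x \<notin> N"
      using N by (simp add: negligible_iff_null_sets AE_not_in)
    then show "AE x in lebesgue. (\<lambda>n. \<phi> x * (clamp m (w x) - h n x)\<^sup>2) \<longlonglongrightarrow> 0"
    proof eventually_elim
      case (elim x)
      have "(\<lambda>n. h n x) \<longlonglongrightarrow> clamp m (w x)"
        unfolding h_def by (rule continuous_on_tendsto_compose[OF clamp_cont lim[OF elim]]) auto
      then have "(\<lambda>n. \<phi> x * (clamp m (w x) - h n x)\<^sup>2)
          \<longlonglongrightarrow> \<phi> x * (clamp m (w x) - clamp m (w x))\<^sup>2"
        by (intro tendsto_intros)
      then show ?case by simp
    qed
    show "AE x in lebesgue. norm (\<phi> x * (clamp m (w x) - h n x)\<^sup>2) \<le> \<phi> x * (2 * real m)\<^sup>2" for n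
      unfolding h_def using cm2 \<phi>(2) by (simp add: abs_mult)
  qed simp
  then have "\<forall>\<^sub>F n in sequentially. (LINT x|lebesgue. \<phi> x * (clamp m (w x) - h n x)\<^sup>2) < e / 4"
    using e by (intro order_tendstoD(2)) auto
  then obtain n where n: "(LINT x|lebesgue. \<phi> x * (clamp m (w x) - h n x)\<^sup>2) < e / 4"
    by (auto simp: eventually_sequentially)
  have i1: "integrable lebesgue (\<lambda>x. \<phi> x * (w x - clamp m (w x))\<^sup>2)"
    by (rule Bochner_Integration.integrable_bound[OF iw clamp_w_meas])
       (use clamp_w_le \<phi>(2) in \<open>simp add: abs_mult\<close>)
  have i2: "integrable lebesgue (\<lambda>x. \<phi> x * (clamp m (w x) - h n x)\<^sup>2)"
    by (rule Bochner_Integration.integrable_bound[OF i4 hm])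
       (use cm2 \<phi>(2) in \<open>simp add: abs_mult h_def\<close>)
  have le: "\<phi> x * (w x - h n x)\<^sup>2
      \<le> 2 * (\<phi> x * (w x - clamp m (w x))\<^sup>2) + 2 * (\<phi> x * (clamp m (w x) - h n x)\<^sup>2)" for x
  proof -
    have "0 \<le> ((w x - clamp m (w x)) - (clamp m (w x) - h n x))\<^sup>2" by simp
    then have "(w x - h n x)\<^sup>2 \<le> 2 * (w x - clamp m (w x))\<^sup>2 + 2 * (clamp m (w x) - h n x)\<^sup>2"
      by (simp add: power2_eq_square algebra_simps)
    from mult_left_mono[OF this \<phi>(2)[of x]] show ?thesis by (simp add: algebra_simps)
  qed
  have "(LINT x|lebesgue. \<phi> x * (w x - h n x)\<^sup>2)
      \<le> (LINT x|lebesgue. 2 * (\<phi> x * (w x - clamp m (w x))\<^sup>2) + 2 * (\<phi> x * (clamp m (w x) - h n x)\<^sup>2))"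
    by (rule integral_mono_AE') (use i1 i2 le \<phi>(2) in auto)
  also have "\<dots> = 2 * (LINT x|lebesgue. \<phi> x * (w x - clamp m (w x))\<^sup>2)
      + 2 * (LINT x|lebesgue. \<phi> x * (clamp m (w x) - h n x)\<^sup>2)"
    using i1 i2 by simp
  also have "\<dots> < e" using m n by simp
  finally show ?thesis using that h by blast
qed

section \<open>The Hopf--Cole transformation\<close>

text \<open>Jensen's inequality for the averaging kernel: the averaged square of w - a, with a the
  average of w at y, is nonnegative.\<close>

lemma conv_moll_power2_le:
  assumes "loc_int w" "loc_int (\<lambda>x. (w x)\<^sup>2)"
  shows "(conv (moll n) w y)\<^sup>2 \<le> conv (moll n) (\<lambda>x. (w x)\<^sup>2) y"
proof -
  define a where "a = conv (moll n) w y"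
  have c: "loc_int (\<lambda>x::'a. a\<^sup>2)" by (intro continuous_loc_int) simp
  have "0 \<le> conv (moll n) (\<lambda>x. (w x - a)\<^sup>2) y"
    unfolding conv_def by (intro integral_nonneg_AE AE_I2 mult_nonneg_nonneg moll_nonneg) simp
  also have "(\<lambda>x. (w x - a)\<^sup>2) = (\<lambda>x. (w x)\<^sup>2 + ((- 2 * a) * w x + a\<^sup>2))"
    by (simp add: power2_eq_square algebra_simps)
  also have "conv (moll n) \<dots> y = conv (moll n) (\<lambda>x. (w x)\<^sup>2) y + (- 2 * a * a + a\<^sup>2)"
    by (simp only: conv_add assms c loc_int_add loc_int_cmult cont_cpt_moll conv_cmult
        conv_moll_const a_def[symmetric])
  finally show ?thesis by (simp add: a_def power2_eq_square)
qed

text \<open>For every continuous g, the bound b^2 \<ge> 2 b g - g^2 with b the mollified w estimates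
  the defect by an expression linear in mollified functions. Its weak limit is the integral of
  \<phi> (w - g)^2, which is small for a suitable g.\<close>

lemma conv_moll_power2_defect:
  assumes w: "loc_int w" "loc_int (\<lambda>x. (w x)\<^sup>2)" and \<phi>: "cont_cpt \<phi>" "\<And>x. \<phi> x \<ge> 0"
  shows "(\<lambda>n. LINT y|lebesgue. (conv (moll n) (\<lambda>x. (w x)\<^sup>2) y - (conv (moll n) w y)\<^sup>2) * \<phi> y)
    \<longlonglongrightarrow> 0"
proof (rule tendstoI)
  fix e :: real assume e: "e > 0"
  obtain g where g: "continuous_on UNIV g" "(LINT x|lebesgue. \<phi> x * (w x - g x)\<^sup>2) < e"
    using continuous_L2_approx[OF loc_int_measurable[OF w(1)] w(2) \<phi> e] by blast
  have g2: "continuous_on UNIV (\<lambda>x. (g x)\<^sup>2)"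
    by (intro continuous_intros g)
  have \<phi>g: "cont_cpt (\<lambda>x. \<phi> x * g x)" by (intro cont_cpt_mult \<phi> g)
  define I where "I n = (LINT y|lebesgue. conv (moll n) (\<lambda>x. (w x)\<^sup>2) y * \<phi> y)
      - 2 * (LINT y|lebesgue. conv (moll n) w y * (\<phi> y * g y)) + (LINT y|lebesgue. \<phi> y * (g y)\<^sup>2)" for n
  have i: "integrable lebesgue (\<lambda>x. \<phi> x * (w x)\<^sup>2)" "integrable lebesgue (\<lambda>x. \<phi> x * g x * w x)"
    "integrable lebesgue (\<lambda>x. \<phi> x * (g x)\<^sup>2)"
    by (intro integrable_cont_cpt_mult w \<phi> \<phi>g continuous_loc_int g2)+
  have "I \<longlonglongrightarrow> (LINT x|lebesgue. \<phi> x * (w x)\<^sup>2) - 2 * (LINT x|lebesgue. \<phi> x * g x * w x)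
      + (LINT x|lebesgue. \<phi> x * (g x)\<^sup>2)"
    unfolding I_def by (intro tendsto_intros conv_moll_weak_limit w \<phi> \<phi>g)
  also have "(LINT x|lebesgue. \<phi> x * (w x)\<^sup>2) - 2 * (LINT x|lebesgue. \<phi> x * g x * w x)
      + (LINT x|lebesgue. \<phi> x * (g x)\<^sup>2)
      = (LINT x|lebesgue. \<phi> x * (w x)\<^sup>2 - 2 * (\<phi> x * g x * w x) + \<phi> x * (g x)\<^sup>2)"
    using i by simp
  also have "\<dots> = (LINT x|lebesgue. \<phi> x * (w x - g x)\<^sup>2)"
    by (rule Bochner_Integration.integral_cong) (simp_all add: power2_eq_square algebra_simps)
  finally have "\<forall>\<^sub>F n in sequentially. I n < e"
    using g(2) by (rule order_tendstoD(2))
  then show "\<forall>\<^sub>F n in sequentially.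
    dist (LINT y|lebesgue. (conv (moll n) (\<lambda>x. (w x)\<^sup>2) y - (conv (moll n) w y)\<^sup>2) * \<phi> y) 0 < e"
  proof eventually_elim
    case (elim n)
    let ?a = "conv (moll n) (\<lambda>x. (w x)\<^sup>2)" and ?b = "conv (moll n) w"
    have ac: "continuous_on UNIV ?a" and bc: "continuous_on UNIV ?b"
      by (intro conv_continuous w cont_cpt_moll)+
    have ii: "integrable lebesgue (\<lambda>y. ?a y * \<phi> y)" "integrable lebesgue (\<lambda>y. ?b y * (\<phi> y * g y))"
      using integrable_cont_cpt[OF cont_cpt_mult[OF \<phi>(1) ac]]
        integrable_cont_cpt[OF cont_cpt_mult[OF \<phi>g bc]]
      by (simp_all add: mult.commute mult.left_commute)
    have id: "integrable lebesgue (\<lambda>y. (?a y - (?b y)\<^sup>2) * \<phi> y)"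
    proof -
      have "continuous_on UNIV (\<lambda>y. ?a y - (?b y)\<^sup>2)" by (intro continuous_intros ac bc)
      from integrable_cont_cpt[OF cont_cpt_mult[OF \<phi>(1) this]] show ?thesis
        by (simp add: mult.commute)
    qed
    have "(LINT y|lebesgue. (?a y - (?b y)\<^sup>2) * \<phi> y)
        \<le> (LINT y|lebesgue. ?a y * \<phi> y - 2 * (?b y * (\<phi> y * g y)) + \<phi> y * (g y)\<^sup>2)"
    proof (rule integral_mono[OF id])
      show "integrable lebesgue (\<lambda>y. ?a y * \<phi> y - 2 * (?b y * (\<phi> y * g y)) + \<phi> y * (g y)\<^sup>2)"
        using ii i(3) by simp
      fix y
      have "0 \<le> \<phi> y * (?b y - g y)\<^sup>2" by (simp add: \<phi>(2))
      then show "(?a y - (?b y)\<^sup>2) * \<phi> y \<le> ?a y * \<phi> y - 2 * (?b y * (\<phi> y * g y)) + \<phi> y * (g y)\<^sup>2"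
        by (simp add: power2_eq_square algebra_simps)
    qed
    also have "\<dots> = I n"
      using ii i(3) by (simp add: I_def)
    finally have "(LINT y|lebesgue. (?a y - (?b y)\<^sup>2) * \<phi> y) < e" using elim by simp
    moreover have "(LINT y|lebesgue. (?a y - (?b y)\<^sup>2) * \<phi> y) \<ge> 0"
      using conv_moll_power2_le[OF w] \<phi>(2) by (intro integral_nonneg_AE AE_I2 mult_nonneg_nonneg) auto
    ultimately show ?case by simp
  qed
qed

lemma integral_cont_cpt_limit:
  fixes \<phi> :: "'a::euclidean_space \<Rightarrow> real"
  assumes \<phi>: "cont_cpt \<phi>" and f: "\<And>n. continuous_on UNIV (f n)" "continuous_on UNIV h"
    and lim: "\<And>y. (\<lambda>n. f n y) \<longlonglongrightarrow> h y" and bound: "\<And>n y. \<phi> y \<noteq> 0 \<Longrightarrow> \<bar>f n y\<bar> \<le> B"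
  shows "(\<lambda>n. LINT y|lebesgue. f n y * \<phi> y) \<longlonglongrightarrow> (LINT y|lebesgue. h y * \<phi> y)"
proof -
  obtain M where M: "M > 0" "\<And>x. \<bar>\<phi> x\<bar> \<le> M" using cont_cpt_bounded \<phi> by blast
  obtain R where R: "\<And>x. norm x > R \<Longrightarrow> \<phi> x = 0" using \<phi> by (auto simp: cont_cpt_def)
  have c: "continuous_on UNIV \<phi>" using \<phi> by (simp add: cont_cpt_def)
  have "(\<lambda>n. LINT y|lebesgue. (f n y * \<phi> y) * 1) \<longlonglongrightarrow> (LINT y|lebesgue. (h y * \<phi> y) * 1)"
  proof (rule conv_dominated)
    show "loc_int (\<lambda>_::'a. 1)" by (intro continuous_loc_int) simp
    show "(\<lambda>y. f n y * \<phi> y) \<in> borel_measurable lebesgue" for n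
      by (intro continuous_borel_measurable_lebesgue continuous_on_mult f c)
    show "(\<lambda>y. h y * \<phi> y) \<in> borel_measurable lebesgue"
      by (intro continuous_borel_measurable_lebesgue continuous_on_mult f c)
    show "\<bar>f n y * \<phi> y\<bar> \<le> \<bar>B\<bar> * M" for n y
    proof (cases "\<phi> y = 0")
      case False
      then show ?thesis
        using bound[of y n] M(2)[of y] by (auto simp: abs_mult intro!: mult_mono)
    qed (use M(1) in simp)
    show "f n y * \<phi> y = 0" if "norm y > R" for n y using R that by simp
    show "(\<lambda>n. f n y * \<phi> y) \<longlonglongrightarrow> h y * \<phi> y" for y
      by (intro tendsto_intros lim)
  qed
  then show ?thesis by simp
qed

text \<open>Mollifying \<open>p\<close> produces the defect \<open>(\<bar>G\<bar>\<^sup>2)\<^sub>n - \<bar>G\<^sub>n\<bar>\<^sup>2\<close> in the equation of \<open>exp (- s p\<^sub>n)\<close>;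
  it vanishes in the limit because \<open>\<bar>G\<bar>\<^sup>2\<close>, by the equation itself, is locally integrable.\<close>

lemma hopf_cole:
  fixes p :: "'a::euclidean_space \<Rightarrow> real"
  assumes p: "continuous_on UNIV p" and wd: "weak_derivatives2 p G H"
    and c: "continuous_on UNIV c" and s: "s > 0"
    and eq: "AE x in lebesgue. laplacian_of H x = s * (norm (G x))\<^sup>2 + c x"
    and \<psi>: "test_function \<psi>" "\<And>x. \<psi> x \<ge> 0"
  shows "(LINT x|lebesgue. exp (- s * p x) * lap \<psi> x)
       = (LINT x|lebesgue. (- s * c x * exp (- s * p x)) * \<psi> x)"
proof -
  let ?D = "\<lambda>b x. G x \<bullet> b" and ?N = "\<lambda>x. \<Sum>b\<in>Basis. (G x \<bullet> b)\<^sup>2"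
  have wg: "weak_gradient p G" and wgi: "\<And>b. b \<in> Basis \<Longrightarrow> weak_gradient (?D b) (H b)"
    using wd by (auto simp: weak_derivatives2_def)
  have pl: "loc_int p" and cl: "loc_int c" by (intro continuous_loc_int p c)+
  have Dl: "loc_int (?D b)" if "b \<in> Basis" for b
    using wgi[OF that] by (auto simp: weak_gradient_def intro: loc_Lp_imp_loc_int)
  have Hl: "loc_int (\<lambda>x. H b x \<bullet> b)" if "b \<in> Basis" for b
  proof -
    have HL: "loc_Lp 1 (H b)" using wgi[OF that] by (simp add: weak_gradient_def)
    then have m: "H b \<in> borel_measurable lebesgue" by (simp add: loc_Lp_def)
    have nl: "loc_int (\<lambda>x. norm (H b x))"
      using HL by (intro loc_Lp_imp_loc_int) (auto simp: loc_Lp_def)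
    show ?thesis
    proof (rule loc_int_bound[OF nl])
      show "(\<lambda>x. H b x \<bullet> b) \<in> borel_measurable lebesgue"
        using m by (intro borel_measurable_inner) auto
      show "AE x in lebesgue. \<bar>H b x \<bullet> b\<bar> \<le> \<bar>norm (H b x)\<bar>"
        using Basis_le_norm[OF that] by auto
    qed
  qed
  have Ll: "loc_int (laplacian_of H)"
    unfolding laplacian_of_def[abs_def] by (intro loc_int_sum Hl)
  have norm_eq: "(norm (G x))\<^sup>2 = ?N x" for x
    unfolding power2_norm_eq_inner by (subst euclidean_inner) (simp add: power2_eq_square)
  have Dm: "?D b \<in> borel_measurable lebesgue" if "b \<in> Basis" for b
    using Dl[OF that] by (rule loc_int_measurable)
  have Nm: "?N \<in> borel_measurable lebesgue"
    by (intro borel_measurable_sum borel_measurable_power Dm)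
  have Nl: "loc_int ?N"
  proof (rule loc_int_bound[OF _ Nm])
    show "loc_int (\<lambda>x. (1 / s) * (laplacian_of H x + (- 1) * c x))"
      by (intro loc_int_cmult loc_int_add Ll cl)
    show "AE x in lebesgue. \<bar>?N x\<bar> \<le> \<bar>(1 / s) * (laplacian_of H x + (- 1) * c x)\<bar>"
      using eq by eventually_elim (use s in \<open>simp add: norm_eq\<close>)
  qed
  have D2l: "loc_int (\<lambda>x. (?D b x)\<^sup>2)" if "b \<in> Basis" for b
  proof (rule loc_int_bound[OF Nl])
    show "(\<lambda>x. (?D b x)\<^sup>2) \<in> borel_measurable lebesgue"
      by (intro borel_measurable_power Dm that)
    show "AE x in lebesgue. \<bar>(?D b x)\<^sup>2\<bar> \<le> \<bar>?N x\<bar>"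
    proof (rule AE_I2)
      fix x
      have "(?D b x)\<^sup>2 \<le> ?N x"
        by (rule member_le_sum) (use that in auto)
      then show "\<bar>(?D b x)\<^sup>2\<bar> \<le> \<bar>?N x\<bar>" by simp
    qed
  qed
  define P where "P n = conv (moll n) p" for n
  define C where "C n = conv (moll n) c" for n
  define g where "g n b = conv (moll n) (?D b)" for n b
  define h where "h n b = conv (moll n) (\<lambda>x. H b x \<bullet> b)" for n b
  \<comment> \<open>The defect of the b-th derivative, mollified square minus square of the
    mollification: the only term in which mollifying fails to respect the equation.\<close>
  define E where "E n b y = conv (moll n) (\<lambda>x. (?D b x)\<^sup>2) y - (g n b y)\<^sup>2" for n b y
  have Pc: "continuous_on UNIV (P n)" and Cc: "continuous_on UNIV (C n)" for n
    unfolding P_def C_def by (intro conv_continuous pl cl cont_cpt_moll)+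
  have gc: "continuous_on UNIV (g n b)" and hc: "continuous_on UNIV (h n b)"
    and Ec: "continuous_on UNIV (E n b)" if "b \<in> Basis" for n b
    unfolding E_def g_def h_def
    by (intro continuous_intros conv_continuous Dl Hl D2l cont_cpt_moll that)+
  have Pp: "has_partial b (P n) (g n b)" and gp: "has_partial b (g n b) (h n b)"
    if "b \<in> Basis" for n b
    unfolding P_def g_def h_def by (intro weak_gradient_conv wg wgi that)+
  \<comment> \<open>The mollified equation. The almost-everywhere identity has become an identity at
    every point, in terms of the mollified squares.\<close>
  have hsum: "(\<Sum>b\<in>Basis. h n b y) = s * (\<Sum>b\<in>Basis. conv (moll n) (\<lambda>x. (?D b x)\<^sup>2) y) + C n y" for n y
  proof -
    have "(\<Sum>b\<in>Basis. h n b y) = conv (moll n) (laplacian_of H) y"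
      unfolding h_def laplacian_of_def[abs_def] by (subst conv_sum) (auto intro: Hl cont_cpt_moll)
    also have "\<dots> = conv (moll n) (\<lambda>x. s * ?N x + c x) y"
    proof (rule conv_cong_AE)
      show "AE x in lebesgue. laplacian_of H x = s * ?N x + c x"
        using eq by eventually_elim (simp add: norm_eq)
      show "(\<lambda>x. s * ?N x + c x) \<in> borel_measurable lebesgue"
        by (intro loc_int_measurable loc_int_add loc_int_cmult Nl cl)
    qed (intro loc_int_measurable Ll cont_cpt_moll)+
    also have "\<dots> = s * conv (moll n) ?N y + C n y"
      by (simp only: conv_add loc_int_cmult Nl cl cont_cpt_moll conv_cmult C_def)
    also have "conv (moll n) ?N y = (\<Sum>b\<in>Basis. conv (moll n) (\<lambda>x. (?D b x)\<^sup>2) y)"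
      by (intro conv_sum D2l cont_cpt_moll)
    finally show ?thesis .
  qed
  define V where "V n y = exp (- s * P n y)" for n y
  have Vc: "continuous_on UNIV (V n)" for n
    unfolding V_def by (intro continuous_intros Pc)
  have pdc: "cont_cpt \<psi>" "cont_cpt (pd b \<psi>)" "cont_cpt (pd b (pd b \<psi>))" if "b \<in> Basis" for b
    by (intro test_function_cont_cpt test_function_pd \<psi> that)+
  have \<psi>c: "cont_cpt \<psi>" by (intro test_function_cont_cpt \<psi>)
  have lapc: "cont_cpt (lap \<psi>)"
    unfolding lap_def[abs_def] by (intro cont_cpt_sum pdc)
  \<comment> \<open>Two integrations by parts move the derivatives onto V = exp (- s P), where the
    second derivative in direction b is s^2 V g^2 - s V h.\<close>
  have parts: "(LINT y|lebesgue. V n y * pd b (pd b \<psi>) y)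
      = (LINT y|lebesgue. (s\<^sup>2 * V n y * (g n b y)\<^sup>2 - s * V n y * h n b y) * \<psi> y)"
    if b: "b \<in> Basis" for n b
  proof -
    define V1 where "V1 y = (- s * exp (- s * P n y)) * g n b y" for y
    define V2 where "V2 y = (s\<^sup>2 * exp (- s * P n y) * g n b y) * g n b y
        + (- s * exp (- s * P n y)) * h n b y" for y
    have "has_partial b (\<lambda>y. exp (- s * P n y)) (\<lambda>y. (- s * exp (- s * P n y)) * g n b y)"
      by (rule has_partial_compose[OF Pp[OF b]]) (auto intro!: derivative_eq_intros)
    then have p1: "has_partial b (V n) V1" by (simp add: V_def[abs_def] V1_def[abs_def])
    have "has_partial b (\<lambda>y. - s * exp (- s * P n y)) (\<lambda>y. (s\<^sup>2 * exp (- s * P n y)) * g n b y)"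
      by (rule has_partial_compose[OF Pp[OF b]])
         (auto intro!: derivative_eq_intros simp: power2_eq_square)
    from has_partial_mult[OF this gp[OF b]]
    have p2: "has_partial b V1 V2" by (simp add: V1_def[abs_def] V2_def[abs_def])
    have V1c: "continuous_on UNIV V1" and V2c: "continuous_on UNIV V2"
      unfolding V1_def V2_def by (intro continuous_intros Pc gc hc b)+
    have "(LINT y|lebesgue. V n y * pd b (pd b \<psi>) y) = - (LINT y|lebesgue. V1 y * pd b \<psi> y)"
      by (rule integral_by_parts[OF p1 Vc V1c test_function_has_partial[OF test_function_pd[OF \<psi>(1) b]]
            pdc(2)[OF b] pdc(3)[OF b]])
    also have "(LINT y|lebesgue. V1 y * pd b \<psi> y) = - (LINT y|lebesgue. V2 y * \<psi> y)"
      by (rule integral_by_parts[OF p2 V1c V2c test_function_has_partial[OF \<psi>(1)] \<psi>c pdc(2)[OF b]])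
    finally show ?thesis by (simp add: V2_def V_def power2_eq_square algebra_simps)
  qed
  \<comment> \<open>After summation over b and insertion of \<open>hsum\<close>, the squares of g
    cancel against the mollified squares up to the defects E.\<close>
  have main: "(LINT y|lebesgue. V n y * lap \<psi> y)
      = - s * (LINT y|lebesgue. (V n y * C n y) * \<psi> y)
        - s\<^sup>2 * (LINT y|lebesgue. (V n y * (\<Sum>b\<in>Basis. E n b y)) * \<psi> y)" for n
  proof -
    have int: "integrable lebesgue (\<lambda>y. f y * \<phi> y)" if "cont_cpt \<phi>" "continuous_on UNIV f" for f \<phi> :: "'a \<Rightarrow> real"
      using integrable_cont_cpt[OF cont_cpt_mult[OF that]] by (simp add: mult.commute)
    have "(LINT y|lebesgue. V n y * lap \<psi> y) = (\<Sum>b\<in>Basis. LINT y|lebesgue. V n y * pd b (pd b \<psi>) y)"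
      unfolding lap_def sum_distrib_left
      by (intro Bochner_Integration.integral_sum int pdc Vc)
    also have "\<dots> = (\<Sum>b\<in>Basis. LINT y|lebesgue.
        (s\<^sup>2 * V n y * (g n b y)\<^sup>2 - s * V n y * h n b y) * \<psi> y)"
      by (intro sum.cong parts) auto
    also have "\<dots> = (LINT y|lebesgue. (\<Sum>b\<in>Basis.
        (s\<^sup>2 * V n y * (g n b y)\<^sup>2 - s * V n y * h n b y) * \<psi> y))"
      by (intro Bochner_Integration.integral_sum[symmetric] int \<psi>c continuous_intros Vc gc hc)
    also have "\<dots> = (LINT y|lebesgue. (- s) * ((V n y * C n y) * \<psi> y)
        - s\<^sup>2 * ((V n y * (\<Sum>b\<in>Basis. E n b y)) * \<psi> y))"
    proof (rule Bochner_Integration.integral_cong)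
      fix y
      have "(\<Sum>b\<in>Basis. (s\<^sup>2 * V n y * (g n b y)\<^sup>2 - s * V n y * h n b y) * \<psi> y)
          = (s\<^sup>2 * V n y * (\<Sum>b\<in>Basis. (g n b y)\<^sup>2) - s * V n y * (\<Sum>b\<in>Basis. h n b y)) * \<psi> y"
        by (simp add: sum_distrib_right[symmetric] sum_distrib_left sum_subtractf)
      also have "\<dots> = (- s) * ((V n y * C n y) * \<psi> y)
          - s\<^sup>2 * ((V n y * (\<Sum>b\<in>Basis. E n b y)) * \<psi> y)"
        unfolding hsum E_def sum_subtractf by (simp add: power2_eq_square algebra_simps)
      finally show "(\<Sum>b\<in>Basis. (s\<^sup>2 * V n y * (g n b y)\<^sup>2 - s * V n y * h n b y) * \<psi> y) = \<dots>" .
    qed simp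
    also have "\<dots> = - s * (LINT y|lebesgue. (V n y * C n y) * \<psi> y)
        - s\<^sup>2 * (LINT y|lebesgue. (V n y * (\<Sum>b\<in>Basis. E n b y)) * \<psi> y)"
    proof -
      have "integrable lebesgue (\<lambda>y. (V n y * C n y) * \<psi> y)"
        "integrable lebesgue (\<lambda>y. (V n y * (\<Sum>b\<in>Basis. E n b y)) * \<psi> y)"
        by (intro int \<psi>c continuous_intros Vc Cc Ec; assumption)+
      then show ?thesis by simp
    qed
    finally show ?thesis .
  qed
  obtain R where R: "\<And>x. norm x > R \<Longrightarrow> \<psi> x = 0" "\<And>x. norm x > R \<Longrightarrow> lap \<psi> x = 0"
  proof -
    obtain R S where "\<And>x. norm x > R \<Longrightarrow> \<psi> x = 0" "\<And>x. norm x > S \<Longrightarrow> lap \<psi> x = 0"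
      using \<psi>c lapc by (auto simp: cont_cpt_def)
    then show ?thesis using that[of "max R S"] by simp
  qed
  obtain B where B: "\<And>n y. norm y \<le> R \<Longrightarrow> \<bar>P n y\<bar> \<le> B"
    using conv_moll_bounded[OF p] unfolding P_def by metis
  obtain K where K: "K > 0" "\<And>n y. norm y \<le> R \<Longrightarrow> \<bar>C n y\<bar> \<le> K"
    using conv_moll_bounded[OF c] unfolding C_def by metis
  have Vb: "\<bar>V n y\<bar> \<le> exp (s * B)" if "norm y \<le> R" for n y
    using B[OF that, of n] s by (simp add: V_def abs_le_iff) (metis mult_left_mono less_imp_le mult_minus_right)
  have Vlim: "(\<lambda>n. V n y) \<longlonglongrightarrow> exp (- s * p y)" for y
    unfolding V_def P_def by (intro tendsto_intros conv_moll_tendsto p)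
  have A1: "(\<lambda>n. LINT y|lebesgue. V n y * lap \<psi> y) \<longlonglongrightarrow> (LINT y|lebesgue. exp (- s * p y) * lap \<psi> y)"
    by (rule integral_cont_cpt_limit[OF lapc Vc _ Vlim, where B = "exp (s * B)"])
       (use Vb R(2) in \<open>auto intro!: continuous_intros p simp: not_less[symmetric]\<close>)
  have A2: "(\<lambda>n. LINT y|lebesgue. (V n y * C n y) * \<psi> y)
      \<longlonglongrightarrow> (LINT y|lebesgue. (exp (- s * p y) * c y) * \<psi> y)"
  proof (rule integral_cont_cpt_limit[OF \<psi>c])
    show "(\<lambda>n. V n y * C n y) \<longlonglongrightarrow> exp (- s * p y) * c y" for y
      unfolding C_def by (intro tendsto_mult Vlim conv_moll_tendsto c)
    show "\<bar>V n y * C n y\<bar> \<le> exp (s * B) * K" if "\<psi> y \<noteq> 0" for n y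
    proof -
      have "norm y \<le> R" using R(1) that not_le by blast
      then show ?thesis unfolding abs_mult by (intro mult_mono Vb K) auto
    qed
  qed (intro continuous_intros Vc Cc p c)+
  \<comment> \<open>The defects are nonnegative by Jensen and V is at most exp (s B) on the support
    of \<psi>, so the defects weighted by \<psi> alone control this integral.\<close>
  have A3: "(\<lambda>n. LINT y|lebesgue. (V n y * (\<Sum>b\<in>Basis. E n b y)) * \<psi> y) \<longlonglongrightarrow> 0"
  proof (rule real_tendsto_sandwich)
    have E0: "E n b y \<ge> 0" if "b \<in> Basis" for n b y
      unfolding E_def g_def using conv_moll_power2_le[OF Dl[OF that] D2l[OF that]] by simp
    have iE: "integrable lebesgue (\<lambda>y. E n b y * \<psi> y)" if "b \<in> Basis" for n b
      using integrable_cont_cpt[OF cont_cpt_mult[OF \<psi>c Ec[OF that]]] by (simp add: mult.commute)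
    show "\<forall>\<^sub>F n in sequentially. 0 \<le> (LINT y|lebesgue. (V n y * (\<Sum>b\<in>Basis. E n b y)) * \<psi> y)"
      using \<psi>(2) E0 by (intro always_eventually allI integral_nonneg_AE AE_I2)
        (auto intro!: mult_nonneg_nonneg sum_nonneg simp: V_def)
    show "\<forall>\<^sub>F n in sequentially. (LINT y|lebesgue. (V n y * (\<Sum>b\<in>Basis. E n b y)) * \<psi> y)
        \<le> exp (s * B) * (\<Sum>b\<in>Basis. LINT y|lebesgue. E n b y * \<psi> y)"
    proof (intro always_eventually allI)
      fix n
      have "(LINT y|lebesgue. (V n y * (\<Sum>b\<in>Basis. E n b y)) * \<psi> y)
          \<le> (LINT y|lebesgue. exp (s * B) * (\<Sum>b\<in>Basis. E n b y * \<psi> y))"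
      proof (rule integral_mono_AE')
        show "integrable lebesgue (\<lambda>y. exp (s * B) * (\<Sum>b\<in>Basis. E n b y * \<psi> y))"
          by (intro integrable_mult_right Bochner_Integration.integrable_sum iE)
        have nn: "0 \<le> (\<Sum>b\<in>Basis. E n b y * \<psi> y)" for y
          using E0 \<psi>(2) by (auto intro!: sum_nonneg)
        show "AE y in lebesgue. (V n y * (\<Sum>b\<in>Basis. E n b y)) * \<psi> y
            \<le> exp (s * B) * (\<Sum>b\<in>Basis. E n b y * \<psi> y)"
        proof (rule AE_I2)
          fix y
          have "V n y * (\<Sum>b\<in>Basis. E n b y * \<psi> y) \<le> exp (s * B) * (\<Sum>b\<in>Basis. E n b y * \<psi> y)"
          proof (cases "norm y \<le> R")
            case True
            then show ?thesis using Vb[of y n] nn by (intro mult_right_mono) auto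
          qed (use R(1) in simp)
          then show "(V n y * (\<Sum>b\<in>Basis. E n b y)) * \<psi> y \<le> exp (s * B) * (\<Sum>b\<in>Basis. E n b y * \<psi> y)"
            by (simp add: sum_distrib_right mult.assoc)
        qed
        show "AE y in lebesgue. 0 \<le> exp (s * B) * (\<Sum>b\<in>Basis. E n b y * \<psi> y)"
          using nn by simp
      qed
      also have "\<dots> = exp (s * B) * (\<Sum>b\<in>Basis. LINT y|lebesgue. E n b y * \<psi> y)"
        by (simp add: Bochner_Integration.integral_sum iE)
      finally show "(LINT y|lebesgue. (V n y * (\<Sum>b\<in>Basis. E n b y)) * \<psi> y) \<le> \<dots>" .
    qed
    have "(\<lambda>n. exp (s * B) * (\<Sum>b\<in>Basis. LINT y|lebesgue. E n b y * \<psi> y))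
        \<longlonglongrightarrow> exp (s * B) * (\<Sum>b\<in>(Basis::'a set). 0)"
      unfolding E_def g_def
      by (intro tendsto_mult tendsto_const tendsto_sum conv_moll_power2_defect Dl D2l \<psi>c \<psi>(2))
    then show "(\<lambda>n. exp (s * B) * (\<Sum>b\<in>Basis. LINT y|lebesgue. E n b y * \<psi> y)) \<longlonglongrightarrow> 0"
      by simp
  qed simp
  have "(\<lambda>n. LINT y|lebesgue. V n y * lap \<psi> y)
      \<longlonglongrightarrow> - s * (LINT y|lebesgue. (exp (- s * p y) * c y) * \<psi> y) - s\<^sup>2 * 0"
    unfolding main by (intro tendsto_intros A2 A3)
  then have "(LINT y|lebesgue. exp (- s * p y) * lap \<psi> y)
      = - s * (LINT y|lebesgue. (exp (- s * p y) * c y) * \<psi> y)"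
    using LIMSEQ_unique[OF A1] by simp
  also have "\<dots> = (LINT y|lebesgue. - s * ((exp (- s * p y) * c y) * \<psi> y))"
    by (rule integral_mult_right_zero[symmetric])
  also have "\<dots> = (LINT x|lebesgue. (- s * c x * exp (- s * p x)) * \<psi> x)"
    by (rule Bochner_Integration.integral_cong) (simp_all add: algebra_simps)
  finally show ?thesis .
qed

section \<open>Viscosity inequalities\<close>

text \<open>If D > 0, then f' is positive immediately to the right of its zero at 0, and the mean
  value theorem produces a value of f above f(0).\<close>

lemma second_derivative_le_0_at_max:
  fixes f :: "real \<Rightarrow> real"
  assumes e: "e > 0" and f: "\<And>t. \<bar>t\<bar> < e \<Longrightarrow> (f has_real_derivative f' t) (at t)"
    and f': "(f' has_real_derivative D) (at 0)"
    and max: "\<And>t. \<bar>t\<bar> < e \<Longrightarrow> f t \<le> f 0"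
  shows "D \<le> 0"
proof (rule ccontr)
  assume "\<not> D \<le> 0"
  then have "D > 0" by simp
  have "f' 0 = 0"
    by (rule DERIV_local_max[OF f e]) (use e max in auto)
  obtain d where d: "d > 0" "\<And>h. 0 < h \<Longrightarrow> h < d \<Longrightarrow> f' 0 < f' (0 + h)"
    using DERIV_pos_inc_right[OF f' \<open>D > 0\<close>] by blast
  define t where "t = min d e / 2"
  have t: "0 < t" "t < d" "t < e" using d(1) e by (auto simp: t_def)
  obtain z where z: "0 < z" "z < t" "f t - f 0 = (t - 0) * f' z"
    using MVT2[of 0 t f f'] t f by force
  then have "f' z > 0" using d(2)[of z] t \<open>f' 0 = 0\<close> by simp
  then have "(t - 0) * f' z > 0" using t by simp
  with z(3) max[of t] t show False by linarith
qed

text \<open>The weak identity is tested with the nonnegative function x |->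
  \<open>moll n (y - x)\<close>. Second derivatives are unaffected by the reflection, so no sign
  appears.\<close>

lemma lap_conv_moll:
  assumes v: "loc_int v"
    and weak: "\<And>\<psi>. test_function \<psi> \<Longrightarrow> (\<And>x. \<psi> x \<ge> 0) \<Longrightarrow>
      (LINT x|lebesgue. v x * lap \<psi> x) = (LINT x|lebesgue. g x * \<psi> x)"
  shows "(\<Sum>b\<in>Basis. conv (pd b (pd b (moll n))) v y) = conv (moll n) g y"
proof -
  let ?\<psi> = "\<lambda>x. moll n (y - x)"
  have k: "cont_cpt (pd b (pd b (moll n)))" if "b \<in> Basis" for b :: 'a
    by (intro test_function_cont_cpt test_function_pd test_function_moll that)
  have "(\<Sum>b\<in>Basis. conv (pd b (pd b (moll n))) v y) = (LINT x|lebesgue. v x * lap ?\<psi> x)"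
    unfolding lap_def conv_def sum_distrib_left
    by (subst Bochner_Integration.integral_sum)
       (auto simp: pd_pd_moll_reflect mult.commute[of "v _"] intro!: integrable_conv v k)
  also have "\<dots> = (LINT x|lebesgue. g x * ?\<psi> x)"
    by (intro weak test_function_moll_reflect moll_nonneg)
  finally show ?thesis by (simp add: conv_def mult.commute)
qed

text \<open>Radial profiles are functions of q = |x|^2 on an interval (-1, T): the origin q = 0 then
  lies in the interior and two-sided derivatives exist there. Powers of 1 + q are smooth on this
  range.\<close>

lemma minus_1_less_norm_power2: "- 1 < (norm x)\<^sup>2"
  by (rule less_le_trans[of _ 0]) simp_all

lemma norm_line_power2:
  "(norm (x + t *\<^sub>R b))\<^sup>2 = (norm x)\<^sup>2 + (2 * (x \<bullet> b)) * t + (norm b)\<^sup>2 * t\<^sup>2"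
  unfolding power2_norm_eq_inner power2_eq_square[of t]
  by (simp add: inner_add_left inner_add_right inner_commute algebra_simps del: dot_square_norm)

lemma radial_has_partial:
  assumes "b \<in> Basis" "(Q has_real_derivative Q') (at ((norm x)\<^sup>2))"
  shows "((\<lambda>t. Q ((norm (x + t *\<^sub>R b))\<^sup>2)) has_real_derivative (2 * (x \<bullet> b)) * Q') (at 0)"
proof -
  have "((\<lambda>t. (norm (x + t *\<^sub>R b))\<^sup>2) has_real_derivative 2 * (x \<bullet> b)) (at 0)"
    unfolding norm_line_power2 by (auto intro!: derivative_eq_intros)
  from DERIV_chain2[of Q Q' "\<lambda>t. (norm (x + t *\<^sub>R b))\<^sup>2" 0 "2 * (x \<bullet> b)" UNIV] assms this
  show ?thesis by (simp add: mult.commute)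
qed

lemma sum_inner_Basis_power2: "(\<Sum>b\<in>Basis. (x \<bullet> b)\<^sup>2) = (norm x)\<^sup>2"
  unfolding power2_norm_eq_inner by (subst (2) euclidean_inner) (simp add: power2_eq_square)

text \<open>The maximum point of \<open>v - Q (\<bar>x\<bar>\<^sup>2)\<close> is compared with maximum points for the mollifications
  of \<open>v\<close>, after a perturbation \<open>\<theta> \<bar>x - x\<^sub>0\<bar>\<^sup>2\<close> that makes the maximum strict.\<close>

lemma laplacian_le_at_max:
  fixes v g :: "'a::euclidean_space \<Rightarrow> real"
  assumes v: "continuous_on UNIV v" and g: "continuous_on UNIV g"
    and weak: "\<And>\<psi>. test_function \<psi> \<Longrightarrow> (\<And>x. \<psi> x \<ge> 0) \<Longrightarrow>
      (LINT x|lebesgue. v x * lap \<psi> x) = (LINT x|lebesgue. g x * \<psi> x)"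
    and Q: "\<And>q. - 1 < q \<Longrightarrow> q < T \<Longrightarrow> (Q has_real_derivative Q1 q) (at q)"
    and Q1: "\<And>q. - 1 < q \<Longrightarrow> q < T \<Longrightarrow> (Q1 has_real_derivative Q2 q) (at q)"
    and Q2: "continuous_on {- 1<..<T} Q2"
    and x0: "(norm x0)\<^sup>2 < T" "v x0 = Q ((norm x0)\<^sup>2)"
    and max: "\<And>x. (norm x)\<^sup>2 < T \<Longrightarrow> v x \<le> Q ((norm x)\<^sup>2)"
  shows "g x0 \<le> 2 * real DIM('a) * Q1 ((norm x0)\<^sup>2) + 4 * (norm x0)\<^sup>2 * Q2 ((norm x0)\<^sup>2)"
proof (rule ccontr)
  \<comment> \<open>The Laplacian of x |-> Q(|x|^2).\<close>
  define S where "S x = 2 * real DIM('a) * Q1 ((norm x)\<^sup>2) + 4 * (norm x)\<^sup>2 * Q2 ((norm x)\<^sup>2)" for x :: 'a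
  define U where "U = {x::'a. (norm x)\<^sup>2 < T}"
  have U: "open U" "x0 \<in> U"
    unfolding U_def using x0 by (auto intro!: open_Collect_less continuous_intros)
  have Qc: "continuous_on {- 1<..<T} Q" and Q1c: "continuous_on {- 1<..<T} Q1"
    using DERIV_isCont[OF Q] DERIV_isCont[OF Q1] by (auto intro!: continuous_at_imp_continuous_on)
  have nc: "continuous_on U (\<lambda>x. (norm x)\<^sup>2)" by (intro continuous_intros)
  have UT: "(\<lambda>x. (norm x)\<^sup>2) ` U \<subseteq> {- 1<..<T}" by (auto simp: U_def minus_1_less_norm_power2)
  have Sc: "continuous_on U S"
    unfolding S_def
    by (intro continuous_intros continuous_on_compose2[OF Q1c nc UT] continuous_on_compose2[OF Q2 nc UT])
  have Pc: "continuous_on U (\<lambda>x. Q ((norm x)\<^sup>2))"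
    by (intro continuous_on_compose2[OF Qc nc UT])
  assume "\<not> ?thesis"
  then have pos: "g x0 - S x0 > 0" by (simp add: S_def)
  define \<kappa> where "\<kappa> = g x0 - S x0"
  have "continuous_on U (\<lambda>x. g x - S x)"
    by (intro continuous_intros Sc continuous_on_subset[OF g]) auto
  then have "isCont (\<lambda>x. g x - S x) x0"
    using U continuous_on_eq_continuous_at by blast
  then have "((\<lambda>x. g x - S x) \<longlongrightarrow> \<kappa>) (nhds x0)"
    using tendsto_at_iff_tendsto_nhds[of "\<lambda>x. g x - S x" x0] by (simp add: isCont_def \<kappa>_def)
  then have "\<forall>\<^sub>F x in nhds x0. g x - S x > \<kappa> / 2"
    by (rule order_tendstoD(1)) (use pos in \<open>simp add: \<kappa>_def\<close>)
  moreover have "\<forall>\<^sub>F x in nhds x0. x \<in> U"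
    using U by (rule eventually_nhds_in_open)
  ultimately have "\<forall>\<^sub>F x in nhds x0. x \<in> U \<and> g x - S x > \<kappa> / 2"
    by eventually_elim simp
  then obtain d where d: "d > 0" "\<And>x. dist x x0 < d \<Longrightarrow> x \<in> U \<and> g x - S x > \<kappa> / 2"
    unfolding eventually_nhds_metric by blast
  define r where "r = d / 2"
  have r: "r > 0" "\<And>x. x \<in> cball x0 r \<Longrightarrow> x \<in> U \<and> g x - S x > \<kappa> / 2"
    using d by (auto simp: r_def dist_commute)
  \<comment> \<open>The perturbation \<theta> |x - x0|^2 has Laplacian 2 \<theta> N = \<kappa> / 4.
    Together with the error \<kappa> / 8 from mollifying g this stays below the gap \<kappa> / 2
    available on the ball.\<close>
  define \<theta> where "\<theta> = \<kappa> / (8 * real DIM('a))"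
  have \<theta>: "\<theta> > 0" using pos by (simp add: \<theta>_def \<kappa>_def)
  have cb: "x \<in> cball 0 (norm x0 + r)" if "x \<in> cball x0 r" for x
    using that norm_triangle_sub[of x x0] by (simp add: dist_norm norm_minus_commute)
  have "\<forall>\<^sub>F n in sequentially. \<forall>y\<in>cball 0 (norm x0 + r). \<bar>conv (moll n) v y - v y\<bar> \<le> \<theta> * r\<^sup>2 / 4"
    using \<theta> r by (intro conv_moll_uniform_limit v) simp
  moreover have "\<forall>\<^sub>F n in sequentially. \<forall>y\<in>cball 0 (norm x0 + r). \<bar>conv (moll n) g y - g y\<bar> \<le> \<kappa> / 8"
    using pos by (intro conv_moll_uniform_limit g) (simp add: \<kappa>_def)
  ultimately have "\<forall>\<^sub>F n in sequentially. \<forall>y\<in>cball 0 (norm x0 + r).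
      \<bar>conv (moll n) v y - v y\<bar> \<le> \<theta> * r\<^sup>2 / 4 \<and> \<bar>conv (moll n) g y - g y\<bar> \<le> \<kappa> / 8"
    by eventually_elim blast
  from eventually_happens'[OF sequentially_bot this]
  obtain n where n0: "\<forall>y\<in>cball 0 (norm x0 + r).
      \<bar>conv (moll n) v y - v y\<bar> \<le> \<theta> * r\<^sup>2 / 4 \<and> \<bar>conv (moll n) g y - g y\<bar> \<le> \<kappa> / 8"
    by blast
  have n: "\<bar>conv (moll n) v y - v y\<bar> \<le> \<theta> * r\<^sup>2 / 4" "\<bar>conv (moll n) g y - g y\<bar> \<le> \<kappa> / 8"
    if "y \<in> cball x0 r" for y
    using n0 cb[OF that] by blast+
  have vl: "loc_int v" by (intro continuous_loc_int v)
  define \<Phi> where "\<Phi> x = conv (moll n) v x - Q ((norm x)\<^sup>2) - \<theta> * (norm (x - x0))\<^sup>2" for x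
  have "continuous_on (cball x0 r) \<Phi>"
    unfolding \<Phi>_def
    by (intro continuous_intros continuous_on_subset[OF Pc] continuous_on_subset[OF conv_continuous[OF vl cont_cpt_moll]])
       (use r in auto)
  then obtain z where z: "z \<in> cball x0 r" "\<And>x. x \<in> cball x0 r \<Longrightarrow> \<Phi> x \<le> \<Phi> z"
    using continuous_attains_sup[of "cball x0 r" \<Phi>] r(1) by fastforce
  have zU: "z \<in> U" using r(2)[OF z(1)] by simp
  \<comment> \<open>With mollification error \<theta> r^2 / 4, the perturbed difference is at least
    - \<theta> r^2 / 4 at the centre and at most - 3 \<theta> r^2 / 4 on the sphere, so the maximum
    is interior.\<close>
  have "norm (z - x0) < r"
  proof (rule ccontr)
    assume "\<not> norm (z - x0) < r"
    then have eq: "norm (z - x0) = r" using z(1) by (simp add: dist_norm norm_minus_commute)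
    have "x0 \<in> cball x0 r" using r(1) by simp
    from n(1)[OF this] have "conv (moll n) v x0 - v x0 \<ge> - (\<theta> * r\<^sup>2 / 4)" by linarith
    then have "\<Phi> x0 \<ge> - (\<theta> * r\<^sup>2 / 4)"
      by (simp add: \<Phi>_def x0(2)[symmetric])
    moreover have "\<Phi> z \<le> \<theta> * r\<^sup>2 / 4 - \<theta> * r\<^sup>2"
    proof -
      have "v z \<le> Q ((norm z)\<^sup>2)" using max[of z] zU by (simp add: U_def)
      with n(1)[OF z(1)] show ?thesis unfolding \<Phi>_def eq by linarith
    qed
    moreover have "\<Phi> x0 \<le> \<Phi> z" using z(2)[of x0] r(1) by simp
    moreover have "\<theta> * r\<^sup>2 > 0" using \<theta> r(1) by simp
    ultimately show False by linarith
  qed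
  define e where "e = r - norm (z - x0)"
  have e: "e > 0" using \<open>norm (z - x0) < r\<close> by (simp add: e_def)
  \<comment> \<open>The second derivative of \<Phi> at z in direction b; summed over the basis it
    gives the Laplacian of \<Phi>.\<close>
  define W where "W b = conv (pd b (pd b (moll n))) v z
      - (2 * Q1 ((norm z)\<^sup>2) + 4 * (z \<bullet> b)\<^sup>2 * Q2 ((norm z)\<^sup>2)) - 2 * \<theta>" for b
  have "W b \<le> 0" if b: "b \<in> Basis" for b
  proof (rule second_derivative_le_0_at_max[OF e])
    have inball: "z + t *\<^sub>R b \<in> cball x0 r" if "\<bar>t\<bar> < e" for t
    proof -
      have "norm (z + t *\<^sub>R b - x0) \<le> norm (z - x0) + norm (t *\<^sub>R b)"
        using norm_triangle_ineq[of "z - x0" "t *\<^sub>R b"] by (simp add: algebra_simps)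
      then show ?thesis using that b by (simp add: e_def dist_norm norm_minus_commute)
    qed
    show "\<Phi> (z + t *\<^sub>R b) \<le> \<Phi> (z + 0 *\<^sub>R b)" if "\<bar>t\<bar> < e" for t
      using z(2)[OF inball[OF that]] by simp
    define f' where "f' t = conv (pd b (moll n)) v (z + t *\<^sub>R b)
        - (2 * ((z + t *\<^sub>R b) \<bullet> b)) * Q1 ((norm (z + t *\<^sub>R b))\<^sup>2) - \<theta> * (2 * ((z - x0 + t *\<^sub>R b) \<bullet> b))" for t
    have line: "((\<lambda>s. Q ((norm (z + s *\<^sub>R b))\<^sup>2)) has_real_derivative
        (2 * ((z + t *\<^sub>R b) \<bullet> b)) * Q1 ((norm (z + t *\<^sub>R b))\<^sup>2)) (at t)" if "\<bar>t\<bar> < e" for t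
    proof -
      have "z + t *\<^sub>R b \<in> U" using r(2)[OF inball[OF that]] by simp
      then have "(norm (z + t *\<^sub>R b))\<^sup>2 < T" by (simp add: U_def)
      from radial_has_partial[OF b Q[OF minus_1_less_norm_power2 this]]
      have "((\<lambda>s. Q ((norm (z + (t + s) *\<^sub>R b))\<^sup>2)) has_real_derivative
        (2 * ((z + t *\<^sub>R b) \<bullet> b)) * Q1 ((norm (z + t *\<^sub>R b))\<^sup>2)) (at 0)"
        by (simp add: scaleR_add_left add.assoc)
      then show ?thesis
        using DERIV_shift[of "\<lambda>s. Q ((norm (z + s *\<^sub>R b))\<^sup>2)" _ 0 t] by (simp add: add.commute)
    qed
    have quad: "((\<lambda>s. (norm (z + s *\<^sub>R b - x0))\<^sup>2) has_real_derivative 2 * ((z - x0 + t *\<^sub>R b) \<bullet> b)) (at t)" for t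
    proof -
      have "(norm (z + s *\<^sub>R b - x0))\<^sup>2 = (norm (z - x0))\<^sup>2 + (2 * ((z - x0) \<bullet> b)) * s + s\<^sup>2" for s
        using norm_line_power2[of "z - x0" s b] b by (simp add: algebra_simps)
      moreover have "((\<lambda>s. (norm (z - x0))\<^sup>2 + (2 * ((z - x0) \<bullet> b)) * s + s\<^sup>2) has_real_derivative
          2 * ((z - x0 + t *\<^sub>R b) \<bullet> b)) (at t)"
        using b by (auto intro!: derivative_eq_intros simp: inner_add_left inner_Basis)
      ultimately show ?thesis by simp
    qed
    show "((\<lambda>t. \<Phi> (z + t *\<^sub>R b)) has_real_derivative f' t) (at t)" if "\<bar>t\<bar> < e" for t
      unfolding \<Phi>_def f'_def
      by (intro DERIV_diff DERIV_cmult line that quad has_partialD conv_moll_has_partial vl b)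
    show "(f' has_real_derivative W b) (at 0)"
    proof -
      have zT: "(norm z)\<^sup>2 < T" using zU by (simp add: U_def)
      have q: "((\<lambda>t. Q1 ((norm (z + t *\<^sub>R b))\<^sup>2)) has_real_derivative 2 * (z \<bullet> b) * Q2 ((norm z)\<^sup>2)) (at 0)"
        by (rule radial_has_partial[OF b Q1[OF minus_1_less_norm_power2 zT]])
      have c2: "((\<lambda>t. conv (pd b (moll n)) v (z + t *\<^sub>R b)) has_real_derivative
          conv (pd b (pd b (moll n))) v z) (at 0)"
        using conv_moll_has_partial(2)[OF vl b, of n] by (simp add: has_partial_def)
      have l: "((\<lambda>t. 2 * ((z + t *\<^sub>R b) \<bullet> b)) has_real_derivative 2) (at 0)"
        "((\<lambda>t. \<theta> * (2 * ((z - x0 + t *\<^sub>R b) \<bullet> b))) has_real_derivative 2 * \<theta>) (at 0)"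
        using b by (auto intro!: derivative_eq_intros simp: inner_add_left inner_Basis)
      have "(f' has_real_derivative conv (pd b (pd b (moll n))) v z
          - (2 * Q1 ((norm (z + 0 *\<^sub>R b))\<^sup>2) + (2 * (z \<bullet> b) * Q2 ((norm z)\<^sup>2)) * (2 * ((z + 0 *\<^sub>R b) \<bullet> b)))
          - 2 * \<theta>) (at 0)"
        unfolding f'_def[abs_def] by (intro DERIV_diff c2 DERIV_mult l q)
      then show ?thesis by (simp add: W_def power2_eq_square algebra_simps)
    qed
  qed
  then have "(\<Sum>b\<in>Basis. W b) \<le> 0" by (rule sum_nonpos)
  moreover have lap_eq: "(\<Sum>b\<in>Basis. conv (pd b (pd b (moll n))) v z) = conv (moll n) g z"
    by (rule lap_conv_moll[OF vl]) (rule weak)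
  moreover have "(\<Sum>b\<in>Basis. W b) = conv (moll n) g z - S z - 2 * \<theta> * real DIM('a)"
    unfolding W_def sum_subtractf sum.distrib sum_distrib_right[symmetric] sum_distrib_left[symmetric]
      sum_inner_Basis_power2 lap_eq
    by (simp add: S_def)
  moreover have "2 * \<theta> * real DIM('a) = \<kappa> / 4" by (simp add: \<theta>_def)
  moreover have "g z - S z > \<kappa> / 2" using r(2)[OF z(1)] by simp
  moreover have "conv (moll n) g z \<ge> g z - \<kappa> / 8" using n(2)[OF z(1)] by linarith
  moreover have "\<kappa> > 0" using pos by (simp add: \<kappa>_def)
  ultimately show False by linarith
qed

lemma exp_radial_derivatives:
  assumes "(F has_real_derivative F1 q) (at q)" "(F1 has_real_derivative F2 q) (at q)"
  shows "((\<lambda>q. exp (- s * (F q + m))) has_real_derivative - s * F1 q * exp (- s * (F q + m))) (at q)"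
    and "((\<lambda>q. - s * F1 q * exp (- s * (F q + m))) has_real_derivative
      (s\<^sup>2 * (F1 q)\<^sup>2 - s * F2 q) * exp (- s * (F q + m))) (at q)"
  using assms by (auto intro!: derivative_eq_intros simp: power2_eq_square algebra_simps)

text \<open>By \<open>weak\<close>, the function \<open>p\<close> solves \<open>\<Delta>p = s \<bar>\<nabla>p\<bar>\<^sup>2 + c\<close> in a generalised sense; the radial
  test function \<open>F (\<bar>x\<bar>\<^sup>2)\<close> has \<open>\<bar>\<nabla>F\<bar>\<^sup>2 = 4 q F1\<^sup>2\<close> and \<open>\<Delta>F = 2 N F1 + 4 q F2\<close> at \<open>q = \<bar>x\<bar>\<^sup>2\<close>.\<close>

lemma viscosity_supersolution:
  fixes p :: "'a::euclidean_space \<Rightarrow> real"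
  assumes p: "continuous_on UNIV p" and c: "continuous_on UNIV c" and s: "s > 0"
    and weak: "\<And>\<psi>. test_function \<psi> \<Longrightarrow> (\<And>x. \<psi> x \<ge> 0) \<Longrightarrow>
      (LINT x|lebesgue. exp (- s * p x) * lap \<psi> x)
      = (LINT x|lebesgue. (- s * c x * exp (- s * p x)) * \<psi> x)"
    and F: "\<And>q. - 1 < q \<Longrightarrow> q < T \<Longrightarrow> (F has_real_derivative F1 q) (at q)"
    and F1: "\<And>q. - 1 < q \<Longrightarrow> q < T \<Longrightarrow> (F1 has_real_derivative F2 q) (at q)"
    and F2: "continuous_on {- 1<..<T} F2"
    and x0: "(norm x0)\<^sup>2 < T" "p x0 = F ((norm x0)\<^sup>2) + m"
    and min: "\<And>x. (norm x)\<^sup>2 < T \<Longrightarrow> F ((norm x)\<^sup>2) + m \<le> p x"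
  shows "2 * real DIM('a) * F1 ((norm x0)\<^sup>2) + 4 * (norm x0)\<^sup>2 * F2 ((norm x0)\<^sup>2)
    \<le> s * (4 * (norm x0)\<^sup>2 * (F1 ((norm x0)\<^sup>2))\<^sup>2) + c x0"
proof -
  have Fc: "continuous_on {- 1<..<T} F" and F1c: "continuous_on {- 1<..<T} F1"
    using DERIV_isCont[OF F] DERIV_isCont[OF F1] by (auto intro!: continuous_at_imp_continuous_on)
  let ?q = "(norm x0)\<^sup>2" and ?E = "exp (- s * p x0)"
  \<comment> \<open>The decreasing map t |-> exp (- s t) turns the contact from below into a contact
    from above. The factor s exp (- s p(x0)) > 0 is cancelled at the end.\<close>
  have "- s * c x0 * exp (- s * p x0)
      \<le> 2 * real DIM('a) * (- s * F1 ?q * exp (- s * (F ?q + m)))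
        + 4 * ?q * ((s\<^sup>2 * (F1 ?q)\<^sup>2 - s * F2 ?q) * exp (- s * (F ?q + m)))"
  proof (rule laplacian_le_at_max[OF _ _ weak])
    show "((\<lambda>q. exp (- s * (F q + m))) has_real_derivative - s * F1 q * exp (- s * (F q + m))) (at q)"
      "((\<lambda>q. - s * F1 q * exp (- s * (F q + m))) has_real_derivative
        (s\<^sup>2 * (F1 q)\<^sup>2 - s * F2 q) * exp (- s * (F q + m))) (at q)" if "- 1 < q" "q < T" for q
      using exp_radial_derivatives[where F = F and ?F1.0 = F1 and ?F2.0 = F2, OF F[OF that] F1[OF that]] by auto
    show "exp (- s * p x) \<le> exp (- s * (F ((norm x)\<^sup>2) + m))" if "(norm x)\<^sup>2 < T" for x
      using min[OF that] s by (simp add: mult_left_mono)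
  qed (use x0 in \<open>auto intro!: continuous_intros p c Fc F1c F2\<close>)
  also have "\<dots> = (s * ?E) * (s * (4 * ?q * (F1 ?q)\<^sup>2)
      - (2 * real DIM('a) * F1 ?q + 4 * ?q * F2 ?q))"
    using x0(2) by (simp add: power2_eq_square algebra_simps)
  also have "- s * c x0 * exp (- s * p x0) = (s * ?E) * (- c x0)" by simp
  finally have "- c x0 \<le> s * (4 * ?q * (F1 ?q)\<^sup>2) - (2 * real DIM('a) * F1 ?q + 4 * ?q * F2 ?q)"
    using s by (subst (asm) mult_le_cancel_left_pos) auto
  then show ?thesis by linarith
qed

text \<open>Contact from above for p is contact from below for exp (- s p), so the maximum point
  lemma is applied to - exp (- s p), whose distributional Laplacian has the opposite sign.\<close>

lemma viscosity_subsolution: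
  fixes p :: "'a::euclidean_space \<Rightarrow> real"
  assumes p: "continuous_on UNIV p" and c: "continuous_on UNIV c" and s: "s > 0"
    and weak: "\<And>\<psi>. test_function \<psi> \<Longrightarrow> (\<And>x. \<psi> x \<ge> 0) \<Longrightarrow>
      (LINT x|lebesgue. exp (- s * p x) * lap \<psi> x)
      = (LINT x|lebesgue. (- s * c x * exp (- s * p x)) * \<psi> x)"
    and F: "\<And>q. - 1 < q \<Longrightarrow> q < T \<Longrightarrow> (F has_real_derivative F1 q) (at q)"
    and F1: "\<And>q. - 1 < q \<Longrightarrow> q < T \<Longrightarrow> (F1 has_real_derivative F2 q) (at q)"
    and F2: "continuous_on {- 1<..<T} F2"
    and x0: "(norm x0)\<^sup>2 < T" "p x0 = F ((norm x0)\<^sup>2) + m"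
    and max: "\<And>x. (norm x)\<^sup>2 < T \<Longrightarrow> p x \<le> F ((norm x)\<^sup>2) + m"
  shows "s * (4 * (norm x0)\<^sup>2 * (F1 ((norm x0)\<^sup>2))\<^sup>2) + c x0
    \<le> 2 * real DIM('a) * F1 ((norm x0)\<^sup>2) + 4 * (norm x0)\<^sup>2 * F2 ((norm x0)\<^sup>2)"
proof -
  have Fc: "continuous_on {- 1<..<T} F" and F1c: "continuous_on {- 1<..<T} F1"
    using DERIV_isCont[OF F] DERIV_isCont[OF F1] by (auto intro!: continuous_at_imp_continuous_on)
  let ?q = "(norm x0)\<^sup>2" and ?E = "exp (- s * p x0)"
  have "s * c x0 * exp (- s * p x0)
      \<le> 2 * real DIM('a) * (s * F1 ?q * exp (- s * (F ?q + m)))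
        + 4 * ?q * (- ((s\<^sup>2 * (F1 ?q)\<^sup>2 - s * F2 ?q) * exp (- s * (F ?q + m))))"
  proof (rule laplacian_le_at_max)
    show "((\<lambda>q. - exp (- s * (F q + m))) has_real_derivative s * F1 q * exp (- s * (F q + m))) (at q)"
      "((\<lambda>q. s * F1 q * exp (- s * (F q + m))) has_real_derivative
        - ((s\<^sup>2 * (F1 q)\<^sup>2 - s * F2 q) * exp (- s * (F q + m)))) (at q)" if "- 1 < q" "q < T" for q
      using exp_radial_derivatives[where F = F and ?F1.0 = F1 and ?F2.0 = F2, OF F[OF that] F1[OF that], THEN DERIV_minus, of s m] by simp_all
    show "- exp (- s * p x) \<le> - exp (- s * (F ((norm x)\<^sup>2) + m))" if "(norm x)\<^sup>2 < T" for x
      using max[OF that] s by (simp add: mult_left_mono)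
    show "(LINT x|lebesgue. - exp (- s * p x) * lap \<psi> x)
        = (LINT x|lebesgue. (s * c x * exp (- s * p x)) * \<psi> x)"
      if "test_function \<psi>" "\<And>x. \<psi> x \<ge> 0" for \<psi>
      using weak[OF that] by simp
  qed (use x0 in \<open>auto intro!: continuous_intros p c Fc F1c F2\<close>)
  also have "\<dots> = (s * ?E) * ((2 * real DIM('a) * F1 ?q + 4 * ?q * F2 ?q)
      - s * (4 * ?q * (F1 ?q)\<^sup>2))"
    using x0(2) by (simp add: power2_eq_square algebra_simps)
  also have "s * c x0 * exp (- s * p x0) = (s * ?E) * c x0" by simp
  finally have "c x0 \<le> (2 * real DIM('a) * F1 ?q + 4 * ?q * F2 ?q) - s * (4 * ?q * (F1 ?q)\<^sup>2)"
    using s by (subst (asm) mult_le_cancel_left_pos) auto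
  then show ?thesis by linarith
qed

section \<open>Comparison with radial barriers\<close>

lemma markov_generator_row_sum:
  assumes "markov_generator \<alpha>"
  shows "(\<Sum>l\<in>UNIV. \<alpha>$j$l) = 0"
proof -
  have "(\<Sum>l\<in>UNIV. \<alpha>$j$l) = \<alpha>$j$j + (\<Sum>l\<in>UNIV - {j}. \<alpha>$j$l)"
    by (rule sum.remove) auto
  then show ?thesis using assms by (simp add: markov_generator_def)
qed

text \<open>The maximum principle for the coupling: zero row sums allow m to be subtracted from
  every w l, which kills the diagonal term at the minimising index j and leaves products of
  nonnegative numbers.\<close>

lemma markov_generator_sum_nonneg:
  assumes "markov_generator \<alpha>" "w j = m" "\<And>l. w l \<ge> m"
  shows "(\<Sum>l\<in>UNIV. \<alpha>$j$l * w l) \<ge> 0"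
proof -
  have "(\<Sum>l\<in>UNIV. \<alpha>$j$l * w l) = (\<Sum>l\<in>UNIV. \<alpha>$j$l * (w l - m))"
    using markov_generator_row_sum[OF assms(1)]
    by (simp add: right_diff_distrib sum_subtractf sum_distrib_right[symmetric])
  also have "\<dots> \<ge> 0"
  proof (rule sum_nonneg)
    fix l
    show "0 \<le> \<alpha>$j$l * (w l - m)"
      using assms by (cases "l = j") (auto simp: markov_generator_def)
  qed
  finally show ?thesis .
qed

lemma finite_pos_lower_bound:
  fixes e :: "'k::finite \<Rightarrow> real"
  assumes "\<And>j. e j > 0"
  obtains m where "m > 0" "m \<le> 1" "\<And>j. m \<le> e j"
proof (rule that)
  let ?m = "Min (insert 1 (range e))"
  show "?m > 0" using assms by (subst Min_gr_iff) auto
  show "?m \<le> 1" "?m \<le> e j" for j by (rule Min_le; simp)+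
qed

lemma finite_upper_bound:
  fixes e :: "'k::finite \<Rightarrow> real"
  shows "\<exists>K\<ge>0. \<forall>j. e j \<le> K"
proof (intro exI conjI allI)
  let ?K = "Max (insert 0 (range e))"
  show "?K \<ge> 0" "e j \<le> ?K" for j by (rule Max_ge; simp)+
qed

lemma half_scale: "S \<noteq> 0 \<Longrightarrow> S / 2 * (1 / S * Y + 2 / S * Z) = Y / 2 + Z" for S :: real
  by (simp add: field_simps)

text \<open>The factor of q in the residual of the lower barrier, with c = \<open>a j\<close> and b
  = \<open>\<beta> j\<close>. For m = 0 and \<kappa> = 1 it is - c. In general the terms in b
  contribute 2 b^2 (1 + m)(m + 3 m^2 + m^3) at most, and m + 3 m^2 + m^3 \<le> 5 m explains the
  constant 20 that leaves half of c.\<close>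

lemma barrier_coefficient:
  fixes m b c \<kappa> :: real
  assumes m: "0 < m" "m \<le> 1" and b: "20 * b\<^sup>2 * m \<le> c" and c: "c > 0" and \<kappa>: "\<kappa> \<le> 1"
  shows "- 4 * b\<^sup>2 * (1 + m)\<^sup>2 + 2 * b\<^sup>2 * (1 + m) ^ 4 * \<kappa> - (1 + m) * (c - 2 * b\<^sup>2) \<le> - c / 2"
proof -
  have "2 * b\<^sup>2 * (1 + m) ^ 4 * \<kappa> \<le> 2 * b\<^sup>2 * (1 + m) ^ 4"
    using m(1) \<kappa> mult_left_mono[of \<kappa> 1 "2 * b\<^sup>2 * (1 + m) ^ 4"] by simp
  moreover have "- 4 * b\<^sup>2 * (1 + m)\<^sup>2 + 2 * b\<^sup>2 * (1 + m) ^ 4 - (1 + m) * (c - 2 * b\<^sup>2)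
      = (1 + m) * (2 * b\<^sup>2 * (m + 3 * m\<^sup>2 + m ^ 3) - c)"
    by (simp add: algebra_simps eval_nat_numeral)
  moreover have "(1 + m) * (2 * b\<^sup>2 * (m + 3 * m\<^sup>2 + m ^ 3) - c) \<le> (1 + m) * (- c / 2)"
  proof (intro mult_left_mono)
    have "m\<^sup>2 \<le> m" "m ^ 3 \<le> m"
      using m power_decreasing[of 1 2 m] power_decreasing[of 1 3 m] by simp_all
    then have "2 * b\<^sup>2 * (m + 3 * m\<^sup>2 + m ^ 3) \<le> 2 * b\<^sup>2 * (5 * m)"
      by (intro mult_left_mono) auto
    also have "2 * b\<^sup>2 * (5 * m) = (20 * b\<^sup>2 * m) / 2" by simp
    also have "\<dots> \<le> c / 2" using b by (rule divide_right_mono) simp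
    finally show "2 * b\<^sup>2 * (m + 3 * m\<^sup>2 + m ^ 3) - c \<le> - c / 2" by simp
  qed (use m in simp)
  moreover have "(1 + m) * (- c / 2) \<le> - c / 2"
    using m c by (simp add: algebra_simps)
  ultimately show ?thesis by linarith
qed

locale hjb_system =
  fixes \<alpha> :: "real^'k^'k" and \<sigma> \<delta> a b :: "'k::finite \<Rightarrow> real"
    and u :: "'k \<Rightarrow> 'a::euclidean_space \<Rightarrow> real"
  assumes gen: "markov_generator \<alpha>"
    and \<sigma>: "\<And>j. \<sigma> j > 0" and \<delta>: "\<And>j. \<delta> j > 0" and a: "\<And>j. a j > 0"
    and cont: "\<And>j. continuous_on UNIV (u j)"
    and sol: "solves_HJB_system \<sigma> \<delta> \<alpha> (\<lambda>j x. a j * (norm x)\<^sup>2 + b j) u"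
begin

text \<open>Left side minus right side of the j-th equation for the radial family x |-> F l (|x|^2),
  as a function of q = |x|^2; sign \<le> 0 means subsolution, \<ge> 0 supersolution.\<close>

definition residual ::
    "('k \<Rightarrow> real \<Rightarrow> real) \<Rightarrow> ('k \<Rightarrow> real \<Rightarrow> real) \<Rightarrow> ('k \<Rightarrow> real \<Rightarrow> real) \<Rightarrow> 'k \<Rightarrow> real \<Rightarrow> real" where
  "residual F F1 F2 j q = - ((\<sigma> j)\<^sup>2 / 2) * (2 * real DIM('a) * F1 j q + 4 * q * F2 j q)
     + 2 * q * (F1 j q)\<^sup>2 + \<delta> j * F j q - (\<Sum>l\<in>UNIV. \<alpha>$j$l * F l q) - (a j * q + b j)"

text \<open>All terms without derivatives, normalised so that the equation reads \<Delta>u =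
  |\<nabla>u|^2 / \<sigma>^2 + source. The coupling is included, and continuity of u makes it
  continuous.\<close>

definition source :: "'k \<Rightarrow> 'a \<Rightarrow> real" where
  "source j x = 2 / (\<sigma> j)\<^sup>2 * (\<delta> j * u j x - (\<Sum>l\<in>UNIV. \<alpha>$j$l * u l x) - (a j * (norm x)\<^sup>2 + b j))"

lemma source_continuous: "continuous_on UNIV (source j)"
  unfolding source_def using cont \<sigma>[of j] by (auto intro!: continuous_intros)

lemma weak_exp:
  assumes "test_function \<psi>" "\<And>x. \<psi> x \<ge> 0"
  shows "(LINT x|lebesgue. exp (- (1 / (\<sigma> j)\<^sup>2) * u j x) * lap \<psi> x)
    = (LINT x|lebesgue. (- (1 / (\<sigma> j)\<^sup>2) * source j x * exp (- (1 / (\<sigma> j)\<^sup>2) * u j x)) * \<psi> x)"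
proof -
  obtain G H where wd: "\<And>j. weak_derivatives2 (u j) (G j) (H j)"
    and eq: "\<And>j. AE x in lebesgue. - ((\<sigma> j)\<^sup>2 / 2) * laplacian_of (H j) x + 1/2 * (norm (G j x))\<^sup>2
            + \<delta> j * u j x - (\<Sum>l\<in>UNIV. \<alpha>$j$l * u l x) = a j * (norm x)\<^sup>2 + b j"
    using sol unfolding solves_HJB_system_def by blast
  show ?thesis
  proof (rule hopf_cole[OF cont wd source_continuous _ _ assms])
    show "1 / (\<sigma> j)\<^sup>2 > 0" using \<sigma>[of j] by simp
    show "AE x in lebesgue. laplacian_of (H j) x = 1 / (\<sigma> j)\<^sup>2 * (norm (G j x))\<^sup>2 + source j x"
      using eq[of j]
    proof eventually_elim
      case (elim x)
      have "(\<sigma> j)\<^sup>2 > 0" using \<sigma>[of j] by simp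
      then show ?case
        unfolding source_def elim[symmetric] by (simp add: field_simps)
    qed
  qed
qed

text \<open>The family F + m lies below u for all indices with the same m, so j minimises u l - F l
  at x and the coupling sum of these differences is nonnegative. The common shift cancels in the
  coupling and survives only as \<delta> m.\<close>

lemma residual_nonneg_at_min:
  assumes F: "\<And>q. - 1 < q \<Longrightarrow> q < T \<Longrightarrow> (F j has_real_derivative F1 j q) (at q)"
    and F1: "\<And>q. - 1 < q \<Longrightarrow> q < T \<Longrightarrow> (F1 j has_real_derivative F2 j q) (at q)"
    and F2: "continuous_on {- 1<..<T} (F2 j)"
    and x: "(norm x)\<^sup>2 < T" "u j x = F j ((norm x)\<^sup>2) + m"
    and min: "\<And>y l. (norm y)\<^sup>2 < T \<Longrightarrow> F l ((norm y)\<^sup>2) + m \<le> u l y"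
  shows "residual F F1 F2 j ((norm x)\<^sup>2) + \<delta> j * m \<ge> 0"
proof -
  let ?q = "(norm x)\<^sup>2"
  have s: "(\<sigma> j)\<^sup>2 > 0" "(\<sigma> j)\<^sup>2 \<noteq> 0" using \<sigma>[of j] by simp_all
  have "2 * real DIM('a) * F1 j ?q + 4 * ?q * F2 j ?q
      \<le> 1 / (\<sigma> j)\<^sup>2 * (4 * ?q * (F1 j ?q)\<^sup>2) + source j x"
    by (rule viscosity_supersolution[where p = "u j" and F = "F j" and T = T and m = m])
       (use F F1 F2 x min s cont source_continuous weak_exp in auto)
  from mult_left_mono[OF this, of "(\<sigma> j)\<^sup>2 / 2"]
  have "(\<sigma> j)\<^sup>2 / 2 * (2 * real DIM('a) * F1 j ?q + 4 * ?q * F2 j ?q)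
      \<le> 2 * ?q * (F1 j ?q)\<^sup>2 + (\<delta> j * u j x - (\<Sum>l\<in>UNIV. \<alpha>$j$l * u l x) - (a j * ?q + b j))"
    unfolding source_def half_scale[OF s(2)] by simp
  moreover have "(\<Sum>l\<in>UNIV. \<alpha>$j$l * (u l x - F l ?q)) \<ge> 0"
    by (rule markov_generator_sum_nonneg[OF gen, of "\<lambda>l. u l x - F l ?q" j m])
       (use x min[OF x(1)] in \<open>auto simp: algebra_simps\<close>)
  then have "(\<Sum>l\<in>UNIV. \<alpha>$j$l * u l x) \<ge> (\<Sum>l\<in>UNIV. \<alpha>$j$l * F l ?q)"
    by (simp add: right_diff_distrib sum_subtractf)
  moreover have "\<delta> j * u j x = \<delta> j * F j ?q + \<delta> j * m"
    unfolding x(2) by (simp add: distrib_left)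
  ultimately show ?thesis unfolding residual_def by linarith
qed

lemma residual_nonpos_at_max:
  assumes F: "\<And>q. - 1 < q \<Longrightarrow> q < T \<Longrightarrow> (F j has_real_derivative F1 j q) (at q)"
    and F1: "\<And>q. - 1 < q \<Longrightarrow> q < T \<Longrightarrow> (F1 j has_real_derivative F2 j q) (at q)"
    and F2: "continuous_on {- 1<..<T} (F2 j)"
    and x: "(norm x)\<^sup>2 < T" "u j x = F j ((norm x)\<^sup>2) + m"
    and max: "\<And>y l. (norm y)\<^sup>2 < T \<Longrightarrow> u l y \<le> F l ((norm y)\<^sup>2) + m"
  shows "residual F F1 F2 j ((norm x)\<^sup>2) + \<delta> j * m \<le> 0"
proof -
  let ?q = "(norm x)\<^sup>2"
  have s: "(\<sigma> j)\<^sup>2 > 0" "(\<sigma> j)\<^sup>2 \<noteq> 0" using \<sigma>[of j] by simp_all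
  have "1 / (\<sigma> j)\<^sup>2 * (4 * ?q * (F1 j ?q)\<^sup>2) + source j x
      \<le> 2 * real DIM('a) * F1 j ?q + 4 * ?q * F2 j ?q"
    by (rule viscosity_subsolution[where p = "u j" and F = "F j" and T = T and m = m])
       (use F F1 F2 x max s cont source_continuous weak_exp in auto)
  from mult_left_mono[OF this, of "(\<sigma> j)\<^sup>2 / 2"]
  have "2 * ?q * (F1 j ?q)\<^sup>2 + (\<delta> j * u j x - (\<Sum>l\<in>UNIV. \<alpha>$j$l * u l x) - (a j * ?q + b j))
      \<le> (\<sigma> j)\<^sup>2 / 2 * (2 * real DIM('a) * F1 j ?q + 4 * ?q * F2 j ?q)"
    unfolding source_def half_scale[OF s(2)] by simp
  moreover have "(\<Sum>l\<in>UNIV. \<alpha>$j$l * (F l ?q - u l x)) \<ge> 0"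
    by (rule markov_generator_sum_nonneg[OF gen, of "\<lambda>l. F l ?q - u l x" j "- m"])
       (use x max[OF x(1)] in \<open>auto simp: algebra_simps\<close>)
  then have "(\<Sum>l\<in>UNIV. \<alpha>$j$l * F l ?q) \<ge> (\<Sum>l\<in>UNIV. \<alpha>$j$l * u l x)"
    by (simp add: right_diff_distrib sum_subtractf)
  moreover have "\<delta> j * u j x = \<delta> j * F j ?q + \<delta> j * m"
    unfolding x(2) by (simp add: distrib_left)
  ultimately show ?thesis unfolding residual_def by linarith
qed

section \<open>Comparison on a ball, for all indices at once\<close>

lemma family_attains_sup:
  fixes D :: "'k \<Rightarrow> 'a \<Rightarrow> real"
  assumes "\<And>j. continuous_on (cball 0 \<rho>) (D j)" "\<rho> \<ge> 0"
  shows "\<exists>j z. norm z \<le> \<rho> \<and> (\<forall>l y. norm y \<le> \<rho> \<longrightarrow> D l y \<le> D j z)"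
proof -
  have "\<exists>z\<in>cball 0 \<rho>. \<forall>y\<in>cball 0 \<rho>. D j y \<le> D j z" for j
    by (rule continuous_attains_sup) (use assms in auto)
  then obtain z where z: "\<And>j. z j \<in> cball 0 \<rho>" "\<And>j y. y \<in> cball 0 \<rho> \<Longrightarrow> D j y \<le> D j (z j)"
    by metis
  have "Max (range (\<lambda>j. D j (z j))) \<in> range (\<lambda>j. D j (z j))"
    by (rule Max_in) auto
  then obtain j where j: "D j (z j) = Max (range (\<lambda>j. D j (z j)))"
    unfolding image_iff by metis
  have jl: "D l (z l) \<le> D j (z j)" for l
    unfolding j by (intro Max_ge) auto
  show ?thesis
  proof (intro exI conjI allI impI)
    show "norm (z j) \<le> \<rho>" using z(1)[of j] by simp
    show "D l y \<le> D j (z j)" if "norm y \<le> \<rho>" for l y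
      using z(2)[of y l] jl[of l] that by simp
  qed
qed

lemma norm_power2_less_iff: "\<rho> \<ge> 0 \<Longrightarrow> (norm x)\<^sup>2 < \<rho>\<^sup>2 \<longleftrightarrow> norm x < \<rho>"
  using abs_le_square_iff[of \<rho> "norm x"] by (simp add: not_le[symmetric])

lemma radial_continuous_on:
  assumes "\<And>q. - 1 < q \<Longrightarrow> q < T \<Longrightarrow> (F has_real_derivative F1 q) (at q)" "\<rho>\<^sup>2 < T"
  shows "continuous_on (cball 0 \<rho>) (\<lambda>x::'a. F ((norm x)\<^sup>2))"
proof -
  have c: "continuous_on {- 1<..<T} F"
    using DERIV_isCont[OF assms(1)] by (auto intro!: continuous_at_imp_continuous_on)
  have "(norm x)\<^sup>2 < T" if "x \<in> cball 0 \<rho>" for x :: 'a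
    using that assms(2) power_mono[of "norm x" \<rho> 2] by simp
  then show ?thesis
    by (intro continuous_on_compose2[OF c]) (auto intro!: continuous_intros simp: minus_1_less_norm_power2)
qed

text \<open>A violation gives a negative minimum m of u - F over all indices and points. The
  boundary values place it inside the ball, where residual + \<delta> m \<ge> 0 contradicts residual
  \<le> 0 and \<delta> > 0.\<close>

lemma comparison_below:
  assumes F: "\<And>j q. - 1 < q \<Longrightarrow> q < T \<Longrightarrow> (F j has_real_derivative F1 j q) (at q)"
    and F1: "\<And>j q. - 1 < q \<Longrightarrow> q < T \<Longrightarrow> (F1 j has_real_derivative F2 j q) (at q)"
    and F2: "\<And>j. continuous_on {- 1<..<T} (F2 j)"
    and \<rho>: "\<rho> \<ge> 0" "\<rho>\<^sup>2 < T"
    and res: "\<And>j q. 0 \<le> q \<Longrightarrow> q < \<rho>\<^sup>2 \<Longrightarrow> residual F F1 F2 j q \<le> 0"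
    and bdry: "\<And>j x. norm x = \<rho> \<Longrightarrow> F j (\<rho>\<^sup>2) \<le> u j x"
    and x: "norm x \<le> \<rho>"
  shows "F j ((norm x)\<^sup>2) \<le> u j x"
proof (rule ccontr)
  assume neg: "\<not> F j ((norm x)\<^sup>2) \<le> u j x"
  have c: "continuous_on (cball 0 \<rho>) (\<lambda>x. F l ((norm x)\<^sup>2) - u l x)" for l
    by (intro continuous_intros radial_continuous_on[OF F \<rho>(2)] continuous_on_subset[OF cont]) auto
  obtain i z where z: "norm z \<le> \<rho>"
    "\<And>l y. norm y \<le> \<rho> \<Longrightarrow> F l ((norm y)\<^sup>2) - u l y \<le> F i ((norm z)\<^sup>2) - u i z"
    using family_attains_sup[of \<rho> "\<lambda>l x. F l ((norm x)\<^sup>2) - u l x", OF c \<rho>(1)] by blast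
  define m where "m = u i z - F i ((norm z)\<^sup>2)"
  have m: "m < 0" using z(2)[OF x, of j] neg by (simp add: m_def)
  have "norm z \<noteq> \<rho>"
    using bdry[of z i] m by (auto simp: m_def)
  then have zs: "(norm z)\<^sup>2 < \<rho>\<^sup>2" using z(1) \<rho>(1) by (simp add: norm_power2_less_iff)
  have "residual F F1 F2 i ((norm z)\<^sup>2) + \<delta> i * m \<ge> 0"
  \<comment> \<open>The profiles live beyond the ball, but contact from below is known only inside
    it, hence the smaller bound \<rho>^2 on q.\<close>
  proof (rule residual_nonneg_at_min[where T = "\<rho>\<^sup>2"])
    show "continuous_on {- 1<..<\<rho>\<^sup>2} (F2 i)"
      by (rule continuous_on_subset[OF F2]) (use \<rho> in auto)
    show "F l ((norm y)\<^sup>2) + m \<le> u l y" if "(norm y)\<^sup>2 < \<rho>\<^sup>2" for y l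
      using z(2)[of y l] that \<rho>(1) by (simp add: m_def norm_power2_less_iff)
  qed (use F F1 \<rho> zs in \<open>auto simp: m_def\<close>)
  moreover have "\<delta> i * m < 0" using m \<delta>[of i] by (simp add: mult_pos_neg)
  ultimately show False using res[of "(norm z)\<^sup>2" i] zs by simp
qed

lemma comparison_above:
  assumes F: "\<And>j q. - 1 < q \<Longrightarrow> q < T \<Longrightarrow> (F j has_real_derivative F1 j q) (at q)"
    and F1: "\<And>j q. - 1 < q \<Longrightarrow> q < T \<Longrightarrow> (F1 j has_real_derivative F2 j q) (at q)"
    and F2: "\<And>j. continuous_on {- 1<..<T} (F2 j)"
    and \<rho>: "\<rho> \<ge> 0" "\<rho>\<^sup>2 < T"
    and res: "\<And>j q. 0 \<le> q \<Longrightarrow> q < \<rho>\<^sup>2 \<Longrightarrow> residual F F1 F2 j q \<ge> 0"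
    and bdry: "\<And>j x. norm x = \<rho> \<Longrightarrow> u j x \<le> F j (\<rho>\<^sup>2)"
    and x: "norm x \<le> \<rho>"
  shows "u j x \<le> F j ((norm x)\<^sup>2)"
proof (rule ccontr)
  assume neg: "\<not> u j x \<le> F j ((norm x)\<^sup>2)"
  have c: "continuous_on (cball 0 \<rho>) (\<lambda>x. u l x - F l ((norm x)\<^sup>2))" for l
    by (intro continuous_intros radial_continuous_on[OF F \<rho>(2)] continuous_on_subset[OF cont]) auto
  obtain i z where z: "norm z \<le> \<rho>"
    "\<And>l y. norm y \<le> \<rho> \<Longrightarrow> u l y - F l ((norm y)\<^sup>2) \<le> u i z - F i ((norm z)\<^sup>2)"
    using family_attains_sup[of \<rho> "\<lambda>l x. u l x - F l ((norm x)\<^sup>2)", OF c \<rho>(1)] by blast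
  define m where "m = u i z - F i ((norm z)\<^sup>2)"
  have m: "m > 0" using z(2)[OF x, of j] neg by (simp add: m_def)
  have "norm z \<noteq> \<rho>"
    using bdry[of z i] m by (auto simp: m_def)
  then have zs: "(norm z)\<^sup>2 < \<rho>\<^sup>2" using z(1) \<rho>(1) by (simp add: norm_power2_less_iff)
  have "residual F F1 F2 i ((norm z)\<^sup>2) + \<delta> i * m \<le> 0"
  proof (rule residual_nonpos_at_max[where T = "\<rho>\<^sup>2"])
    show "continuous_on {- 1<..<\<rho>\<^sup>2} (F2 i)"
      by (rule continuous_on_subset[OF F2]) (use \<rho> in auto)
    show "u l y \<le> F l ((norm y)\<^sup>2) + m" if "(norm y)\<^sup>2 < \<rho>\<^sup>2" for y l
      using z(2)[of y l] that \<rho>(1) by (simp add: m_def norm_power2_less_iff)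
  qed (use F F1 \<rho> zs in \<open>auto simp: m_def\<close>)
  moreover have "\<delta> i * m > 0" using m \<delta>[of i] by simp
  ultimately show False using res[of "(norm z)\<^sup>2" i] zs by simp
qed

section \<open>Barriers around the quadratic solution\<close>

lemma sum_alpha_const: "(\<Sum>l\<in>UNIV. \<alpha>$j$l * c) = 0"
  using markov_generator_row_sum[OF gen, of j] by (simp add: sum_distrib_right[symmetric])

text \<open>Apart from the square of the gradient, which yields the cross term, the operator is
  affine; the constant c contributes only \<delta> c, since the rows of \<alpha> sum to 0.\<close>

lemma residual_add:
  "residual (\<lambda>j q. F j q + G j q + c) (\<lambda>j q. F1 j q + G1 j q) (\<lambda>j q. F2 j q + G2 j q) j q
   = residual F F1 F2 j q - ((\<sigma> j)\<^sup>2 / 2) * (2 * real DIM('a) * G1 j q + 4 * q * G2 j q)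
     + 2 * q * (2 * F1 j q * G1 j q + (G1 j q)\<^sup>2) + \<delta> j * (G j q + c) - (\<Sum>l\<in>UNIV. \<alpha>$j$l * G l q)"
  unfolding residual_def distrib_left sum.distrib sum_alpha_const
  by (simp add: power2_eq_square algebra_simps)

context
  fixes \<beta> \<eta> :: "'k \<Rightarrow> real"
  assumes \<beta>: "\<And>j. \<beta> j > 0" and beta_eq: "beta_system \<delta> \<alpha> a \<beta>"
    and eta_eq: "eta_system DIM('a) \<sigma> \<delta> \<alpha> b \<beta> \<eta>"
begin

text \<open>The residual is affine in q: its slope vanishes by the system for \<beta>, its constant
  term by the system for \<eta>.\<close>

lemma residual_quadratic:
  "residual (\<lambda>j q. \<beta> j * q + \<eta> j) (\<lambda>j q. \<beta> j) (\<lambda>j q. 0) j q = 0"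
proof -
  have B: "2 * (\<beta> j)\<^sup>2 + \<delta> j * \<beta> j - (\<Sum>l\<in>UNIV. \<alpha>$j$l * \<beta> l) = a j"
    using beta_eq by (simp add: beta_system_def)
  have E: "\<delta> j * \<eta> j - (\<Sum>l\<in>UNIV. \<alpha>$j$l * \<eta> l) = b j + real DIM('a) * (\<sigma> j)\<^sup>2 * \<beta> j"
    using eta_eq by (simp add: eta_system_def)
  have "(\<Sum>l\<in>UNIV. \<alpha>$j$l * (\<beta> l * q + \<eta> l)) = (\<Sum>l\<in>UNIV. \<alpha>$j$l * \<beta> l) * q + (\<Sum>l\<in>UNIV. \<alpha>$j$l * \<eta> l)"
    by (simp add: distrib_left sum.distrib sum_distrib_right mult.assoc)
  then show ?thesis
    unfolding residual_def B[symmetric] using E by (simp add: algebra_simps)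
qed

text \<open>The barrier \<open>- C ln (1 - \<bar>x\<bar>\<^sup>2 / R\<^sup>2) + L / R\<^sup>2\<close> blows up on the sphere of radius \<open>R\<close>, so no
  growth bound on \<open>u\<close> is needed. It is a supersolution because \<open>C \<ge> (\<sigma> j)\<^sup>2\<close> lets the quadratic
  gradient term absorb the second derivative, and it tends to \<open>0\<close> as \<open>R \<rightarrow> \<infinity>\<close>.\<close>

lemma solution_le:
  "u j x \<le> \<beta> j * (norm x)\<^sup>2 + \<eta> j"
proof -
  obtain C where C: "C \<ge> 0" "\<And>j. (\<sigma> j)\<^sup>2 \<le> C"
    using finite_upper_bound[where e = "\<lambda>j. (\<sigma> j)\<^sup>2"] by blast
  have C0: "C > 0" using C(2)[of j] \<sigma>[of j] by (auto intro: less_le_trans[of 0 "(\<sigma> j)\<^sup>2"])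
  \<comment> \<open>For q \<le> R^2 / 2 the first-order error is at most 2 C \<sigma>^2 N / R^2, and
    L is chosen so that \<delta> L / R^2 covers it.\<close>
  obtain L where L: "L \<ge> 0" "\<And>j. 2 * C * (\<sigma> j)\<^sup>2 * real DIM('a) / \<delta> j \<le> L"
    using finite_upper_bound[where e = "\<lambda>j. 2 * C * (\<sigma> j)\<^sup>2 * real DIM('a) / \<delta> j"] by blast
  \<comment> \<open>Beyond q0 the cross term 4 q \<beta> G1 dominates the Laplacian term \<sigma>^2
    N G1. The condition 2 q0 \<le> R^2 puts all remaining q into the range that L handles.\<close>
  obtain q0 where q0: "q0 \<ge> 0" "\<And>j. (\<sigma> j)\<^sup>2 * real DIM('a) / (4 * \<beta> j) \<le> q0"
    using finite_upper_bound[where e = "\<lambda>j. (\<sigma> j)\<^sup>2 * real DIM('a) / (4 * \<beta> j)"] by blast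
  have bound: "u j x \<le> \<beta> j * (norm x)\<^sup>2 + \<eta> j + (- C * ln (1 - (norm x)\<^sup>2 / R\<^sup>2)) + L / R\<^sup>2"
    if R: "R > 0" "norm x < R" "2 * q0 \<le> R\<^sup>2" for R
  proof -
    define G where "G q = - C * ln (1 - q / R\<^sup>2)" for q
    define G1 where "G1 q = C / (R\<^sup>2 * (1 - q / R\<^sup>2))" for q
    define G2 where "G2 q = C / (R\<^sup>2 * (1 - q / R\<^sup>2))\<^sup>2" for q
    have R2: "R\<^sup>2 > 0" using R(1) by simp
    have y: "1 - q / R\<^sup>2 > 0" if "q < R\<^sup>2" for q using that R2 by simp
    have dG: "(G has_real_derivative G1 q) (at q)" if "q < R\<^sup>2" for q
    proof -
      have "(G has_real_derivative - C * (1 / (1 - q / R\<^sup>2) * (0 - 1 / R\<^sup>2))) (at q)"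
        unfolding G_def[abs_def]
        by (intro DERIV_cmult DERIV_chain2[where f = ln and g = "\<lambda>q. 1 - q / R\<^sup>2"]
            DERIV_ln_divide y that DERIV_diff
            DERIV_const DERIV_cdivide DERIV_ident)
      then show ?thesis by (simp add: G1_def mult.commute)
    qed
    have dG1: "(G1 has_real_derivative G2 q) (at q)" if "q < R\<^sup>2" for q
      unfolding G1_def[abs_def] G2_def using y[OF that] R2
      by (auto intro!: derivative_eq_intros simp: power2_eq_square)
    have G2c: "continuous_on {- 1<..<R\<^sup>2} G2"
      unfolding G2_def[abs_def] using y R2 by (intro continuous_intros) force+
    obtain M where M: "M \<ge> 0" "\<And>l y. norm y \<le> R \<Longrightarrow> u l y \<le> M + \<eta> l"
    proof -
      have c: "continuous_on (cball 0 R) (\<lambda>x. u l x - \<eta> l)" for l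
        by (intro continuous_intros continuous_on_subset[OF cont]) auto
      have "R \<ge> 0" using R(1) by simp
      from family_attains_sup[of R "\<lambda>l x. u l x - \<eta> l", OF c this]
      obtain i z where z: "\<And>l y. norm y \<le> R \<Longrightarrow> u l y - \<eta> l \<le> u i z - \<eta> i" by blast
      show ?thesis
      proof (rule that[of "\<bar>u i z - \<eta> i\<bar>"])
        show "u l y \<le> \<bar>u i z - \<eta> i\<bar> + \<eta> l" if "norm y \<le> R" for l y
          using z[OF that, of l] by linarith
      qed simp
    qed
    \<comment> \<open>The comparison radius \<rho> < R is given by 1 - \<rho>^2 / R^2 = y0. The
      first bound raises the barrier to at least M on that sphere, the second keeps x inside the
      ball.\<close>
    define y0 where "y0 = min (exp (- M / C)) (1 - (norm x)\<^sup>2 / R\<^sup>2)"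
    have nx: "(norm x)\<^sup>2 < R\<^sup>2" using R by (simp add: norm_power2_less_iff)
    have y0: "0 < y0" "y0 \<le> 1 - (norm x)\<^sup>2 / R\<^sup>2" "y0 \<le> exp (- M / C)"
      using y[OF nx] by (auto simp: y0_def)
    define \<rho> where "\<rho> = sqrt (R\<^sup>2 * (1 - y0))"
    have "(norm x)\<^sup>2 / R\<^sup>2 \<ge> 0" by simp
    with y0(2) have y01: "y0 \<le> 1" by linarith
    have \<rho>2: "\<rho>\<^sup>2 = R\<^sup>2 * (1 - y0)" unfolding \<rho>_def using y01 by simp
    have \<rho>: "\<rho> \<ge> 0" "\<rho>\<^sup>2 < R\<^sup>2" using y0(1) y01 R2 by (simp_all add: \<rho>_def \<rho>2)
    have x\<rho>: "norm x \<le> \<rho>"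
    proof -
      have "(norm x)\<^sup>2 / R\<^sup>2 \<le> 1 - y0" using y0(2) by linarith
      then have "(norm x)\<^sup>2 \<le> \<rho>\<^sup>2" unfolding \<rho>2 using R2 by (simp add: field_simps)
      then show ?thesis using \<rho>(1) by (rule power2_le_imp_le)
    qed
    have "u j x \<le> (\<lambda>j q. (\<beta> j * q + \<eta> j) + G q + L / R\<^sup>2) j ((norm x)\<^sup>2)"
    proof (rule comparison_above[where ?F1.0 = "\<lambda>j q. \<beta> j + G1 q" and ?F2.0 = "\<lambda>j q. 0 + G2 q"
          and T = "R\<^sup>2" and \<rho> = \<rho>])
      show "((\<lambda>q. \<beta> j * q + \<eta> j + G q + L / R\<^sup>2) has_real_derivative \<beta> j + G1 q) (at q)"
        if "- 1 < q" "q < R\<^sup>2" for j q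
        using dG[OF that(2)] by (auto intro!: derivative_eq_intros)
      show "((\<lambda>q. \<beta> j + G1 q) has_real_derivative 0 + G2 q) (at q)" if "- 1 < q" "q < R\<^sup>2" for j q
        using dG1[OF that(2)] by (auto intro!: derivative_eq_intros)
      show "continuous_on {- 1<..<R\<^sup>2} (\<lambda>q. 0 + G2 q)" using G2c by simp
      show "u j y \<le> \<beta> j * \<rho>\<^sup>2 + \<eta> j + G (\<rho>\<^sup>2) + L / R\<^sup>2" if "norm y = \<rho>" for j y
      proof -
        have "ln y0 \<le> ln (exp (- M / C))" using y0 by (subst ln_le_cancel_iff) auto
        then have "ln y0 \<le> - M / C" by simp
        then have "G (\<rho>\<^sup>2) \<ge> M" unfolding G_def \<rho>2 using R2 C0 by (simp add: field_simps)
        moreover have "norm y \<le> R"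
          unfolding that by (rule power2_le_imp_le[OF less_imp_le[OF \<rho>(2)]]) (use R(1) in simp)
        then have "u j y \<le> M + \<eta> j" by (rule M(2))
        moreover have "\<beta> j * \<rho>\<^sup>2 \<ge> 0" "L / R\<^sup>2 \<ge> 0" using \<beta>[of j] L(1) by simp_all
        ultimately show ?thesis by linarith
      qed
      show "0 \<le> residual (\<lambda>j q. (\<beta> j * q + \<eta> j) + G q + L / R\<^sup>2) (\<lambda>j q. \<beta> j + G1 q) (\<lambda>j q. 0 + G2 q) j q"
        if "0 \<le> q" "q < \<rho>\<^sup>2" for j q
      proof -
        define n where "n = real DIM('a)"
        have q: "q < R\<^sup>2" using that \<rho> by linarith
        have G10: "G1 q \<ge> 0" and G2e: "C * G2 q = (G1 q)\<^sup>2"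
          using y[OF q] C0 R2 by (simp_all add: G1_def G2_def power_divide power2_eq_square)
        have G20: "G2 q \<ge> 0" using C0 by (simp add: G2_def)
        have G0: "G q \<ge> 0"
        proof -
          have "ln (1 - q / R\<^sup>2) \<le> 0" using y[OF q] that(1) R2 by simp
          then show ?thesis unfolding G_def using C0 by (simp add: mult_nonneg_nonpos)
        qed
        \<comment> \<open>The logarithm satisfies C G2 = G1^2, so C \<ge> \<sigma>^2 is exactly what
          the gradient term must provide.\<close>
        have "(\<sigma> j)\<^sup>2 * G2 q \<le> (G1 q)\<^sup>2"
          unfolding G2e[symmetric] by (intro mult_right_mono C G20)
        then have 1: "2 * q * ((\<sigma> j)\<^sup>2 * G2 q) \<le> 2 * q * (G1 q)\<^sup>2"
          using that(1) by (intro mult_left_mono) auto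
        have 2: "G1 q * ((\<sigma> j)\<^sup>2 * n - 4 * q * \<beta> j) \<le> \<delta> j * (L / R\<^sup>2)"
        proof (cases "(\<sigma> j)\<^sup>2 * n \<le> 4 * q * \<beta> j")
          case True
          then have "G1 q * ((\<sigma> j)\<^sup>2 * n - 4 * q * \<beta> j) \<le> 0"
            using G10 by (intro mult_nonneg_nonpos) auto
          also have "0 \<le> \<delta> j * (L / R\<^sup>2)" using \<delta>[of j] L(1) by simp
          finally show ?thesis .
        next
          case False
          then have "q \<le> (\<sigma> j)\<^sup>2 * n / (4 * \<beta> j)" using \<beta>[of j] by (simp add: field_simps)
          then have "2 * q \<le> R\<^sup>2" using q0(2)[of j] R(3) by (simp add: n_def)
          then have "1 / 2 \<le> 1 - q / R\<^sup>2" using R2 by (simp add: field_simps)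
          then have "R\<^sup>2 * (1 / 2) \<le> R\<^sup>2 * (1 - q / R\<^sup>2)" by (intro mult_left_mono) auto
          then have "G1 q \<le> C / (R\<^sup>2 * (1 / 2))"
            unfolding G1_def using C0 R2 y[OF q] by (intro divide_left_mono mult_pos_pos) auto
          then have g: "G1 q \<le> 2 * C / R\<^sup>2" by (simp add: mult.commute)
          have "G1 q * ((\<sigma> j)\<^sup>2 * n - 4 * q * \<beta> j) \<le> G1 q * ((\<sigma> j)\<^sup>2 * n)"
            using G10 that(1) \<beta>[of j] by (intro mult_left_mono) auto
          also have "\<dots> \<le> 2 * C / R\<^sup>2 * ((\<sigma> j)\<^sup>2 * n)"
            using g by (intro mult_right_mono) (auto simp: n_def)
          also have "\<dots> = (2 * C * (\<sigma> j)\<^sup>2 * n) / R\<^sup>2" by simp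
          also have "\<dots> \<le> (L * \<delta> j) / R\<^sup>2"
            using L(2)[of j] \<delta>[of j] by (intro divide_right_mono) (auto simp: field_simps n_def)
          finally show ?thesis by (simp add: mult.commute)
        qed
        have 3: "\<delta> j * G q \<ge> 0" using \<delta>[of j] G0 by simp
        show ?thesis
          unfolding residual_add[where G = "\<lambda>j. G" and ?G1.0 = "\<lambda>j. G1" and ?G2.0 = "\<lambda>j. G2"]
            residual_quadratic sum_alpha_const n_def[symmetric]
          using 1 2 3 by (simp add: algebra_simps)
      qed
    qed (use \<rho> x\<rho> in auto)
    then show ?thesis by (simp add: G_def)
  qed
  have sq: "filterlim (\<lambda>R::real. R\<^sup>2) at_top at_top"
    by (intro filterlim_pow_at_top filterlim_ident) simp
  have "((\<lambda>R. \<beta> j * (norm x)\<^sup>2 + \<eta> j + (- C * ln (1 - (norm x)\<^sup>2 / R\<^sup>2)) + L / R\<^sup>2)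
      \<longlongrightarrow> \<beta> j * (norm x)\<^sup>2 + \<eta> j + (- C * ln (1 - 0)) + 0) at_top"
    by (intro tendsto_intros tendsto_divide_0[OF tendsto_const] filterlim_at_top_imp_at_infinity sq) auto
  moreover have "\<forall>\<^sub>F R in at_top. u j x
      \<le> \<beta> j * (norm x)\<^sup>2 + \<eta> j + (- C * ln (1 - (norm x)\<^sup>2 / R\<^sup>2)) + L / R\<^sup>2"
    using eventually_gt_at_top[of "norm x"] eventually_gt_at_top[of 0]
      filterlim_at_top[THEN iffD1, OF sq, rule_format, of "2 * q0"]
    by eventually_elim (rule bound)
  ultimately have "u j x \<le> \<beta> j * (norm x)\<^sup>2 + \<eta> j + (- C * ln (1 - 0)) + 0"
    by (intro tendsto_lowerbound[where F = at_top]) auto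
  then show ?thesis by simp
qed

text \<open>The barrier \<open>- (1 + m) \<beta>\<^sub>j (1 + \<bar>x\<bar>\<^sup>2)\<^bsup>1 + m\<^esup> / (1 + R\<^sup>2)\<^bsup>m\<^esup>\<close> is about \<open>- (1 + m) \<beta>\<^sub>j R\<^sup>2\<close> on the
  sphere of radius \<open>R\<close>, which pushes the quadratic solution below \<open>u\<close> there by the growth condition,
  and it tends to \<open>0\<close> locally as \<open>R \<rightarrow> \<infinity>\<close>. For small \<open>m\<close> its exponent is close enough to that of a
  multiple of \<open>\<bar>x\<bar>\<^sup>2\<close> for it to be a subsolution.\<close>

lemma solution_ge:
  assumes growth: "\<And>j \<epsilon>. \<epsilon> > 0 \<Longrightarrow> \<forall>\<^sub>F x in at_infinity. - \<epsilon> * (norm x)\<^sup>2 \<le> u j x"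
  shows "\<beta> j * (norm x)\<^sup>2 + \<eta> j \<le> u j x"
proof -
  \<comment> \<open>Small enough for \<open>barrier_coefficient\<close> at every index
    simultaneously.\<close>
  obtain m where m: "m > 0" "m \<le> 1" and ma: "\<And>j. m \<le> a j / (20 * (\<beta> j)\<^sup>2)"
    using finite_pos_lower_bound[of "\<lambda>j. a j / (20 * (\<beta> j)\<^sup>2)"] a \<beta> by (metis divide_pos_pos mult_pos_pos zero_less_numeral zero_less_power)
  have mb: "20 * (\<beta> j)\<^sup>2 * m \<le> a j" for j
    using ma[of j] \<beta>[of j] by (simp add: field_simps)
  define t where "t = 1 + m"
  have t: "t \<ge> 1" using m by (simp add: t_def)
  define n where "n = real DIM('a)"
  \<comment> \<open>Bounds the part of the residual that is left, after division by \<kappa>, once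
    the term proportional to q and the constant c are set aside.\<close>
  define K where "K j = t * \<bar>a j - 2 * (\<beta> j)\<^sup>2\<bar> + (\<sigma> j)\<^sup>2 * n * \<beta> j * t\<^sup>2 + 2 * (\<sigma> j)\<^sup>2 * \<beta> j * t\<^sup>2 * m" for j
  have K0: "K j \<ge> 0" for j
    unfolding K_def n_def using \<beta>[of j] t m by (intro add_nonneg_nonneg mult_nonneg_nonneg) auto
  \<comment> \<open>For q \<ge> q0 the term - q a / 2 outweighs K. For smaller q the constant - c
    does so, and the next choice of L is made for that case.\<close>
  obtain q0 where q0: "q0 \<ge> 0" "\<And>j. 2 * K j / a j \<le> q0"
    using finite_upper_bound[where e = "\<lambda>j. 2 * K j / a j"] by blast
  obtain L where L: "L \<ge> 0" "\<And>j. K j / \<delta> j \<le> L"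
    using finite_upper_bound[where e = "\<lambda>j. K j / \<delta> j"] by blast
  \<comment> \<open>On the sphere the barrier leaves a surplus m \<beta> R^2: one half absorbs
    \<eta> once R^2 \<ge> R1, the other half is the growth condition with \<epsilon> = m \<beta> /
    2.\<close>
  obtain R1 where R1: "R1 \<ge> 0" "\<And>j. 2 * \<eta> j / (m * \<beta> j) \<le> R1"
    using finite_upper_bound[where e = "\<lambda>j. 2 * \<eta> j / (m * \<beta> j)"] by blast
  have "\<forall>\<^sub>F x in at_infinity. \<forall>j. - (m / 2 * \<beta> j) * (norm x)\<^sup>2 \<le> u j x"
    by (intro eventually_all_finite growth) (use m \<beta> in simp)
  then obtain R0 where R0: "\<And>x j. norm x \<ge> R0 \<Longrightarrow> - (m / 2 * \<beta> j) * (norm x)\<^sup>2 \<le> u j x"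
    unfolding eventually_at_infinity by blast
  define Y where "Y = t * \<beta> j * (1 + (norm x)\<^sup>2) powr t + (1 + q0) powr m * L"
  have bound: "\<beta> j * (norm x)\<^sup>2 + \<eta> j - (1 + R\<^sup>2) powr (- m) * Y \<le> u j x"
    if R: "R > 0" "R \<ge> R0" "R\<^sup>2 \<ge> R1" "norm x \<le> R" for R
  proof -
    define k where "k = (1 + R\<^sup>2) powr (- m)"
    define c where "c = k * (1 + q0) powr m * L"
    define h where "h q = k * (1 + q) powr t" for q
    define h1 where "h1 q = k * (t * (1 + q) powr m)" for q
    define h2 where "h2 q = k * (t * (m * (1 + q) powr (m - 1)))" for q
    have k0: "k \<ge> 0" by (simp add: k_def)
    have c0: "c \<ge> 0" using k0 L(1) by (simp add: c_def)
    have pd: "((\<lambda>q. (1 + q) powr r) has_real_derivative r * (1 + q) powr (r - 1)) (at q)"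
      if "- 1 < q" for r q :: real
    proof -
      have "((\<lambda>q. (1 + q) powr r) has_real_derivative r * (1 + q) powr (r - 1) * (0 + 1)) (at q)"
        by (rule DERIV_chain2[where f = "\<lambda>z. z powr r" and g = "\<lambda>q. 1 + q"])
           (use that in \<open>auto intro!: has_real_derivative_powr derivative_eq_intros\<close>)
      then show ?thesis by simp
    qed
    have dh: "(h has_real_derivative h1 q) (at q)" if "- 1 < q" for q
      using pd[OF that, of t] unfolding h_def[abs_def] h1_def by (intro DERIV_cmult) (simp add: t_def)
    have dh1: "(h1 has_real_derivative h2 q) (at q)" if "- 1 < q" for q
      unfolding h1_def[abs_def] h2_def by (intro DERIV_cmult pd that)
    have h2c: "continuous_on {- 1<..<R\<^sup>2 + 1} h2"
      unfolding h2_def[abs_def] by (intro continuous_intros) auto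
    have hR: "h (R\<^sup>2) = 1 + R\<^sup>2"
    proof -
      have "(1 + R\<^sup>2) \<noteq> 0" using zero_le_power2[of R] by linarith
      then show ?thesis
        unfolding h_def k_def t_def powr_add[symmetric] by simp
    qed
    have "(\<lambda>j q. (\<beta> j * q + \<eta> j) + (- (t * \<beta> j) * h q) + (- c)) j ((norm x)\<^sup>2) \<le> u j x"
    proof (rule comparison_below[where ?F1.0 = "\<lambda>j q. \<beta> j + (- (t * \<beta> j) * h1 q)"
          and ?F2.0 = "\<lambda>j q. 0 + (- (t * \<beta> j) * h2 q)" and T = "R\<^sup>2 + 1" and \<rho> = R])
      show "((\<lambda>q. \<beta> j * q + \<eta> j + - (t * \<beta> j) * h q + - c) has_real_derivative
          \<beta> j + - (t * \<beta> j) * h1 q) (at q)" if "- 1 < q" "q < R\<^sup>2 + 1" for j q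
        using dh[OF that(1)] by (auto intro!: derivative_eq_intros)
      show "((\<lambda>q. \<beta> j + - (t * \<beta> j) * h1 q) has_real_derivative 0 + - (t * \<beta> j) * h2 q) (at q)"
        if "- 1 < q" "q < R\<^sup>2 + 1" for j q
        using dh1[OF that(1)] by (auto intro!: derivative_eq_intros)
      show "continuous_on {- 1<..<R\<^sup>2 + 1} (\<lambda>q. 0 + - (t * \<beta> j) * h2 q)" for j
        by (intro continuous_intros h2c)
      show "\<beta> j * R\<^sup>2 + \<eta> j + - (t * \<beta> j) * h (R\<^sup>2) + - c \<le> u j y" if "norm y = R" for j y
      proof -
        have "2 * \<eta> j / (m * \<beta> j) \<le> R\<^sup>2" using R1(2)[of j] R(3) by linarith
        moreover have "m * \<beta> j > 0" using \<beta>[of j] m(1) by simp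
        ultimately have "\<eta> j \<le> R\<^sup>2 * (m * \<beta> j) / 2" by (simp add: pos_divide_le_eq)
        moreover have "- (m / 2 * \<beta> j) * R\<^sup>2 \<le> u j y"
          using R0[of y j] that R(2) by simp
        moreover have "\<beta> j * t \<ge> 0" using \<beta>[of j] t by simp
        ultimately show ?thesis
          using c0 unfolding hR by (simp add: t_def algebra_simps)
      qed
      show "residual (\<lambda>j q. (\<beta> j * q + \<eta> j) + (- (t * \<beta> j) * h q) + (- c))
          (\<lambda>j q. \<beta> j + (- (t * \<beta> j) * h1 q)) (\<lambda>j q. 0 + (- (t * \<beta> j) * h2 q)) j q \<le> 0"
        if q: "0 \<le> q" "q < R\<^sup>2" for j q
      proof -
        define z where "z = 1 + q"
        \<comment> \<open>Equals ((1 + q) / (1 + R^2))^m, hence at most 1 in the ball. The values h,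
          h1 and q h2 are all multiples of it, and the squared gradient carries one extra factor
          \<kappa>.\<close>
        define \<kappa> where "\<kappa> = k * z powr m"
        have z: "z > 0" using q by (simp add: z_def)
        have \<kappa>0: "\<kappa> \<ge> 0" using k0 by (simp add: \<kappa>_def)
        have \<kappa>1: "\<kappa> \<le> 1"
        proof -
          have "\<kappa> \<le> k * (1 + R\<^sup>2) powr m"
            unfolding \<kappa>_def using k0 q m z by (intro mult_left_mono powr_mono2) (auto simp: z_def)
          also have "\<dots> = 1"
          proof -
            have "(1 + R\<^sup>2) \<noteq> 0" using zero_le_power2[of R] by linarith
            then show ?thesis unfolding k_def powr_add[symmetric] by simp
          qed
          finally show ?thesis .
        qed
        have he: "h q = \<kappa> * z"
          using z by (simp add: h_def \<kappa>_def z_def[symmetric] t_def powr_add)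
        have h1e: "h1 q = \<kappa> * t" by (simp add: h1_def \<kappa>_def z_def)
        have h2e: "q * h2 q = \<kappa> * t * m * (q / z)"
          using z by (simp add: h2_def \<kappa>_def z_def[symmetric] powr_diff)
        have B: "(\<Sum>l\<in>UNIV. \<alpha>$j$l * \<beta> l) = 2 * (\<beta> j)\<^sup>2 + \<delta> j * \<beta> j - a j"
          using beta_eq by (simp add: beta_system_def algebra_simps)
        have sumG: "(\<Sum>l\<in>UNIV. \<alpha>$j$l * (- (t * \<beta> l) * h q))
            = - t * h q * (2 * (\<beta> j)\<^sup>2 + \<delta> j * \<beta> j - a j)"
          unfolding B[symmetric] sum_distrib_left by (intro sum.cong) (simp_all add: algebra_simps)
        have eq: "residual (\<lambda>j q. (\<beta> j * q + \<eta> j) + (- (t * \<beta> j) * h q) + (- c))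
          (\<lambda>j q. \<beta> j + (- (t * \<beta> j) * h1 q)) (\<lambda>j q. 0 + (- (t * \<beta> j) * h2 q)) j q
          = (\<sigma> j)\<^sup>2 * n * t * \<beta> j * h1 q + 2 * (\<sigma> j)\<^sup>2 * t * \<beta> j * (q * h2 q)
            + 2 * q * (- 2 * (\<beta> j)\<^sup>2 * t * h1 q + (t * \<beta> j * h1 q)\<^sup>2)
            - t * h q * (a j - 2 * (\<beta> j)\<^sup>2) - \<delta> j * c"
          unfolding residual_add residual_quadratic sumG n_def[symmetric]
          by (simp add: power2_eq_square algebra_simps)
        also have "\<dots> = \<kappa> * ((\<sigma> j)\<^sup>2 * n * \<beta> j * t\<^sup>2 + 2 * (\<sigma> j)\<^sup>2 * \<beta> j * t\<^sup>2 * m * (q / z)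
            + q * (- 4 * (\<beta> j)\<^sup>2 * t\<^sup>2 + 2 * (\<beta> j)\<^sup>2 * t ^ 4 * \<kappa> - t * (a j - 2 * (\<beta> j)\<^sup>2))
            - t * (a j - 2 * (\<beta> j)\<^sup>2)) - \<delta> j * c"
          unfolding he h1e h2e z_def[THEN arg_cong[where f = "\<lambda>z. _ * z"]]
          by (simp add: z_def eval_nat_numeral algebra_simps)
        also have "\<dots> \<le> \<kappa> * (K j - q * (a j / 2)) - \<delta> j * c"
        proof (intro diff_right_mono mult_left_mono \<kappa>0)
          have "q / z \<le> 1" using z q by (simp add: z_def)
          then have 1: "2 * (\<sigma> j)\<^sup>2 * \<beta> j * t\<^sup>2 * m * (q / z) \<le> 2 * (\<sigma> j)\<^sup>2 * \<beta> j * t\<^sup>2 * m"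
            using \<beta>[of j] m by (intro mult_left_le) auto
          have "- 4 * (\<beta> j)\<^sup>2 * t\<^sup>2 + 2 * (\<beta> j)\<^sup>2 * t ^ 4 * \<kappa> - t * (a j - 2 * (\<beta> j)\<^sup>2) \<le> - a j / 2"
            unfolding t_def by (rule barrier_coefficient[OF m mb a \<kappa>1])
          from mult_left_mono[OF this q(1)]
          have 2: "q * (- 4 * (\<beta> j)\<^sup>2 * t\<^sup>2 + 2 * (\<beta> j)\<^sup>2 * t ^ 4 * \<kappa> - t * (a j - 2 * (\<beta> j)\<^sup>2))
              \<le> - (q * (a j / 2))" by simp
          have "t * (- (a j - 2 * (\<beta> j)\<^sup>2)) \<le> t * \<bar>a j - 2 * (\<beta> j)\<^sup>2\<bar>"
            using t by (intro mult_left_mono) auto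
          then have 3: "- (t * (a j - 2 * (\<beta> j)\<^sup>2)) \<le> t * \<bar>a j - 2 * (\<beta> j)\<^sup>2\<bar>"
            by (simp only: mult_minus_right)
          show "(\<sigma> j)\<^sup>2 * n * \<beta> j * t\<^sup>2 + 2 * (\<sigma> j)\<^sup>2 * \<beta> j * t\<^sup>2 * m * (q / z)
            + q * (- 4 * (\<beta> j)\<^sup>2 * t\<^sup>2 + 2 * (\<beta> j)\<^sup>2 * t ^ 4 * \<kappa> - t * (a j - 2 * (\<beta> j)\<^sup>2))
            - t * (a j - 2 * (\<beta> j)\<^sup>2) \<le> K j - q * (a j / 2)"
            unfolding K_def using 1 2 3 by linarith
        qed
        also have "\<dots> \<le> 0"
        proof (cases "q \<ge> q0")
          case True
          then have "2 * K j / a j \<le> q" using q0(2)[of j] by linarith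
          then have "K j - q * (a j / 2) \<le> 0" using a[of j] by (simp add: field_simps)
          then have "\<kappa> * (K j - q * (a j / 2)) \<le> 0" using \<kappa>0 by (intro mult_nonneg_nonpos)
          moreover have "\<delta> j * c \<ge> 0" using \<delta>[of j] c0 by simp
          ultimately show ?thesis by linarith
        next
          case False
          have "\<kappa> * (K j - q * (a j / 2)) \<le> \<kappa> * K j"
            using \<kappa>0 q a[of j] by (intro mult_left_mono) auto
          also have "\<dots> \<le> (k * (1 + q0) powr m) * K j"
            unfolding \<kappa>_def using False k0 m z K0
            by (intro mult_right_mono mult_left_mono powr_mono2) (auto simp: z_def)
          also have "\<dots> \<le> (k * (1 + q0) powr m) * (L * \<delta> j)"
            using L(2)[of j] \<delta>[of j] k0 by (intro mult_left_mono) (auto simp: field_simps)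
          also have "\<dots> = \<delta> j * c" by (simp add: c_def)
          finally show ?thesis by simp
        qed
        finally show ?thesis .
      qed
    qed (use R in auto)
    then show ?thesis
      by (simp add: Y_def h_def c_def k_def algebra_simps)
  qed
  have sq: "filterlim (\<lambda>R::real. R\<^sup>2) at_top at_top"
    by (intro filterlim_pow_at_top filterlim_ident) simp
  have "((\<lambda>R. (1 + R\<^sup>2) powr (- m)) \<longlongrightarrow> 0) at_top"
    by (rule tendsto_neg_powr) (use m filterlim_tendsto_add_at_top[OF tendsto_const sq, of 1] in auto)
  then have "((\<lambda>R. \<beta> j * (norm x)\<^sup>2 + \<eta> j - (1 + R\<^sup>2) powr (- m) * Y)
      \<longlongrightarrow> \<beta> j * (norm x)\<^sup>2 + \<eta> j - 0 * Y) at_top"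
    by (intro tendsto_intros)
  moreover have "\<forall>\<^sub>F R in at_top. \<beta> j * (norm x)\<^sup>2 + \<eta> j - (1 + R\<^sup>2) powr (- m) * Y \<le> u j x"
    using eventually_ge_at_top[of "norm x"] eventually_gt_at_top[of 0] eventually_ge_at_top[of R0]
      filterlim_at_top[THEN iffD1, OF sq, rule_format, of R1]
    by eventually_elim (rule bound)
  ultimately have "\<beta> j * (norm x)\<^sup>2 + \<eta> j - 0 * Y \<le> u j x"
    by (intro tendsto_upperbound[where F = at_top]) auto
  then show ?thesis by simp
qed

end

end

section \<open>The quadratic solution\<close>

lemma continuous_loc_Lp:
  fixes f :: "'a::euclidean_space \<Rightarrow> 'b::euclidean_space"
  assumes f: "continuous_on UNIV f" and m: "m > 0"
  shows "loc_Lp m f"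
  unfolding loc_Lp_def
proof (intro conjI allI impI)
  show "f \<in> borel_measurable lebesgue"
    using borel_measurable_continuous_onI[OF f] by (simp add: measurable_completion)
  fix K :: "'a set" assume K: "compact K"
  have c: "continuous_on UNIV (\<lambda>x. norm (f x) powr m)"
    by (intro continuous_on_powr' continuous_intros f) (use m in auto)
  have "integrable lborel (\<lambda>x. indicator K x *\<^sub>R (norm (f x) powr m))"
    by (rule borel_integrable_compact[OF K continuous_on_subset[OF c]]) simp
  moreover have "K \<in> sets borel" using K by (simp add: borel_compact)
  then have "(\<lambda>x. indicator K x *\<^sub>R (norm (f x) powr m)) \<in> borel_measurable lborel"
    using borel_measurable_continuous_onI[OF c]
    by (auto intro!: borel_measurable_scaleR borel_measurable_indicator)
  ultimately show "set_integrable lebesgue K (\<lambda>x. norm (f x) powr m)"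
    by (simp add: set_integrable_def integrable_completion)
qed

lemma weak_gradient_classical:
  assumes "continuous_on UNIV u" "continuous_on UNIV G"
    and p: "\<And>i. i \<in> Basis \<Longrightarrow> has_partial i u (\<lambda>x. G x \<bullet> i)"
  shows "weak_gradient u G"
  unfolding weak_gradient_def
proof (intro conjI allI impI ballI)
  show "loc_Lp 1 u" "loc_Lp 1 G"
    using assms by (simp_all add: continuous_loc_Lp)
  fix \<phi> :: "'a \<Rightarrow> real" and i :: 'a assume \<phi>: "test_function \<phi>" and i: "i \<in> Basis"
  have "(LINT x|lebesgue. u x * pd i \<phi> x) = - (LINT x|lebesgue. (G x \<bullet> i) * \<phi> x)"
    by (rule integral_by_parts[OF p[OF i] assms(1) _ test_function_has_partial[OF \<phi>]
          test_function_cont_cpt[OF \<phi>] test_function_cont_cpt[OF test_function_pd[OF \<phi> i]]])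
       (intro continuous_intros assms(2))
  then show "(LINT x|lebesgue. u x * frechet_derivative \<phi> (at x) i)
      = - (LINT x|lebesgue. (G x \<bullet> i) * \<phi> x)"
    by (simp add: pd_def)
qed

lemma weak_derivatives2_quad:
  "weak_derivatives2 (\<lambda>x::'a::euclidean_space. B * (norm x)\<^sup>2 + E) (\<lambda>x. (2 * B) *\<^sub>R x) (\<lambda>i x. (2 * B) *\<^sub>R i)"
  unfolding weak_derivatives2_def
proof (intro conjI ballI)
  show "weak_gradient (\<lambda>x::'a. B * (norm x)\<^sup>2 + E) (\<lambda>x. (2 * B) *\<^sub>R x)"
  proof (rule weak_gradient_classical)
    fix i :: 'a assume i: "i \<in> Basis"
    show "has_partial i (\<lambda>x. B * (norm x)\<^sup>2 + E) (\<lambda>x. ((2 * B) *\<^sub>R x) \<bullet> i)"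
      unfolding has_partial_def
    proof
      fix x :: 'a
      have "((\<lambda>q. B * q + E) has_real_derivative B) (at ((norm x)\<^sup>2))"
        by (auto intro!: derivative_eq_intros)
      from radial_has_partial[OF i this]
      show "((\<lambda>t. B * (norm (x + t *\<^sub>R i))\<^sup>2 + E) has_real_derivative ((2 * B) *\<^sub>R x) \<bullet> i) (at 0)"
        by (simp add: mult.commute mult.left_commute)
    qed
  qed (intro continuous_intros)+
  fix j :: 'a assume "j \<in> Basis"
  show "weak_gradient (\<lambda>x::'a. ((2 * B) *\<^sub>R x) \<bullet> j) (\<lambda>x. (2 * B) *\<^sub>R j)"
  proof (rule weak_gradient_classical)
    fix i :: 'a
    show "has_partial i (\<lambda>x. ((2 * B) *\<^sub>R x) \<bullet> j) (\<lambda>x. ((2 * B) *\<^sub>R j) \<bullet> i)"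
      unfolding has_partial_def
    proof
      fix x :: 'a
      have "((\<lambda>t. (2 * B) * (x \<bullet> j + t * (i \<bullet> j))) has_real_derivative (2 * B) * (i \<bullet> j)) (at 0)"
        by (auto intro!: derivative_eq_intros)
      then show "((\<lambda>t. ((2 * B) *\<^sub>R (x + t *\<^sub>R i)) \<bullet> j) has_real_derivative ((2 * B) *\<^sub>R j) \<bullet> i) (at 0)"
        by (simp add: inner_add_left inner_add_right inner_commute)
    qed
  qed (intro continuous_intros)+
qed

lemma admissible_quad:
  assumes "B > 0"
  shows "admissible (\<lambda>x::'a::euclidean_space. B * (norm x)\<^sup>2 + E)"
  unfolding admissible_def
proof (intro conjI allI impI)
  show c: "continuous_on UNIV (\<lambda>x::'a. B * (norm x)\<^sup>2 + E)" by (intro continuous_intros)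
  show "W2_loc m (\<lambda>x::'a. B * (norm x)\<^sup>2 + E)" if "real DIM('a) < m" for m
  proof -
    have "m > 0" using that by (rule le_less_trans[rotated]) simp
    then have "loc_Lp m (\<lambda>x::'a. B * (norm x)\<^sup>2 + E)" "loc_Lp m (\<lambda>x::'a. (2 * B) *\<^sub>R x)"
      "\<And>i. loc_Lp m (\<lambda>x::'a. (2 * B) *\<^sub>R (i::'a))"
      by (intro continuous_loc_Lp continuous_intros; assumption)+
    then show ?thesis
      unfolding W2_loc_def using weak_derivatives2_quad by blast
  qed
  show "0 \<le> Liminf at_infinity (\<lambda>x::'a. ereal ((B * (norm x)\<^sup>2 + E) / (norm x)\<^sup>2))"
  proof (rule Liminf_bounded)
    show "\<forall>\<^sub>F x::'a in at_infinity. 0 \<le> ereal ((B * (norm x)\<^sup>2 + E) / (norm x)\<^sup>2)"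
      unfolding eventually_at_infinity
    proof (intro exI allI impI)
      \<comment> \<open>E may be negative; from this radius on B |x|^2 outweighs it.\<close>
      fix x :: 'a assume "sqrt (\<bar>E\<bar> / B) \<le> norm x"
      then have "\<bar>E\<bar> / B \<le> (norm x)\<^sup>2" by (rule sqrt_le_D)
      then have "\<bar>E\<bar> \<le> B * (norm x)\<^sup>2" using assms by (simp add: field_simps)
      then have "B * (norm x)\<^sup>2 + E \<ge> 0" by linarith
      then show "0 \<le> ereal ((B * (norm x)\<^sup>2 + E) / (norm x)\<^sup>2)" by simp
    qed
  qed
qed

lemma solves_HJB_system_quad:
  assumes "beta_system \<delta> \<alpha> a \<beta>" "eta_system DIM('a) \<sigma> \<delta> \<alpha> b \<beta> \<eta>"
  shows "solves_HJB_system \<sigma> \<delta> \<alpha> (\<lambda>j (x::'a::euclidean_space). a j * (norm x)\<^sup>2 + b j)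
    (\<lambda>j x. \<beta> j * (norm x)\<^sup>2 + \<eta> j)"
  unfolding solves_HJB_system_def
proof (intro exI conjI allI)
  fix j
  show "weak_derivatives2 (\<lambda>x::'a. \<beta> j * (norm x)\<^sup>2 + \<eta> j) (\<lambda>x. (2 * \<beta> j) *\<^sub>R x) (\<lambda>i x. (2 * \<beta> j) *\<^sub>R i)"
    by (rule weak_derivatives2_quad)
  show "AE x in lebesgue. - ((\<sigma> j)\<^sup>2 / 2) * laplacian_of (\<lambda>i (x::'a). (2 * \<beta> j) *\<^sub>R i) x
      + 1 / 2 * (norm ((2 * \<beta> j) *\<^sub>R x))\<^sup>2 + \<delta> j * (\<beta> j * (norm x)\<^sup>2 + \<eta> j)
      - (\<Sum>l\<in>UNIV. \<alpha>$j$l * (\<beta> l * (norm x)\<^sup>2 + \<eta> l)) = a j * (norm x)\<^sup>2 + b j"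
  proof (rule AE_I2)
    fix x :: 'a
    have B: "2 * (\<beta> j)\<^sup>2 + \<delta> j * \<beta> j - (\<Sum>l\<in>UNIV. \<alpha>$j$l * \<beta> l) = a j"
      using assms(1) by (simp add: beta_system_def)
    have E: "\<delta> j * \<eta> j - (\<Sum>l\<in>UNIV. \<alpha>$j$l * \<eta> l) = b j + real DIM('a) * (\<sigma> j)\<^sup>2 * \<beta> j"
      using assms(2) by (simp add: eta_system_def)
    have S: "(\<Sum>l\<in>UNIV. \<alpha>$j$l * (\<beta> l * (norm x)\<^sup>2 + \<eta> l))
        = (\<Sum>l\<in>UNIV. \<alpha>$j$l * \<beta> l) * (norm x)\<^sup>2 + (\<Sum>l\<in>UNIV. \<alpha>$j$l * \<eta> l)"
      by (simp add: distrib_left sum.distrib sum_distrib_right mult.assoc)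
    have L: "laplacian_of (\<lambda>i (x::'a). (2 * \<beta> j) *\<^sub>R i) x = real DIM('a) * (2 * \<beta> j)"
      unfolding laplacian_of_def by (simp add: inner_Basis)
    have N: "(norm ((2 * \<beta> j) *\<^sub>R x))\<^sup>2 = 4 * (\<beta> j)\<^sup>2 * (norm x)\<^sup>2"
      by (simp add: power_mult_distrib)
    show "- ((\<sigma> j)\<^sup>2 / 2) * laplacian_of (\<lambda>i (x::'a). (2 * \<beta> j) *\<^sub>R i) x
      + 1 / 2 * (norm ((2 * \<beta> j) *\<^sub>R x))\<^sup>2 + \<delta> j * (\<beta> j * (norm x)\<^sup>2 + \<eta> j)
      - (\<Sum>l\<in>UNIV. \<alpha>$j$l * (\<beta> l * (norm x)\<^sup>2 + \<eta> l)) = a j * (norm x)\<^sup>2 + b j"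
      unfolding S L N B[symmetric] using E by (simp add: algebra_simps)
  qed
qed

lemma admissible_growth:
  assumes "admissible u" "\<epsilon> > 0"
  shows "\<forall>\<^sub>F x in at_infinity. - \<epsilon> * (norm x)\<^sup>2 \<le> u x"
proof -
  have "ereal (- \<epsilon>) < 0" using assms(2) by simp
  also have "0 \<le> Liminf at_infinity (\<lambda>x. ereal (u x / (norm x)\<^sup>2))"
    using assms(1) by (simp add: admissible_def)
  finally have "\<forall>\<^sub>F x in at_infinity. ereal (- \<epsilon>) < ereal (u x / (norm x)\<^sup>2)"
    by (rule less_LiminfD)
  moreover have "\<forall>\<^sub>F x::'a in at_infinity. norm x \<ge> 1"
    unfolding eventually_at_infinity by blast
  ultimately show ?thesis
  proof eventually_elim
    case (elim x)
    then have "(norm x)\<^sup>2 > 0" by (intro zero_less_power) linarith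
    then show ?case using elim(1) by (simp add: field_simps)
  qed
qed

lemma hjb_solution_unique:
  fixes u :: "'k::finite \<Rightarrow> 'a::euclidean_space \<Rightarrow> real"
  assumes "markov_generator \<alpha>" "\<And>j. \<sigma> j > 0" "\<And>j. \<delta> j > 0" "\<And>j. a j > 0"
    and \<beta>: "\<And>j. \<beta> j > 0" "beta_system \<delta> \<alpha> a \<beta>" "eta_system DIM('a) \<sigma> \<delta> \<alpha> b \<beta> \<eta>"
    and u: "\<And>j. admissible (u j)" "solves_HJB_system \<sigma> \<delta> \<alpha> (\<lambda>j x. a j * (norm x)\<^sup>2 + b j) u"
  shows "u = (\<lambda>j x. \<beta> j * (norm x)\<^sup>2 + \<eta> j)"
proof -
  have cont: "continuous_on UNIV (u j)" for j
    using u(1)[of j] by (simp add: admissible_def)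
  interpret hjb_system \<alpha> \<sigma> \<delta> a b u
    by unfold_locales (rule assms(1-4) u(2) cont)+
  show ?thesis
    using solution_le[OF \<beta>] solution_ge[OF \<beta> admissible_growth[OF u(1)]]
    by (intro ext antisym) auto
qed

section \<open>The algebraic systems\<close>

text \<open>With the other components fixed, the j-th equation is a quadratic 2 t^2 + d t = r with d
  > 0 and r > 0. A fixed point of the map to its positive roots solves the system, and it is
  positive because every root is.\<close>

lemma beta_system_exists:
  fixes \<alpha> :: "real^'k^'k"
  assumes gen: "markov_generator \<alpha>" and \<delta>: "\<And>j. \<delta> j > 0" and a: "\<And>j. a j > 0"
  shows "\<exists>\<beta>. (\<forall>j. \<beta> j > 0) \<and> beta_system \<delta> \<alpha> a \<beta>"
proof -
  have off: "\<alpha>$j$l \<ge> 0" if "l \<noteq> j" for j l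
    using gen that by (auto simp: markov_generator_def)
  have diag: "\<alpha>$j$j = - (\<Sum>l\<in>UNIV - {j}. \<alpha>$j$l)" for j
    using gen by (simp add: markov_generator_def)
  define d where "d j = \<delta> j - \<alpha>$j$j" for j
  have d: "d j > 0" for j
  proof -
    have "(\<Sum>l\<in>UNIV - {j}. \<alpha>$j$l) \<ge> 0" by (rule sum_nonneg) (simp add: off)
    then show ?thesis using \<delta>[of j] diag[of j] unfolding d_def by linarith
  qed
  \<comment> \<open>Since a \<le> \<delta> \<kappa> and the rows of \<alpha> sum to 0, r is at most
    d \<kappa> on the box [0, \<kappa>]^k. The root is then at most \<kappa>, so the box is mapped
    into itself.\<close>
  obtain \<kappa> where \<kappa>: "\<kappa> \<ge> 0" "\<And>j. a j / \<delta> j \<le> \<kappa>"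
    using finite_upper_bound[where e = "\<lambda>j. a j / \<delta> j"] by blast
  define r where "r j y = a j + (\<Sum>l\<in>UNIV - {j}. \<alpha>$j$l * y$l)" for j and y :: "real^'k"
  define T where "T y = (\<chi> j. (sqrt ((d j)\<^sup>2 + 8 * r j y) - d j) / 4)" for y :: "real^'k"
  define S where "S = cbox 0 (\<chi> j. \<kappa> :: real^'k)"
  have S: "y \<in> S \<longleftrightarrow> (\<forall>j. 0 \<le> y$j \<and> y$j \<le> \<kappa>)" for y
    by (simp add: S_def mem_box_cart)
  have r_pos: "r j y \<ge> a j" if "y \<in> S" for j y
    unfolding r_def using off that by (auto simp: S intro!: sum_nonneg mult_nonneg_nonneg)
  have T_pos: "T y $ j > 0" if "y \<in> S" for y j
  proof -
    have "d j < sqrt ((d j)\<^sup>2 + 8 * r j y)"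
      by (rule real_less_rsqrt) (use r_pos[OF that, of j] a[of j] in simp)
    then show ?thesis by (simp add: T_def)
  qed
  have T_le: "T y $ j \<le> \<kappa>" if "y \<in> S" for y j
  proof -
    have "(\<Sum>l\<in>UNIV - {j}. \<alpha>$j$l * y$l) \<le> (\<Sum>l\<in>UNIV - {j}. \<alpha>$j$l * \<kappa>)"
      using off that by (intro sum_mono mult_left_mono) (auto simp: S)
    also have "\<dots> = - \<alpha>$j$j * \<kappa>"
      unfolding diag by (simp add: sum_distrib_right)
    finally have "r j y \<le> \<delta> j * \<kappa> - \<alpha>$j$j * \<kappa>"
      using \<kappa>(2)[of j] \<delta>[of j] unfolding r_def by (simp add: field_simps)
    also have "\<dots> = d j * \<kappa>" by (simp add: d_def algebra_simps)
    also have "\<dots> \<le> 2 * \<kappa>\<^sup>2 + d j * \<kappa>" by simp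
    finally have "(d j)\<^sup>2 + 8 * r j y \<le> (d j + 4 * \<kappa>)\<^sup>2"
      by (simp add: power2_eq_square algebra_simps)
    then have "sqrt ((d j)\<^sup>2 + 8 * r j y) \<le> d j + 4 * \<kappa>"
      using \<kappa>(1) d[of j] by (intro real_le_lsqrt) auto
    then show ?thesis by (simp add: T_def)
  qed
  have cont: "continuous_on S T"
    unfolding T_def r_def by (intro continuous_intros) simp_all
  have maps: "T \<in> S \<rightarrow> S"
  proof
    fix y assume "y \<in> S"
    then show "T y \<in> S"
      using T_pos[of y] T_le[of y] by (auto simp: S[of "T y"] intro: less_imp_le)
  qed
  have "compact S" "convex S" unfolding S_def by (rule compact_cbox convex_box)+
  moreover have "0 \<in> S" using \<kappa>(1) by (simp add: S)
  then have "S \<noteq> {}" by blast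
  ultimately obtain y where y: "y \<in> S" "T y = y"
    using brouwer[OF _ _ _ cont maps] by blast
  have "2 * (y$j)\<^sup>2 + \<delta> j * y$j - (\<Sum>l\<in>UNIV. \<alpha>$j$l * y$l) = a j" for j
  proof -
    have "(d j)\<^sup>2 + 8 * r j y \<ge> 0"
      using r_pos[OF y(1), of j] a[of j] by (intro add_nonneg_nonneg) auto
    then have "(sqrt ((d j)\<^sup>2 + 8 * r j y))\<^sup>2 = (d j)\<^sup>2 + 8 * r j y" by simp
    moreover have "sqrt ((d j)\<^sup>2 + 8 * r j y) = d j + 4 * y$j"
      using y(2) by (simp add: T_def vec_eq_iff field_simps)
    ultimately have "(d j + 4 * y$j)\<^sup>2 = (d j)\<^sup>2 + 8 * r j y" by simp
    then have "2 * (y$j)\<^sup>2 + d j * y$j = r j y"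
      by (simp add: power2_eq_square algebra_simps)
    then show ?thesis
      using sum.remove[of UNIV j "\<lambda>l. \<alpha>$j$l * y$l"] by (simp add: d_def r_def algebra_simps)
  qed
  moreover have "y$j > 0" for j using T_pos[OF y(1), of j] y(2) by simp
  ultimately show ?thesis
    by (intro exI[of _ "\<lambda>j. y$j"]) (simp add: beta_system_def)
qed

text \<open>The system reads M \<eta> = r with r \<ge> 0, and the entries of the inverse of M are
  nonnegative.\<close>

lemma eta_system_exists:
  fixes \<alpha> :: "real^'k^'k"
  assumes M: "M_matrix (\<chi> j l. (if j = l then \<delta> j else 0) - \<alpha>$j$l)"
    and b: "\<And>j. b j \<ge> 0" and \<beta>: "\<And>j. \<beta> j > 0"
  shows "\<exists>\<eta>. (\<forall>j. \<eta> j \<ge> 0) \<and> eta_system N \<sigma> \<delta> \<alpha> b \<beta> \<eta>"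
proof -
  define M where "M = (\<chi> j l. (if j = l then \<delta> j else 0) - \<alpha>$j$l)"
  define r :: "real^'k" where "r = (\<chi> j. b j + real N * (\<sigma> j)\<^sup>2 * \<beta> j)"
  define y where "y = matrix_inv M *v r"
  have inv: "invertible M" and nn: "\<And>j l. matrix_inv M $ j $ l \<ge> 0"
    using M by (auto simp: M_matrix_def M_def)
  have "M ** matrix_inv M = mat 1"
    using someI_ex[OF inv[unfolded invertible_def]] by (simp add: matrix_inv_def)
  then have My: "M *v y = r"
    by (simp add: y_def matrix_vector_mul_assoc)
  have "r $ l \<ge> 0" for l
    using b[of l] \<beta>[of l] by (simp add: r_def)
  then have y0: "y $ j \<ge> 0" for j
    unfolding y_def using nn by (auto simp: matrix_vector_mult_def intro!: sum_nonneg)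
  have eq: "\<delta> j * y$j - (\<Sum>l\<in>UNIV. \<alpha>$j$l * y$l) = r$j" for j
  proof -
    have "(M *v y) $ j = (\<Sum>l\<in>UNIV. (if j = l then \<delta> j * y$l else 0) - \<alpha>$j$l * y$l)"
      by (auto simp: M_def matrix_vector_mult_def left_diff_distrib intro!: sum.cong)
    then show ?thesis by (simp add: My sum_subtractf)
  qed
  show ?thesis
    by (rule exI[of _ "\<lambda>j. y$j"]) (use y0 eq in \<open>simp add: eta_system_def r_def\<close>)
qed

theorem theorem6p1:
  fixes \<alpha> :: "real^'k^'k" and \<sigma> \<delta> a b :: "'k::finite \<Rightarrow> real"
    and f :: "'k \<Rightarrow> real^'n \<Rightarrow> real"
  assumes "markov_generator \<alpha>" and "irreducible_matrix \<alpha>"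
    and "\<And>j. \<sigma> j > 0" and "\<And>j. \<delta> j > 0"
    and "\<And>j. a j > 0" and "\<And>j. b j \<ge> 0"
    and "\<And>j x. f j x = a j * (norm x)\<^sup>2 + b j"
    and "M_matrix (\<chi> j l. (if j = l then \<delta> j else 0) - \<alpha>$j$l)"
  shows "\<exists>\<beta> \<eta>.
    (\<forall>j. \<beta> j > 0) \<and> beta_system \<delta> \<alpha> a \<beta> \<and>
    (\<forall>\<beta>'. (\<forall>j. \<beta>' j > 0) \<and> beta_system \<delta> \<alpha> a \<beta>' \<longrightarrow> \<beta>' = \<beta>) \<and>
    (\<forall>j. \<eta> j \<ge> 0) \<and> eta_system CARD('n) \<sigma> \<delta> \<alpha> b \<beta> \<eta> \<and>
    (\<forall>\<eta>'. eta_system CARD('n) \<sigma> \<delta> \<alpha> b \<beta> \<eta>' \<longrightarrow> \<eta>' = \<eta>) \<and>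
    (\<forall>u. (\<forall>j. admissible (u j)) \<and> solves_HJB_system \<sigma> \<delta> \<alpha> f u \<longleftrightarrow>
         u = (\<lambda>j x. \<beta> j * (norm x)\<^sup>2 + \<eta> j))"
proof -
  have f: "f = (\<lambda>j x. a j * (norm x)\<^sup>2 + b j)" using assms(7) by blast
  have dim: "DIM(real^'n) = CARD('n)" by simp
  have quad: "admissible (\<lambda>x::real^'n. \<beta> j * (norm x)\<^sup>2 + \<eta> j)"
    "solves_HJB_system \<sigma> \<delta> \<alpha> f (\<lambda>j x. \<beta> j * (norm x)\<^sup>2 + \<eta> j)"
    if "\<And>j. \<beta> j > 0" "beta_system \<delta> \<alpha> a \<beta>" "eta_system CARD('n) \<sigma> \<delta> \<alpha> b \<beta> \<eta>" for \<beta> \<eta> j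
    using that admissible_quad solves_HJB_system_quad[where 'a = "real^'n", of \<delta> \<alpha> a \<beta> \<sigma> b \<eta>]
    by (auto simp: f dim)
  have unique: "u = (\<lambda>j x. \<beta> j * (norm x)\<^sup>2 + \<eta> j)"
    if "\<And>j. \<beta> j > 0" "beta_system \<delta> \<alpha> a \<beta>" "eta_system CARD('n) \<sigma> \<delta> \<alpha> b \<beta> \<eta>"
      "\<And>j. admissible (u j)" "solves_HJB_system \<sigma> \<delta> \<alpha> f u" for \<beta> \<eta> and u :: "'k \<Rightarrow> real^'n \<Rightarrow> real"
    using hjb_solution_unique[where 'a = "real^'n", of \<alpha> \<sigma> \<delta> a \<beta> b \<eta> u] that assms by (simp add: f dim)
  \<comment> \<open>Both pairs describe the same solution of the PDE; its value at 0 determines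
    \<eta>, and its value at a unit vector then determines \<beta>.\<close>
  have coeff: "\<beta>' = \<beta> \<and> \<eta>' = \<eta>"
    if "\<And>j. \<beta> j > 0" "beta_system \<delta> \<alpha> a \<beta>" "eta_system CARD('n) \<sigma> \<delta> \<alpha> b \<beta> \<eta>"
      "\<And>j. \<beta>' j > 0" "beta_system \<delta> \<alpha> a \<beta>'" "eta_system CARD('n) \<sigma> \<delta> \<alpha> b \<beta>' \<eta>'" for \<beta> \<eta> \<beta>' \<eta>'
  proof -
    have eq: "(\<lambda>j (x::real^'n). \<beta>' j * (norm x)\<^sup>2 + \<eta>' j) = (\<lambda>j x. \<beta> j * (norm x)\<^sup>2 + \<eta> j)"
      by (rule unique[OF that(1-3) quad[OF that(4-6)]])
    then have eqx: "\<beta>' j * (norm x)\<^sup>2 + \<eta>' j = \<beta> j * (norm x)\<^sup>2 + \<eta> j" for j and x :: "real^'n"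
      by meson
    have e: "\<eta>' j = \<eta> j" for j using eqx[of j 0] by simp
    obtain v :: "real^'n" where "norm v = 1" using vector_choose_size[of 1] by auto
    then have "\<beta>' j = \<beta> j" for j using eqx[of j v] e[of j] by simp
    with e show ?thesis by blast
  qed
  obtain \<beta> where \<beta>: "\<And>j. \<beta> j > 0" "beta_system \<delta> \<alpha> a \<beta>"
    using beta_system_exists[where \<delta> = \<delta> and a = a, OF assms(1,4,5)] by blast
  obtain \<eta> where \<eta>: "\<And>j. \<eta> j \<ge> 0" "eta_system CARD('n) \<sigma> \<delta> \<alpha> b \<beta> \<eta>"
    using eta_system_exists[where b = b and \<beta> = \<beta> and \<sigma> = \<sigma> and N = "CARD('n)",
      OF assms(8,6) \<beta>(1)] by blast
  show ?thesis
  proof (rule exI[of _ \<beta>], rule exI[of _ \<eta>], intro conjI allI impI)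
    fix \<beta>' assume \<beta>': "(\<forall>j. \<beta>' j > 0) \<and> beta_system \<delta> \<alpha> a \<beta>'"
    then have pos': "\<beta>' j > 0" for j by blast
    \<comment> \<open>Completes \<beta>' to a pair, so that it too yields a solution of the
      PDE.\<close>
    obtain \<eta>' where \<eta>': "eta_system CARD('n) \<sigma> \<delta> \<alpha> b \<beta>' \<eta>'"
      using eta_system_exists[where b = b and \<beta> = \<beta>' and \<sigma> = \<sigma> and N = "CARD('n)",
        OF assms(8,6) pos'] by blast
    show "\<beta>' = \<beta>"
      using coeff[OF \<beta> \<eta>(2) pos' conjunct2[OF \<beta>'] \<eta>'] by (rule conjunct1)
  next
    fix \<eta>' assume "eta_system CARD('n) \<sigma> \<delta> \<alpha> b \<beta> \<eta>'"
    from coeff[OF \<beta> \<eta>(2) \<beta> this] show "\<eta>' = \<eta>" by (rule conjunct2)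
  next
    fix u :: "'k \<Rightarrow> real^'n \<Rightarrow> real"
    show "(\<forall>j. admissible (u j)) \<and> solves_HJB_system \<sigma> \<delta> \<alpha> f u \<longleftrightarrow>
         u = (\<lambda>j x. \<beta> j * (norm x)\<^sup>2 + \<eta> j)" (is "?sol \<longleftrightarrow> ?quad")
    proof
      assume u: ?sol
      then have "admissible (u j)" for j by blast
      from unique[OF \<beta> \<eta>(2) this conjunct2[OF u]] show ?quad .
    next
      assume ?quad
      then show ?sol using quad[OF \<beta> \<eta>(2)] by simp
    qed
  qed (use \<beta> \<eta> in auto)
qed

end
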